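(* Let $p\equiv\pm 1\pmod{10}$ be a prime and $n$ a positive integer with $p<2^n$, and let $\mathcal{S}_{p,n}:=p^2 16^n+1$. Let $E_{30}$ be the elliptic curve $30y^2=x^3-x$ and let $Q:=p\cdot(5,2)\in E_{30}(\mathbb{Q}(i))$. Then $\mathcal{S}_{p,n}$ is prime if and only if $(1+i)^{4n-1}Q\equiv(0,0)\pmod{p4^n+i}$.
   Context: $E_{30}$ is a $\mathbb{Z}[i]$-module via the automorphism $i\colon(x,y)\mapsto(-x,iy)$ and the ring homomorphism $a+bi\mapsto a+b\circ i$ into its endomorphism ring; thus $(1+i)P=P+i(P)$. The congruence means: reducing the coordinates of $Q$ modulo the ideal $(p4^n+i)$ of $\mathbb{Z}[i]$ (note $\mathbb{Z}[i]/(p4^n+i)\cong\mathbb{Z}/\mathcal{S}_{p,n}\mathbb{Z}$) and applying the endomorphism $1+i$ successively $4n-1$ times, all computations are defined modulo $p4^n+i$ and the result is the point $(0,0)$. *)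

theory Defs
  imports "HOL-Number_Theory.Number_Theory"
begin

datatype 'a ecpt = Inf | Aff 'a 'a

text \<open>Group law on  A y^2 = x^3 - x  over a field (chord-tangent formulas).\<close>
fun ec_add :: "'a::field \<Rightarrow> 'a ecpt \<Rightarrow> 'a ecpt \<Rightarrow> 'a ecpt" where
  "ec_add A Inf P = P"
| "ec_add A (Aff x y) Inf = Aff x y"
| "ec_add A (Aff x1 y1) (Aff x2 y2) =
     (if x1 \<noteq> x2 then
        (let l = (y2 - y1) / (x2 - x1); x3 = A * l^2 - x1 - x2 in Aff x3 (l * (x1 - x3) - y1))
      else if y1 + y2 = 0 then Inf
      else
        (let l = (3 * x1^2 - 1) / (2 * A * y1); x3 = A * l^2 - 2 * x1 in Aff x3 (l * (x1 - x3) - y1)))"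

fun ec_mul :: "'a::field \<Rightarrow> nat \<Rightarrow> 'a ecpt \<Rightarrow> 'a ecpt" where
  "ec_mul A 0 P = Inf"
| "ec_mul A (Suc k) P = ec_add A P (ec_mul A k P)"

definition E30_Q :: "nat \<Rightarrow> rat ecpt" where
  "E30_Q p = ec_mul 30 p (Aff 5 2)"

definition inv_mod :: "int \<Rightarrow> int \<Rightarrow> int option" where
  "inv_mod N d = (if coprime d N then Some (SOME e. e \<in> {0..<N} \<and> [d * e = 1] (mod N)) else None)"

definition red_rat :: "int \<Rightarrow> rat \<Rightarrow> int option" where
  "red_rat N r = (case quotient_of r of (a, b) \<Rightarrow>
      (case inv_mod N b of None \<Rightarrow> None | Some e \<Rightarrow> Some ((a * e) mod N)))"

fun red_pt :: "int \<Rightarrow> rat ecpt \<Rightarrow> int ecpt option" where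
  "red_pt N Inf = Some Inf"
| "red_pt N (Aff x y) =
     (case (red_rat N x, red_rat N y) of
        (Some u, Some v) \<Rightarrow> Some (Aff u v)
      | _ \<Rightarrow> None)"

text \<open>Partial addition on  A y^2 = x^3 - x  modulo N; None = some needed inversion is undefined.\<close>
fun ecN_add :: "int \<Rightarrow> int \<Rightarrow> int ecpt \<Rightarrow> int ecpt \<Rightarrow> int ecpt option" where
  "ecN_add N A Inf P = Some P"
| "ecN_add N A (Aff x y) Inf = Some (Aff x y)"
| "ecN_add N A (Aff x1 y1) (Aff x2 y2) =
     (case inv_mod N (x2 - x1) of
        Some e \<Rightarrow>
          (let l = (y2 - y1) * e; x3 = (A * l^2 - x1 - x2) mod N
           in Some (Aff x3 ((l * (x1 - x3) - y1) mod N)))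
      | None \<Rightarrow>
          (if [x1 = x2] (mod N) \<and> [y1 + y2 = 0] (mod N) then Some Inf
           else if [x1 = x2] (mod N) \<and> [y1 = y2] (mod N) then
             (case inv_mod N (2 * A * y1) of
                Some e \<Rightarrow>
                  (let l = (3 * x1^2 - 1) * e; x3 = (A * l^2 - 2 * x1) mod N
                   in Some (Aff x3 ((l * (x1 - x3) - y1) mod N)))
              | None \<Rightarrow> None)
           else None))"

text \<open>The automorphism i:(x,y) \<mapsto> (-x, i y) modulo N, where c is the image of i in Z/N.\<close>
fun ecN_i :: "int \<Rightarrow> int \<Rightarrow> int ecpt \<Rightarrow> int ecpt" where
  "ecN_i N c Inf = Inf"
| "ecN_i N c (Aff x y) = Aff ((- x) mod N) ((c * y) mod N)"

definition one_plus_i :: "int \<Rightarrow> int \<Rightarrow> int ecpt \<Rightarrow> int ecpt option" where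
  "one_plus_i N c P = ecN_add N 30 P (ecN_i N c P)"

definition iter_one_plus_i :: "int \<Rightarrow> int \<Rightarrow> nat \<Rightarrow> int ecpt option \<Rightarrow> int ecpt option" where
  "iter_one_plus_i N c k = ((\<lambda>r. Option.bind r (one_plus_i N c)) ^^ k)"

text \<open>Z[i]/(p 4^n + i) \<cong> Z/S_{p,n}, with i \<mapsto> -p 4^n.  The congruence of the theorem:\<close>
definition congr_cond :: "nat \<Rightarrow> nat \<Rightarrow> bool" where
  "congr_cond p n =
     (let N = int (p^2 * 16^n + 1); c = (- int (p * 4^n)) mod N
      in iter_one_plus_i N c (4 * n - 1) (red_pt N (E30_Q p)) = Some (Aff 0 0))"

end

theory Submission
  imports
    Defs
    "HOL-Computational_Algebra.Polynomial_Factorial"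
    "Berlekamp_Zassenhaus.Finite_Field"
begin

text \<open>
  Let \<open>q\<close> be a prime factor of \<open>N = p^2 16^n + 1\<close> and \<open>\<theta> = 1 + i\<close>, acting on the points modulo \<open>q\<close>
  with kernel \<open>{0, (0,0)}\<close>.

  If the congruence holds, some point is killed by \<open>\<theta>^(4n)\<close> but not by \<open>\<theta>^(4n-1)\<close>; then the kernel of
  \<open>\<theta>^(4n)\<close> has \<open>16^n\<close> elements, so \<open>16^n \<le> 2 q + 1\<close>, which is impossible for \<open>q^2 \<le> N < 64^n\<close>.

  Conversely let \<open>q = N\<close> be prime and \<open>m = p 4^n\<close>. On the twist \<open>f Y^2 = X^3 - X\<close> over the function
  field \<open>F_q(x)\<close>, \<open>f = x^3 - x\<close>, the multiple \<open>1 + m i\<close> of the generic point \<open>(x, 1)\<close> has height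
  \<open>m^2 + 1 = q\<close> by the parallelogram law and zero differential, since \<open>i\<close> acts as \<open>m\<close> on differentials.
  So its abscissa is a Moebius transform of \<open>x^q\<close>, and the 2-torsion shows that it is \<open>x^q\<close>.
  Hence \<open>P + m i P\<close> is \<open>P\<close> or \<open>-P\<close> for every point \<open>P\<close> over \<open>F_q\<close>. As 6 is not a square modulo \<open>q\<close>,
  \<open>(5,2)\<close> is not divisible by \<open>\<theta>\<close>, and it follows that \<open>m\<close> kills all points. Jacobsthal's identity and
  the 2-power torsion give exactly \<open>q - 1 = p^2 16^n\<close> points, and with this count
  \<open>\<theta>^(4n-1) p (5,2)\<close> cannot vanish; it is therefore the nonzero element \<open>(0,0)\<close> of the kernel of \<open>\<theta>\<close>.
\<close>

subsection \<open>The group law on \<open>A y^2 = x^3 - x\<close>\<close>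

text \<open>Heights and reduction both come from one identity: the unordered pair of abscissas of
  \<open>P + Q\<close> and \<open>P - Q\<close> is given by three biquadratic forms in the abscissas
  of \<open>P\<close> and \<open>Q\<close>, without common zero outside characteristic 2. Comparing
  degrees over \<open>F_q(x)\<close> yields the parallelogram law; at a place it yields
  compatibility of reduction with addition, for the generic point as well as for
  \<open>p (5,2)\<close> over the rationals. The price is the sign of ordinates. It is harmless at
  the end since \<open>T = - T\<close>. In \<open>P + m i P = - P\<close> it is removed by
  divisibility: with \<open>m = 4 k\<close>, \<open>P + 2 k i P\<close> is 2-torsion, and as 30 is a
  square, all 2-torsion is divisible by \<theta>, hence so is \<open>P\<close>. The points outside
  the image of \<theta> are thus killed by \<open>m\<close>, and they generate the group. The point
  count rests on a prime \<open>q = m^2 + 1\<close> being a sum of two squares in one way only; this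
  leaves few values for the character sum, and divisibility of the count by 8 selects one. The last
  digit of \<open>p\<close> makes \<open>N\<close> a nonresidue modulo 5, as it is modulo 3; since 2
  is a residue modulo \<open>q\<close>, 6 is a nonresidue and 30 a residue.\<close>

fun on_curve :: "'a::field \<Rightarrow> 'a ecpt \<Rightarrow> bool" where
  "on_curve A Inf = True"
| "on_curve A (Aff x y) = (A * y^2 = x^3 - x)"

fun ec_neg :: "'a::field ecpt \<Rightarrow> 'a ecpt" where
  "ec_neg Inf = Inf"
| "ec_neg (Aff x y) = Aff x (- y)"

text \<open>Chord and tangent slopes both satisfy these two equations, and over a curve point they
  determine the slope; this avoids the case distinction of the addition formulas.\<close>
definition is_slope :: "'a::field \<Rightarrow> 'a \<Rightarrow> 'a \<Rightarrow> 'a \<Rightarrow> 'a \<Rightarrow> 'a \<Rightarrow> bool" where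
  "is_slope A l x1 y1 x2 y2 \<longleftrightarrow>
     l * (x2 - x1) = y2 - y1 \<and> A * l * (y1 + y2) = x1^2 + x1 * x2 + x2^2 - 1"

lemma ec_neg_neg [simp]: "ec_neg (ec_neg P) = P"
  by (cases P) auto

lemma on_curve_neg [simp]: "on_curve A (ec_neg P) = on_curve A P"
  by (cases P) auto

lemma ec_add_Inf_right [simp]: "ec_add A P Inf = P"
  by (cases P) auto

lemma ec_add_neg_right [simp]: "ec_add A P (ec_neg P) = Inf"
  by (cases P) auto

lemma ec_add_neg_left [simp]: "ec_add A (ec_neg P) P = Inf"
  by (cases P) auto

locale ec_field =
  fixes A :: "'a::field"
  assumes A_nz: "A \<noteq> 0" and two_nz: "(2::'a) \<noteq> 0"
begin

text \<open>This is nonsingularity: opposite points with a slope would have \<open>y1 = 0\<close>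
  and \<open>3 * x1^2 = 1\<close>, so \<open>x1\<close> would be a common root of
  \<open>x^3 - x\<close> and its derivative.\<close>

lemma slope_not_opposite:
  assumes "is_slope A l x1 y1 x2 y2" "on_curve A (Aff x1 y1)"
  shows "\<not> (x1 = x2 \<and> y1 + y2 = 0)"
proof
  assume h: "x1 = x2 \<and> y1 + y2 = 0"
  have x: "x2 = x1" using h by simp
  have e: "y2 = y1" using assms(1) unfolding is_slope_def x by simp
  have "0 = x1^2 + x1 * x1 + x1^2 - 1" using assms(1) h unfolding is_slope_def x by simp
  then have t: "3 * x1^2 = 1" by (simp add: power2_eq_square)
  have "2 * y1 = 0" using h unfolding e mult_2 by (rule conjunct2)
  then have "y1 = 0" using two_nz by simp
  have "x1 * (x1^2 - 1) = x1^3 - x1" by (simp add: algebra_simps power2_eq_square power3_eq_cube)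
  also have "\<dots> = 0" using assms(2) \<open>y1 = 0\<close> by simp
  finally have "x1 * (x1^2 - 1) = 0" .
  then have "x1 = 0 \<or> x1^2 = 1" unfolding mult_eq_0_iff right_minus_eq .
  then show False
  proof
    assume "x1 = 0"
    then show False using t by simp
  next
    assume "x1^2 = 1"
    then have "(3::'a) = 1" using t by simp
    then have "(2::'a) + 1 = 0 + 1" by simp
    then show False using two_nz by (simp only: add_right_cancel)
  qed
qed

lemma ec_add_slope:
  assumes "is_slope A l x1 y1 x2 y2" "on_curve A (Aff x1 y1)"
  shows "ec_add A (Aff x1 y1) (Aff x2 y2) =
    Aff (A * l^2 - x1 - x2) (l * (x1 - (A * l^2 - x1 - x2)) - y1)"
proof (cases "x1 = x2")
  case False
  then have "(y2 - y1) / (x2 - x1) = l" using assms(1) by (simp add: is_slope_def field_simps)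
  then show ?thesis using False by (simp add: Let_def)
next
  case True
  with slope_not_opposite[OF assms] have s: "y1 + y2 \<noteq> 0" by auto
  from True assms(1) have e: "y2 = y1" by (simp add: is_slope_def)
  with s have y: "y1 \<noteq> 0" by auto
  from True have x2: "x2 = x1" by simp
  have "A * l * (y1 + y1) = x1^2 + x1 * x1 + x1^2 - 1"
    using assms(1) unfolding is_slope_def e x2 by (rule conjunct2)
  then have num: "3 * x1^2 - 1 = l * (2 * A * y1)" by Groebner_Basis.algebra
  have nz: "2 * A * y1 \<noteq> 0" using y A_nz two_nz by simp
  have "(3 * x1^2 - 1) / (2 * A * y1) = l" unfolding num by (rule nonzero_mult_div_cancel_right[OF nz])
  then show ?thesis using s unfolding e x2 by (simp add: Let_def)
qed

lemma slope_exists: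
  assumes "on_curve A (Aff x1 y1)" "on_curve A (Aff x2 y2)" "\<not> (x1 = x2 \<and> y1 + y2 = 0)"
  obtains l where "is_slope A l x1 y1 x2 y2"
proof (cases "x1 = x2")
  case False
  define l where "l = (y2 - y1) / (x2 - x1)"
  have l: "l * (x2 - x1) = y2 - y1" using False by (simp add: l_def)
  have "(x2 - x1) * (A * l * (y1 + y2)) = A * y2^2 - A * y1^2" using l by Groebner_Basis.algebra
  also have "\<dots> = (x2 - x1) * (x1^2 + x1 * x2 + x2^2 - 1)"
    using assms(1,2) unfolding on_curve.simps by Groebner_Basis.algebra
  finally have "A * l * (y1 + y2) = x1^2 + x1 * x2 + x2^2 - 1" using False by simp
  with l show ?thesis by (intro that[of l]) (simp add: is_slope_def)
next
  case True
  have "A * y1^2 = A * y2^2" using True assms(1,2) by simp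
  then have "(y1 - y2) * (y1 + y2) = 0" using A_nz by (simp add: algebra_simps power2_eq_square)
  then have e: "y2 = y1" using assms(3) True by auto
  then have y: "y1 \<noteq> 0" using assms(3) True by auto
  show ?thesis
    by (rule that[of "(3 * x1^2 - 1) / (2 * A * y1)"])
       (use True e y A_nz two_nz in \<open>simp add: is_slope_def field_simps power2_eq_square\<close>)
qed

text \<open>Vieta: the line through the two points meets the curve in \<open>x1\<close>, \<open>x2\<close> and \<open>x3\<close>.\<close>
lemma slope_vieta:
  assumes "is_slope A l x1 y1 x2 y2" "on_curve A (Aff x1 y1)"
    and "x3 = A * l^2 - x1 - x2"
  shows "x1 * x2 + (x1 + x2) * x3 = - 1 - 2 * A * l * (y1 - l * x1)"
    and "x1 * x2 * x3 = A * (y1 - l * x1)^2"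
proof -
  have y2: "y2 = y1 + l * (x2 - x1)" using assms(1) by (simp add: is_slope_def)
  have s: "A * l * (2 * y1 + l * (x2 - x1)) = x1^2 + x1 * x2 + x2^2 - 1"
    using assms(1) unfolding y2 is_slope_def by (simp add: algebra_simps)
  show v: "x1 * x2 + (x1 + x2) * x3 = - 1 - 2 * A * l * (y1 - l * x1)"
    using s unfolding assms(3) by (simp add: algebra_simps power2_eq_square)
  have "x1 * x2 * x3 = x1 * (x1 * x2 + (x1 + x2) * x3) - x1^2 * (x1 + x2 + x3) + x1^3"
    by (simp add: algebra_simps power2_eq_square power3_eq_cube)
  also have "\<dots> = x1^3 - x1 - 2 * A * l * x1 * (y1 - l * x1) - x1^2 * (A * l^2)"
    unfolding v by (simp add: assms(3) algebra_simps power2_eq_square)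
  also have "\<dots> = A * (y1 - l * x1)^2"
    using assms(2) by (simp add: algebra_simps power2_eq_square)
  finally show "x1 * x2 * x3 = A * (y1 - l * x1)^2" .
qed

lemma on_curve_slope:
  assumes "is_slope A l x1 y1 x2 y2" "on_curve A (Aff x1 y1)"
    and x3: "x3 = A * l^2 - x1 - x2" and y3: "y3 = l * (x1 - x3) - y1"
  shows "on_curve A (Aff x3 y3)"
proof -
  note v = slope_vieta[OF assms(1,2) x3]
  have "x3^3 = x3^2 * (x1 + x2 + x3) - x3 * (x1 * x2 + (x1 + x2) * x3) + x1 * x2 * x3"
    by (simp add: algebra_simps power2_eq_square power3_eq_cube)
  also have "\<dots> = x3^2 * (A * l^2) + x3 * (1 + 2 * A * l * (y1 - l * x1)) + A * (y1 - l * x1)^2"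
    unfolding v by (simp add: x3 algebra_simps)
  finally show ?thesis by (simp add: y3 algebra_simps power2_eq_square)
qed

lemma on_curve_add:
  assumes "on_curve A P" "on_curve A Q"
  shows "on_curve A (ec_add A P Q)"
proof (cases "P = Inf \<or> Q = Inf")
  case True
  then show ?thesis using assms by (cases P; cases Q) auto
next
  case False
  then obtain x1 y1 x2 y2 where PQ: "P = Aff x1 y1" "Q = Aff x2 y2" by (cases P; cases Q) auto
  show ?thesis
  proof (cases "x1 = x2 \<and> y1 + y2 = 0")
    case True
    then show ?thesis by (simp add: PQ)
  next
    case False
    then obtain l where "is_slope A l x1 y1 x2 y2" using slope_exists assms PQ by blast
    then show ?thesis using on_curve_slope ec_add_slope assms PQ by simp
  qed
qed

lemma is_slope_sym: "is_slope A l x1 y1 x2 y2 \<longleftrightarrow> is_slope A l x2 y2 x1 y1"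
  unfolding is_slope_def by (auto simp: algebra_simps power2_eq_square)

lemma ec_add_commute:
  assumes "on_curve A P" "on_curve A Q"
  shows "ec_add A P Q = ec_add A Q P"
proof (cases "P = Inf \<or> Q = Inf")
  case True
  then show ?thesis by auto
next
  case False
  then obtain x1 y1 x2 y2 where PQ: "P = Aff x1 y1" "Q = Aff x2 y2" by (cases P; cases Q) auto
  show ?thesis
  proof (cases "x1 = x2 \<and> y1 + y2 = 0")
    case True
    then show ?thesis by (simp add: PQ add.commute)
  next
    case False
    then obtain l where l: "is_slope A l x1 y1 x2 y2" using slope_exists assms PQ by blast
    then have l': "is_slope A l x2 y2 x1 y1" by (simp add: is_slope_sym)
    have y2: "y2 = y1 + l * (x2 - x1)" using l by (simp add: is_slope_def)
    show ?thesis using ec_add_slope[OF l] ec_add_slope[OF l'] assms unfolding PQ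
      by (auto simp: y2 algebra_simps)
  qed
qed

text \<open>The line through \<open>P\<close> and \<open>Q\<close> meets the curve again in the
  negative of \<open>P + Q\<close>. Its mirror image passes through \<open>P + Q\<close>,
  \<open>- Q\<close> and \<open>- P\<close>, so \<open>- l\<close> is the slope needed for the
  second addition.\<close>

lemma ec_add_cancel:
  assumes "on_curve A P" "on_curve A Q"
  shows "ec_add A (ec_add A P Q) (ec_neg Q) = P"
proof (cases "P = Inf \<or> Q = Inf")
  case True
  then show ?thesis by auto
next
  case False
  then obtain x1 y1 x2 y2 where PQ: "P = Aff x1 y1" "Q = Aff x2 y2" by (cases P; cases Q) auto
  show ?thesis
  proof (cases "x1 = x2 \<and> y1 + y2 = 0")
    case True
    then have "y2 = - y1" by (simp add: eq_neg_iff_add_eq_0 add.commute)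
    with True show ?thesis by (simp add: PQ)
  next
    case False
    then obtain l where l: "is_slope A l x1 y1 x2 y2" using slope_exists assms PQ by blast
    define x3 y3 where x3: "x3 = A * l^2 - x1 - x2" and y3: "y3 = l * (x1 - x3) - y1"
    have c1: "on_curve A (Aff x1 y1)" using assms PQ by simp
    have sum: "ec_add A P Q = Aff x3 y3" using ec_add_slope[OF l c1] unfolding PQ x3 y3 .
    have c3: "on_curve A (Aff x3 y3)" by (rule on_curve_slope[OF l c1 x3 y3])
    note v = slope_vieta(1)[OF l c1 x3]
    have y2: "y2 = y1 + l * (x2 - x1)" using l by (simp add: is_slope_def)
    have "A * l^2 = x1 + x2 + x3" by (simp add: x3)
    then have "A * (- l) * (y3 + - y2) = x3^2 + x3 * x2 + x2^2 - 1"
      using v y2 y3 by Groebner_Basis.algebra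
    moreover have "- l * (x2 - x3) = - y2 - y3" by (simp add: y2 y3 algebra_simps)
    ultimately have l3: "is_slope A (- l) x3 y3 x2 (- y2)" by (simp only: is_slope_def)
    have X: "A * (- l)^2 - x3 - x2 = x1" by (simp add: x3)
    have Y: "- l * (x3 - x1) - y3 = y1" by (simp add: y3 algebra_simps)
    show ?thesis
      unfolding sum unfolding PQ ec_neg.simps ec_add_slope[OF l3 c3] X Y ..
  qed
qed

lemma ec_add_cancel':
  assumes "on_curve A P" "on_curve A Q"
  shows "ec_add A (ec_add A P (ec_neg Q)) Q = P"
  using ec_add_cancel[of P "ec_neg Q"] assms by simp

text \<open>The parabola through the three points meets the curve in the negative of their sum;
  \<open>r\<close> is its leading coefficient.\<close>
lemma ec_add_assoc_generic:
  assumes c1: "on_curve A (Aff x1 y1)"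
    and l: "is_slope A l x1 y1 x2 y2" and m: "is_slope A m x2 y2 x3 y3" and x31: "x3 \<noteq> x1"
    and r: "r = (m - l) / (x3 - x1)" and r0: "r \<noteq> 0"
  shows "ec_add A (ec_add A (Aff x1 y1) (Aff x2 y2)) (Aff x3 y3) =
    (let x = 1 / (A * r^2) - 2 * l / r + x1 + x2 - x3 in 
      Aff x ((1 / (A * r) - l) * (x3 - x) - y3))"
proof -
  define x4 y4 where x4: "x4 = A * l^2 - x1 - x2" and y4: "y4 = l * (x1 - x4) - y1"
  have sum: "ec_add A (Aff x1 y1) (Aff x2 y2) = Aff x4 y4" using ec_add_slope[OF l c1] unfolding x4 y4 .
  have c4: "on_curve A (Aff x4 y4)" by (rule on_curve_slope[OF l c1 x4 y4])
  \<comment> \<open>The ordinate at \<open>x3\<close> of the line of slope \<open>l\<close>. As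
    \<open>r\<close> is the second divided difference,
    \<open>y3 - z = r * (x3 - x1) * (x3 - x2)\<close> is Newton interpolation.\<close>
  define z where "z = y1 + l * (x3 - x1)"
  have y2: "y2 = y1 + l * (x2 - x1)" using l by (simp add: is_slope_def)
  have m1: "m * (x3 - x2) = y3 - y2" using m by (simp add: is_slope_def)
  have rr: "r * (x3 - x1) = m - l" using x31 by (simp add: r)
  have y3: "y3 = z + r * (x3 - x1) * (x3 - x2)"
    unfolding rr z_def using m1 by (simp add: y2 algebra_simps)
  have ls: "A * l * (y1 + y2) = x1^2 + x1 * x2 + x2^2 - 1" using l by (simp add: is_slope_def)
  have ms: "A * m * (y2 + y3) = x2^2 + x2 * x3 + x3^2 - 1" using m by (simp add: is_slope_def)
  have "(x3 - x1) * (A * r * (y3 + z)) = A * (r * (x3 - x1)) * (y3 + z)" by (simp add: algebra_simps)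
  also have "\<dots> = A * m * (y2 + y3) + A * l * (m * (x3 - x2)) - A * l * (y3 + z)"
    unfolding rr by (simp add: z_def y2 algebra_simps)
  also have "\<dots> = (x2^2 + x2 * x3 + x3^2 - 1) - A * l * (y1 + y2) - A * l * (l * (x3 - x1))"
    unfolding ms m1 by (simp add: z_def algebra_simps)
  also have "\<dots> = (x3 - x1) * (x3 - x4)"
    unfolding ls x4 by (simp add: algebra_simps power2_eq_square)
  finally have B: "A * r * (y3 + z) = x3 - x4" using x31 by simp
  \<comment> \<open>The slope from \<open>P1 + P2\<close> to \<open>P3\<close>: subtract
    \<open>z + y4 = l * (x3 - x4)\<close> from \<open>y3 + z = (x3 - x4) / (A * r)\<close>.\<close>
  define n where "n = 1 / (A * r) - l"
  have yz: "y3 + z = (x3 - x4) / (A * r)" using B A_nz r0 by (simp add: field_simps)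
  have zy4: "z + y4 = l * (x3 - x4)" by (simp add: z_def y4 algebra_simps)
  have "n * (x3 - x4) = (y3 + z) - l * (x3 - x4)" unfolding yz n_def by (simp add: algebra_simps)
  also have "\<dots> = y3 - y4" using zy4 by (simp add: algebra_simps)
  finally have n1: "n * (x3 - x4) = y3 - y4" .
  note v = slope_vieta(1)[OF l c1 x4]
  have "A * n * r = 1 - A * r * l" unfolding n_def using A_nz r0 by (simp add: field_simps)
  have yy: "y4 + y3 = r * (x3 - x1) * (x3 - x2) + l * (x3 - x4)"
    using zy4 y3 by Groebner_Basis.algebra
  have "A * n * (y4 + y3) = (1 - A * r * l) * (x3 - x1) * (x3 - x2) + (A * n) * l * (x3 - x4)"
    unfolding yy \<open>A * n * r = 1 - A * r * l\<close>[symmetric] by (simp add: algebra_simps)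
  also have "(A * n) * l * (x3 - x4) = A * l * (y3 - y4)" using n1 by Groebner_Basis.algebra
  also have "(1 - A * r * l) * (x3 - x1) * (x3 - x2) = (x3 - x1) * (x3 - x2) - A * l * (y3 - z)"
    unfolding y3 by (simp add: algebra_simps)
  also have "(x3 - x1) * (x3 - x2) - A * l * (y3 - z) + A * l * (y3 - y4) =
     (x3 - x1) * (x3 - x2) + A * l * (z - y4)" by (simp add: algebra_simps)
  also have "\<dots> = (x3 - x1) * (x3 - x2) + 2 * A * l * (y1 - l * x1) + A * l^2 * (x3 + x4)"
    by (simp add: z_def y4 algebra_simps power2_eq_square)
  also have "2 * A * l * (y1 - l * x1) = - 1 - (x1 * x2 + (x1 + x2) * x4)" unfolding v by simp
  also have "A * l^2 = x1 + x2 + x4" by (simp add: x4)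
  finally have n2: "A * n * (y4 + y3) = x4^2 + x4 * x3 + x3^2 - 1"
    by (simp add: algebra_simps power2_eq_square)
  have n: "is_slope A n x4 y4 x3 y3" unfolding is_slope_def using n1 n2 by simp
  have X: "A * n^2 - x4 - x3 = 1 / (A * r^2) - 2 * l / r + x1 + x2 - x3"
    unfolding n_def x4 using A_nz r0 by (simp add: field_simps power2_eq_square)
  define x where "x = 1 / (A * r^2) - 2 * l / r + x1 + x2 - x3"
  have "n * (x4 - x) - y4 = n * (x3 - x) - y3" using n1 by (simp add: algebra_simps)
  then show ?thesis
    unfolding sum ec_add_slope[OF n c4] X by (simp add: x_def n_def Let_def)
qed

text \<open>The case in which the parabola degenerates to a line: the third intersection with the
  curve is the third point itself.\<close>

lemma collinear_sum:
  assumes c1: "on_curve A (Aff x1 y1)"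
    and l: "is_slope A l x1 y1 x2 y2" and m: "is_slope A l x2 y2 x3 y3" and x31: "x3 \<noteq> x1"
  shows "ec_add A (Aff x1 y1) (Aff x2 y2) = ec_neg (Aff x3 y3)"
proof -
  have y2: "y2 = y1 + l * (x2 - x1)" using l by (simp add: is_slope_def)
  have y3: "y3 = y2 + l * (x3 - x2)" using m by (simp add: is_slope_def)
  have ls: "A * l * (y1 + y2) = x1^2 + x1 * x2 + x2^2 - 1" using l by (simp add: is_slope_def)
  have ms: "A * l * (y2 + y3) = x2^2 + x2 * x3 + x3^2 - 1" using m by (simp add: is_slope_def)
  have "A * l * (y2 + y3) - A * l * (y1 + y2) = A * l^2 * (x3 - x1)"
    by (simp add: y2 y3 algebra_simps power2_eq_square)
  then have "(x3 - x1) * (A * l^2) = (x3 - x1) * (x1 + x2 + x3)"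
    unfolding ls ms by (simp add: algebra_simps power2_eq_square)
  then have e: "A * l^2 = x1 + x2 + x3" using x31 by simp
  show ?thesis unfolding ec_add_slope[OF l c1] e by (simp add: y3 y2 algebra_simps)
qed

text \<open>The formula of \<open>ec_add_assoc_generic\<close> is symmetric in the first and third
  point: exchanging them swaps \<open>l\<close> with \<open>m\<close> and keeps \<open>r\<close>. So
  \<open>(P1 + P2) + P3 = (P3 + P2) + P1\<close>, and commutativity finishes.\<close>

lemma ec_add_assoc_aux:
  assumes c: "on_curve A P1" "on_curve A P2" "on_curve A P3"
    and "P1 \<noteq> Inf" "P2 \<noteq> Inf" "P3 \<noteq> Inf" "P2 \<noteq> ec_neg P1" "P3 \<noteq> ec_neg P2" "P3 \<noteq> P1" "P3 \<noteq> ec_neg P1"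
  shows "ec_add A (ec_add A P1 P2) P3 = ec_add A P1 (ec_add A P2 P3)"
proof -
  obtain x1 y1 x2 y2 x3 y3 where P: "P1 = Aff x1 y1" "P2 = Aff x2 y2" "P3 = Aff x3 y3"
    using assms(4,5,6) by (cases P1; cases P2; cases P3) auto
  note c1 = c(1)[unfolded P] and c2 = c(2)[unfolded P] and c3 = c(3)[unfolded P]
  have "\<not> (x1 = x2 \<and> y1 + y2 = 0)" using assms(7) by (auto simp: P eq_neg_iff_add_eq_0 add.commute)
  then obtain l where l: "is_slope A l x1 y1 x2 y2" using slope_exists c1 c2 by blast
  have "\<not> (x2 = x3 \<and> y2 + y3 = 0)" using assms(8) by (auto simp: P eq_neg_iff_add_eq_0 add.commute)
  then obtain m where m: "is_slope A m x2 y2 x3 y3" using slope_exists c2 c3 by blast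
  have x31: "x3 \<noteq> x1"
  proof
    assume e: "x3 = x1"
    have "A * y1^2 = A * y3^2" using e c1 c3 by simp
    then have "(y3 - y1) * (y3 + y1) = 0" using A_nz by (simp add: algebra_simps power2_eq_square)
    then show False using assms(9,10) e by (auto simp: P eq_neg_iff_add_eq_0)
  qed
  define r where "r = (m - l) / (x3 - x1)"
  have r': "r = (l - m) / (x1 - x3)" unfolding r_def by (metis minus_diff_eq minus_divide_divide)
  have m': "is_slope A m x3 y3 x2 y2" and l': "is_slope A l x2 y2 x1 y1" using l m by (auto simp: is_slope_sym)
  have R: "ec_add A P1 (ec_add A P2 P3) = ec_add A (ec_add A P3 P2) P1"
    using c on_curve_add ec_add_commute by metis
  show ?thesis
  proof (cases "r = 0")
    case True
    then have ml: "m = l" using x31 by (auto simp: r_def)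
    have "ec_add A P1 P2 = ec_neg P3" "ec_add A P3 P2 = ec_neg P1"
      unfolding P using collinear_sum[OF c1 l m[unfolded ml] x31]
        collinear_sum[OF c3 m'[unfolded ml] l'] x31 by auto
    then show ?thesis unfolding R by simp
  next
    case False
    define x where "x = 1 / (A * r^2) - 2 * l / r + x1 + x2 - x3"
    have "x3 - x1 = m / r - l / r" 
      using False x31 unfolding r_def diff_divide_distrib[symmetric] by simp
    then have x': "1 / (A * r^2) - 2 * m / r + x3 + x2 - x1 = x"
      unfolding x_def times_divide_eq_right[symmetric] by Groebner_Basis.algebra
    have y: "y3 = y2 + m * (x3 - x2)" "y2 = y1 + l * (x2 - x1)" using l m by (auto simp: is_slope_def)
    have xx: "1 / A / r = (x - x2 - x1 + x3) * r + 2 * l" unfolding x_def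
      using False A_nz by (simp add: field_simps power2_eq_square)
    have rx: "m = l + r * (x3 - x1)" using x31 by (simp add: r_def)
    have yy: "(1 / (A * r) - l) * (x3 - x) - y3 = (1 / (A * r) - m) * (x1 - x) - y1"
      unfolding y divide_divide_eq_left[symmetric] xx unfolding rx
      by (simp add: algebra_simps)
    show ?thesis
      unfolding R unfolding P ec_add_assoc_generic[OF c1 l m x31 r_def False]
        ec_add_assoc_generic[OF c3 m' l' x31[symmetric] r' False]
      by (simp add: Let_def x' yy flip: x_def)
  qed
qed

text \<open>The configurations that the parabola misses need no further geometry: commutativity and
  cancellation settle each of them.\<close>

lemma ec_add_assoc:
  assumes c: "on_curve A P1" "on_curve A P2" "on_curve A P3"
  shows "ec_add A (ec_add A P1 P2) P3 = ec_add A P1 (ec_add A P2 P3)"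
proof -
  note comm = ec_add_commute[OF _ _] and oc = on_curve_add
  consider "P1 = Inf \<or> P2 = Inf \<or> P3 = Inf" | "P2 = ec_neg P1" | "P3 = ec_neg P2" | "P3 = P1" | "P3 = ec_neg P1"
    | "P1 \<noteq> Inf" "P2 \<noteq> Inf" "P3 \<noteq> Inf" "P2 \<noteq> ec_neg P1" "P3 \<noteq> ec_neg P2" "P3 \<noteq> P1" "P3 \<noteq> ec_neg P1"
    by blast
  then show ?thesis
  proof cases
    case 1
    then show ?thesis by auto
  next
    case 2
    have "ec_add A P1 (ec_add A (ec_neg P1) P3) = ec_add A (ec_add A P3 (ec_neg P1)) P1"
      using c comm oc by (metis on_curve_neg)
    then show ?thesis using 2 c by (simp add: ec_add_cancel')
  next
    case 3
    then show ?thesis using c by (simp add: ec_add_cancel)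
  next
    case 4
    then show ?thesis using c comm oc by metis
  next
    case 5
    have "ec_add A (ec_add A P1 P2) (ec_neg P1) = ec_add A (ec_add A P2 P1) (ec_neg P1)"
      using c comm by metis
    moreover have "ec_add A P1 (ec_add A P2 (ec_neg P1)) = ec_add A (ec_add A P2 (ec_neg P1)) P1"
      using c comm oc by (metis on_curve_neg)
    ultimately show ?thesis using 5 c by (simp add: ec_add_cancel ec_add_cancel')
  next
    case 6
    then show ?thesis by (intro ec_add_assoc_aux c)
  qed
qed

end

subsection \<open>Kummer coordinates and reduction\<close>

text \<open>\<open>(U : V)\<close> is the image of the point on the projective \<open>x\<close>-line (its Kummer coordinate).\<close>
fun kum :: "'a::field ecpt \<Rightarrow> 'a \<Rightarrow> 'a \<Rightarrow> bool" where
  "kum Inf U V = (V = 0 \<and> U \<noteq> 0)"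
| "kum (Aff x y) U V = (V \<noteq> 0 \<and> U = x * V)"

lemma kum_nonzero: "kum P U V \<Longrightarrow> U \<noteq> 0 \<or> V \<noteq> 0"
  by (cases P) auto

lemma kum_scale: "kum P U V \<Longrightarrow> U = k * U' \<Longrightarrow> V = k * V' \<Longrightarrow> kum P U' V'"
  by (cases P) auto

lemma kum_prop:
  assumes "kum P U V" "U * V' = U' * V" "U' \<noteq> 0 \<or> V' \<noteq> 0"
  shows "kum P U' V'"
  using assms by (cases P) (auto simp: mult_ac)

lemma kum_cross: "kum P U V \<Longrightarrow> kum P U' V' \<Longrightarrow> U * V' = U' * V"
  by (cases P) auto

lemma linear_forms_nonzero:
  fixes U V U' V' :: "'a::idom"
  assumes "U \<noteq> 0 \<or> V \<noteq> 0" "U' \<noteq> 0 \<or> V' \<noteq> 0"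
  shows "V * V' \<noteq> 0 \<or> U * V' + U' * V \<noteq> 0 \<or> U * U' \<noteq> 0"
  using assms by auto

section \<open>The sum and difference law on Kummer coordinates\<close>

context ec_field
begin

lemma four_nz: "(4::'a) \<noteq> 0"
proof -
  have "(2::'a) * 2 \<noteq> 0" using two_nz by (simp only: mult_eq_0_iff) simp
  moreover have "(2::'a) * 2 = 4" by simp
  ultimately show ?thesis by metis
qed

text \<open>At a common zero both arguments are the same abscissa \<open>t\<close> with
  \<open>t^2 = - 1\<close> and \<open>4 * t * (t^2 - 1) = 0\<close>, impossible when 2 is
  invertible. Heights and reduction both rest on this: the three forms of
  \<open>kummer_sum_diff\<close> cannot vanish together at any place.\<close>

lemma kummer_no_base_point:
  fixes U1 V1 U2 V2 :: 'a
  assumes "U1 \<noteq> 0 \<or> V1 \<noteq> 0" "U2 \<noteq> 0 \<or> V2 \<noteq> 0"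
  shows "(U1 * V2 - U2 * V1)^2 \<noteq> 0 \<or> 2 * (U1 * V2 + U2 * V1) * (U1 * U2 - V1 * V2) \<noteq> 0 \<or>
    (U1 * U2 + V1 * V2)^2 \<noteq> 0"
proof (rule ccontr)
  assume "\<not> ?thesis"
  then have a: "U1 * V2 = U2 * V1" and b2: "2 * (U1 * V2 + U2 * V1) * (U1 * U2 - V1 * V2) = 0"
    and c: "U1 * U2 = - (V1 * V2)"
    unfolding eq_neg_iff_add_eq_0 by (auto simp only: power_eq_0_iff right_minus_eq)
  have b: "(U1 * V2 + U2 * V1) * (U1 * U2 - V1 * V2) = 0"
    using b2 two_nz by (simp only: mult_eq_0_iff) simp
  have "4 * (U1 * V2 * (V1 * V2)) = 0" using b unfolding c a by Groebner_Basis.algebra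
  then have z: "U1 * V2 * (V1 * V2) = 0" using four_nz by simp
  show False
  proof (cases "V2 = 0")
    case True
    then show ?thesis using a c assms by auto
  next
    case False
    then show ?thesis using z a c assms by auto
  qed
qed

lemma double_x:
  assumes "on_curve A (Aff x y)" "y \<noteq> 0"
  obtains y' where "ec_add A (Aff x y) (Aff x y) = Aff ((x^2 + 1)^2 / (4 * (x^3 - x))) y'"
proof -
  have "y + y \<noteq> 0" using assms(2) two_nz by (simp flip: mult_2)
  then obtain l where l: "is_slope A l x y x y" using slope_exists[of x y x y] assms by auto
  have e: "A * l * (2 * y) = 3 * x^2 - 1" using l unfolding is_slope_def by Groebner_Basis.algebra
  have c: "A * y^2 = x^3 - x" using assms by simp
  have nz: "4 * (x^3 - x) \<noteq> 0"
  proof -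
show ?thesis using four_nz c assms(2) A_nz by (metis mult_eq_0_iff power_not_zero)
  qed
  have "(A * l^2 - x - x) * (4 * (x^3 - x)) = (A * l * (2 * y))^2 - 8 * x * (x^3 - x)"
    unfolding c[symmetric] by (simp add: algebra_simps power2_eq_square)
  also have "\<dots> = (x^2 + 1)^2" unfolding e by Groebner_Basis.algebra
  finally have "A * l^2 - x - x = (x^2 + 1)^2 / (4 * (x^3 - x))"
    using nz by (metis nonzero_mult_div_cancel_right)
  then show ?thesis using that ec_add_slope[OF l assms(1)] by metis
qed

lemma kummer_double:
  assumes "on_curve A (Aff x y)" "kum (Aff x y) U1 V1" "kum (Aff x y) U2 V2" 
    "kum (ec_add A (Aff x y) (Aff x y)) U3 V3" "kum Inf U4 V4"
  shows "\<exists>k. k \<noteq> 0 \<and> V3 * V4 = k * (U1 * V2 - U2 * V1)^2 \<and>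
    U3 * V4 + U4 * V3 = k * (2 * (U1 * V2 + U2 * V1) * (U1 * U2 - V1 * V2)) \<and>
    U3 * U4 = k * (U1 * U2 + V1 * V2)^2"
proof -
  have 1: "V1 \<noteq> 0" "V2 \<noteq> 0" "U1 = x * V1" "U2 = x * V2" "V4 = 0" "U4 \<noteq> 0" using assms by auto
  have c: "A * y^2 = x^3 - x" using assms by simp
  have T2: "2 * (U1 * V2 + U2 * V1) * (U1 * U2 - V1 * V2) = (V1 * V2)^2 * (4 * (x^3 - x))"
    unfolding 1 by (simp add: algebra_simps power2_eq_square power3_eq_cube)
  have T3: "(U1 * U2 + V1 * V2)^2 = (V1 * V2)^2 * (x^2 + 1)^2"
    unfolding 1 by (simp add: algebra_simps power2_eq_square)
  have T1: "(U1 * V2 - U2 * V1)^2 = 0" unfolding 1 by simp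
  show ?thesis
  proof (cases "y = 0")
    case False
    then have nz: "4 * (x^3 - x) \<noteq> 0" using c A_nz four_nz by (metis mult_eq_0_iff power_not_zero)
    obtain y' where "ec_add A (Aff x y) (Aff x y) = Aff ((x^2 + 1)^2 / (4 * (x^3 - x))) y'"
      using double_x[OF assms(1) False] .
    then have 3: "V3 \<noteq> 0" "U3 = (x^2 + 1)^2 / (4 * (x^3 - x)) * V3" using assms(4) by auto
    define d where "d = 4 * (x^3 - x)"
    have d: "d \<noteq> 0" using nz d_def by simp
    show ?thesis unfolding T1 T2 T3 unfolding 3(2) d_def[symmetric]
      by (rule exI[of _ "U4 * V3 / ((V1 * V2)^2 * d)"]) (use 1 3 d in simp)
  next
    case True
    then have 3: "V3 = 0" "U3 \<noteq> 0" using assms(4) by auto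
    have z: "x^3 - x = 0" using c True by simp
    then have "x * (x^2 - 1) = 0" by (simp add: algebra_simps power2_eq_square power3_eq_cube)
    then have "x = 0 \<or> x^2 = 1" by auto
    then have "x^2 + 1 \<noteq> 0" using two_nz by auto
    then show ?thesis unfolding T1 T2 T3 z
      by (intro exI[of _ "U3 * U4 / ((V1 * V2)^2 * (x^2 + 1)^2)"]) (use 1 3 in simp)
  qed
qed

text \<open>Sum and product of the abscissas of \<open>P + Q\<close> and \<open>P - Q\<close>
  contain the ordinates only through their squares, hence are rational in \<open>x1\<close> and
  \<open>x2\<close>. Homogenised, the statement covers points at infinity and doubling as well, and
  \<open>k\<close> absorbs the scaling of the coordinates.\<close>

lemma kummer_sum_diff:
  assumes P: "on_curve A P" and Q: "on_curve A Q" and kum: "kum P U1 V1" "kum Q U2 V2" 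
    "kum (ec_add A P Q) U3 V3" "kum (ec_add A P (ec_neg Q)) U4 V4"
  shows "\<exists>k. k \<noteq> 0 \<and> V3 * V4 = k * (U1 * V2 - U2 * V1)^2 \<and>
    U3 * V4 + U4 * V3 = k * (2 * (U1 * V2 + U2 * V1) * (U1 * U2 - V1 * V2)) \<and>
    U3 * U4 = k * (U1 * U2 + V1 * V2)^2"
proof -
  consider "Q = Inf" | "P = Inf" "Q \<noteq> Inf" 
    | x1 y1 x2 y2 where "P = Aff x1 y1" "Q = Aff x2 y2" by (cases P; cases Q) auto
  then show ?thesis
  proof cases
    case 1
    then have 2: "V2 = 0" "U2 \<noteq> 0" using kum by auto
    show ?thesis
    proof (cases P)
      case Inf
      then have "V1 = 0" "U1 \<noteq> 0" "V3 = 0" "U3 \<noteq> 0" "V4 = 0" "U4 \<noteq> 0" using kum 1 by auto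
      then show ?thesis using 2 by (intro exI[of _ "U3 * U4 / (U1 * U2)^2"]) simp
    next
      case (Aff x y)
      then have "V1 \<noteq> 0" "V3 \<noteq> 0" "V4 \<noteq> 0" "U1 = x * V1" "U3 = x * V3" "U4 = x * V4" using kum 1 by auto
      then show ?thesis using 2
        by (intro exI[of _ "V3 * V4 / (U2 * V1)^2"]) (simp add: power_mult_distrib power2_eq_square)
    qed
  next
    case 2
    then obtain x y where "Q = Aff x y" by (cases Q) auto
    then have "V1 = 0" "U1 \<noteq> 0" "V2 \<noteq> 0" "U2 = x * V2" "V3 \<noteq> 0" "U3 = x * V3" "V4 \<noteq> 0" "U4 = x * V4"
      using kum 2 by auto
    then show ?thesis
      by (intro exI[of _ "V3 * V4 / (U1 * V2)^2"]) (simp add: power_mult_distrib power2_eq_square)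
  next
    case 3
    have c1: "on_curve A (Aff x1 y1)" and c2: "on_curve A (Aff x2 y2)" using P Q 3 by auto
    have e1: "A * y1^2 = x1^3 - x1" and e2: "A * y2^2 = x2^3 - x2" using c1 c2 by auto
    show ?thesis
    proof (cases "x1 = x2")
      case True
      have "A * y1^2 = A * y2^2" using e1 e2 True by simp
      then have "(y1 - y2) * (y1 + y2) = 0" using A_nz by (simp add: algebra_simps power2_eq_square)
      then consider "Q = P" | "Q = ec_neg P" using 3 True by (auto simp: eq_neg_iff_add_eq_0 add.commute)
      then show ?thesis
      proof cases
        case 1
        then show ?thesis using kummer_double[OF c1, of U1 V1 U2 V2 U3 V3 U4 V4] kum by (simp add: 3)
      next
        case 2
        then have "\<exists>k. k \<noteq> 0 \<and> V4 * V3 = k * (U1 * V2 - U2 * V1)^2 \<and>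
          U4 * V3 + U3 * V4 = k * (2 * (U1 * V2 + U2 * V1) * (U1 * U2 - V1 * V2)) \<and>
          U4 * U3 = k * (U1 * U2 + V1 * V2)^2"
          using kummer_double[OF c1, of U1 V1 U2 V2 U4 V4 U3 V3] kum by (simp add: 3)
        then show ?thesis by (simp add: mult.commute add.commute)
      qed
    next
      case False
      have 1: "V1 \<noteq> 0" "U1 = x1 * V1" "V2 \<noteq> 0" "U2 = x2 * V2" using kum 3 by auto
      define d where "d = x2 - x1"
      have d: "d \<noteq> 0" using False by (simp add: d_def)
      define x3 x4 where "x3 = A * ((y2 - y1) / d)^2 - x1 - x2" and "x4 = A * ((- y2 - y1) / d)^2 - x1 - x2"
      have "V3 \<noteq> 0 \<and> U3 = x3 * V3" "V4 \<noteq> 0 \<and> U4 = x4 * V4"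
        using kum(3,4) False unfolding 3 x3_def x4_def d_def by (auto simp: Let_def)
      then have V: "V3 \<noteq> 0" "V4 \<noteq> 0" "U3 = x3 * V3" "U4 = x4 * V4" by auto
      have x3: "x3 * d^2 = A * (y2 - y1)^2 - (x1 + x2) * d^2"
        and x4: "x4 * d^2 = A * (y2 + y1)^2 - (x1 + x2) * d^2"
        unfolding x3_def x4_def using d by (simp_all add: field_simps power2_eq_square)
      have S: "(x3 + x4) * d^2 = 2 * (x1 + x2) * (x1 * x2 - 1)"
        using x3 x4 e1 e2 d_def by Groebner_Basis.algebra
      have "x3 * x4 * d^2 * d^2 = (A * (y2 - y1)^2 - (x1 + x2) * d^2) * (A * (y2 + y1)^2 - (x1 + x2) * d^2)"
        unfolding x3[symmetric] x4[symmetric] by (simp add: algebra_simps)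
      also have "\<dots> = (A * y1^2 + A * y2^2 - (x1 + x2) * d^2)^2 - 4 * (A * y1^2) * (A * y2^2)"
        by Groebner_Basis.algebra
      also have "\<dots> = (x1 * x2 + 1)^2 * d^2"
        unfolding e1 e2 d_def by Groebner_Basis.algebra
      finally have M: "x3 * x4 * d^2 = (x1 * x2 + 1)^2" using d by simp
      have T1: "(U1 * V2 - U2 * V1)^2 = (V1 * V2)^2 * d^2" unfolding 1 d_def by Groebner_Basis.algebra
      have T2: "2 * (U1 * V2 + U2 * V1) * (U1 * U2 - V1 * V2) = (V1 * V2)^2 * ((x3 + x4) * d^2)"
        unfolding 1 S by Groebner_Basis.algebra
      have T3: "(U1 * U2 + V1 * V2)^2 = (V1 * V2)^2 * (x3 * x4 * d^2)" unfolding 1 M by Groebner_Basis.algebra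
      show ?thesis unfolding T1 T2 T3 using 1 V d
        by (intro exI[of _ "V3 * V4 / ((V1 * V2)^2 * d^2)"]) (simp add: algebra_simps)
    qed
  qed
qed

end

text \<open>Points with coordinates in the fraction field \<open>'k\<close> of \<open>'d\<close>, reduced to a field \<open>'f\<close>.\<close>
locale fraction_reduction =
  fixes emb :: "'d::{euclidean_ring_gcd,factorial_ring_gcd} \<Rightarrow> 'k::field" and red :: "'d \<Rightarrow> 'f::field"
  assumes emb_add: "emb (a + b) = emb a + emb b" and emb_mult: "emb (a * b) = emb a * emb b"
    and emb_1: "emb 1 = 1" and emb_inj: "emb a = 0 \<Longrightarrow> a = 0"
    and red_add: "red (a + b) = red a + red b" and red_mult: "red (a * b) = red a * red b"
    and red_1: "red 1 = 1"
    and fraction: "\<exists>a b. b \<noteq> 0 \<and> z * emb b = emb a"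
    and two_nz: "(2::'k) \<noteq> 0" "(2::'f) \<noteq> 0"
begin

lemma emb_0: "emb 0 = 0" using emb_add[of 0 0] by (metis add_0 add_left_cancel add_0_right)
lemma red_0: "red 0 = 0" using red_add[of 0 0] by (metis add_0 add_left_cancel add_0_right)
lemma emb_minus: "emb (- a) = - emb a" using emb_add[of a "- a"] by (simp add: emb_0 eq_neg_iff_add_eq_0 add.commute)
lemma red_minus: "red (- a) = - red a" using red_add[of a "- a"] by (simp add: red_0 eq_neg_iff_add_eq_0 add.commute)
lemma emb_diff: "emb (a - b) = emb a - emb b" using emb_add[of a "- b"] by (simp add: emb_minus)
lemma red_diff: "red (a - b) = red a - red b" using red_add[of a "- b"] by (simp add: red_minus)
lemma emb_eq: "emb a = emb b \<longleftrightarrow> a = b" using emb_inj[of "a - b"] by (auto simp: emb_diff)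
lemma emb_2: "emb 2 = 2" using emb_add[of 1 1] by (simp add: emb_1)
lemma red_2: "red 2 = 2" using red_add[of 1 1] by (simp add: red_1)
lemma emb_power2: "emb (a^2) = (emb a)^2" by (simp add: power2_eq_square emb_mult)
lemma red_power2: "red (a^2) = (red a)^2" by (simp add: power2_eq_square red_mult)
lemmas emb_simps = emb_0 emb_1 emb_2 emb_add emb_mult emb_diff emb_minus emb_power2
lemmas red_simps = red_0 red_1 red_2 red_add red_mult red_diff red_minus red_power2

lemma red_unit: "is_unit a \<Longrightarrow> red a \<noteq> 0"
  by (metis dvdE red_mult red_1 mult_zero_left zero_neq_one)

lemma red_coprime:
  assumes "coprime U V"
  shows "red U \<noteq> 0 \<or> red V \<noteq> 0"
proof -
  obtain s t where "s * U + t * V = 1" using assms bezout_coefficients_fst_snd[of U V]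
    by (metis coprime_imp_gcd_eq_1)
  then have "red s * red U + red t * red V = 1" by (metis red_simps(2,4,5))
  then show ?thesis by auto
qed

text \<open>Lowest terms: by \<open>red_coprime\<close> the reduced pair is again a point of the
  projective line.\<close>

definition crep :: "'k ecpt \<Rightarrow> 'd \<Rightarrow> 'd \<Rightarrow> bool" where
  "crep R U V \<longleftrightarrow> coprime U V \<and> kum R (emb U) (emb V)"

lemma crep_exists: "\<exists>U V. crep R U V"
proof (cases R)
  case Inf
  then show ?thesis by (intro exI[of _ 1] exI[of _ 0]) (simp add: crep_def emb_simps)
next
  case (Aff x y)
  obtain a b where ab: "b \<noteq> 0" "x * emb b = emb a" using fraction by blast
  define g where "g = gcd a b"
  have g: "g \<noteq> 0" using ab by (simp add: g_def)
  obtain a' b' where a': "a = a' * g" "b = b' * g" "coprime a' b'"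
    using gcd_coprime_exists[of a b] g unfolding g_def by blast
  have "x * emb b' * emb g = emb a' * emb g" using ab(2) unfolding a' by (simp add: emb_simps mult_ac)
  then have "x * emb b' = emb a'" using g emb_inj by fastforce
  moreover have "emb b' \<noteq> 0" using ab(1) a' emb_inj by fastforce
  ultimately show ?thesis using a'(3) Aff by (intro exI[of _ a'] exI[of _ b']) (simp add: crep_def)
qed

lemma crep_reduction_unique:
  assumes "crep R U V" "crep R U' V'" "kum r (red U) (red V)"
  shows "kum r (red U') (red V')"
proof (rule kum_prop[OF assms(3)])
  have "emb U * emb V' = emb U' * emb V" using assms kum_cross unfolding crep_def by blast
  then have "U * V' = U' * V" by (simp flip: emb_mult add: emb_eq)
  then show "red U * red V' = red U' * red V" by (simp flip: red_mult)
qed (use assms red_coprime crep_def in blast)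

text \<open>Here \<open>a / b\<close> is the factor \<open>k\<close> of
  \<open>kummer_sum_diff\<close> in lowest terms. That \<open>a\<close> is a unit is Gauss's lemma:
  a prime dividing \<open>a\<close> would divide all coefficients of the product of the primitive
  linear forms \<open>U3 + V3 X\<close> and \<open>U4 + V4 X\<close>.\<close>

lemma crep_sum_diff:
  assumes "ec_field A" "on_curve A P" "on_curve A Q" "crep P U1 V1" "crep Q U2 V2" 
    "crep (ec_add A P Q) U3 V3" "crep (ec_add A P (ec_neg Q)) U4 V4"
  obtains a b where "is_unit a" "coprime a b" "b \<noteq> 0" "b * (V3 * V4) = a * (U1 * V2 - U2 * V1)^2"
    "b * (U3 * V4 + U4 * V3) = a * (2 * (U1 * V2 + U2 * V1) * (U1 * U2 - V1 * V2))"
    "b * (U3 * U4) = a * (U1 * U2 + V1 * V2)^2"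
proof -
  interpret ec_field A by fact
  obtain k where k: "k \<noteq> 0" "emb V3 * emb V4 = k * (emb U1 * emb V2 - emb U2 * emb V1)^2"
     "emb U3 * emb V4 + emb U4 * emb V3 = k * (2 * (emb U1 * emb V2 + emb U2 * emb V1) * (emb U1 * emb U2 - emb V1 * emb V2))"
     "emb U3 * emb U4 = k * (emb U1 * emb U2 + emb V1 * emb V2)^2"
    using kummer_sum_diff[OF assms(2,3)] assms(4-) unfolding crep_def by blast
  obtain a0 b0 where ab: "b0 \<noteq> 0" "k * emb b0 = emb a0" using fraction by blast
  have "a0 \<noteq> 0" using ab k(1) emb_inj emb_0 by auto
  define g where "g = gcd a0 b0"
  have g: "g \<noteq> 0" using ab by (simp add: g_def)
  obtain a b where a: "a0 = a * g" "b0 = b * g" "coprime a b"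
    using gcd_coprime_exists[of a0 b0] g unfolding g_def by blast
  have "k * emb b * emb g = emb a * emb g" using ab(2) unfolding a by (simp add: emb_simps mult_ac)
  then have kb: "k * emb b = emb a" using g emb_inj by fastforce
  have b0: "b \<noteq> 0" using ab a by auto
  have e: "b * L = a * T" if "emb L = k * emb T" for L T
  proof -
    have "emb (b * L) = emb b * (k * emb T)" using that by (simp add: emb_mult)
    also have "\<dots> = emb (a * T)" unfolding emb_mult kb[symmetric] by simp
    finally show ?thesis by (simp add: emb_eq)
  qed
  have L: "b * (V3 * V4) = a * (U1 * V2 - U2 * V1)^2"
    "b * (U3 * V4 + U4 * V3) = a * (2 * (U1 * V2 + U2 * V1) * (U1 * U2 - V1 * V2))"
    "b * (U3 * U4) = a * (U1 * U2 + V1 * V2)^2"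
    by (rule e; simp only: emb_simps k)+
  have dvd: "a dvd V3 * V4" "a dvd U3 * V4 + U4 * V3" "a dvd U3 * U4"
    using L a(3) by (metis coprime_dvd_mult_right_iff dvd_triv_left)+
  have "is_unit a"
  proof (rule ccontr)
    assume "\<not> is_unit a"
    moreover have "a \<noteq> 0" using \<open>a0 \<noteq> 0\<close> a by auto
    ultimately obtain w where w: "prime w" "w dvd a" using prime_divisor_exists by blast
    have n: "\<not> (w dvd U3 \<and> w dvd V3)" "\<not> (w dvd U4 \<and> w dvd V4)"
      using assms(6,7) w(1) unfolding crep_def by (metis coprime_common_divisor not_prime_unit)+
    have "w dvd V3 * V4" "w dvd U3 * V4 + U4 * V3" "w dvd U3 * U4" using dvd w(2) dvd_trans by blast+
    then show False using n w(1) 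
      by (metis prime_dvd_mult_iff dvd_add_right_iff dvd_add_left_iff dvd_mult dvd_mult2)
  qed
  then show ?thesis using that a(3) b0 L by blast
qed

text \<open>No addition formula is reduced. The unordered pair of sum and difference reduces
  correctly, so if the difference does, the sum must too. The factor \<open>b\<close> survives
  reduction because otherwise all three forms would vanish, against
  \<open>kummer_no_base_point\<close>.\<close>

lemma reduction_step:
  assumes A: "ec_field A" "on_curve A P" "on_curve A Q" "crep P U1 V1" "crep Q U2 V2" 
    "crep (ec_add A P Q) U3 V3" "crep (ec_add A P (ec_neg Q)) U4 V4"
    and B: "ec_field B" "on_curve B p" "on_curve B q" "kum p (red U1) (red V1)" "kum q (red U2) (red V2)"
    "kum (ec_add B p (ec_neg q)) (red U4) (red V4)"
  shows "kum (ec_add B p q) (red U3) (red V3)"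
proof -
  interpret B: ec_field B by fact
  obtain a b where ab: "is_unit a" "coprime a b" "b \<noteq> 0" "b * (V3 * V4) = a * (U1 * V2 - U2 * V1)^2"
    "b * (U3 * V4 + U4 * V3) = a * (2 * (U1 * V2 + U2 * V1) * (U1 * U2 - V1 * V2))"
    "b * (U3 * U4) = a * (U1 * U2 + V1 * V2)^2"
    using crep_sum_diff[OF A] .
  have nz: "red U3 \<noteq> 0 \<or> red V3 \<noteq> 0" "red U4 \<noteq> 0 \<or> red V4 \<noteq> 0"
    using red_coprime A(6,7) unfolding crep_def by blast+
  define T1 T2 T3 where T: "T1 = (red U1 * red V2 - red U2 * red V1)^2"
    "T2 = 2 * (red U1 * red V2 + red U2 * red V1) * (red U1 * red U2 - red V1 * red V2)"
    "T3 = (red U1 * red U2 + red V1 * red V2)^2"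
  obtain u v where uv: "kum (ec_add B p q) u v"
    by (cases "ec_add B p q") (use that[of 1 0] that[of _ 1] in auto)
  obtain k where k: "k \<noteq> 0" "v * red V4 = k * T1" "u * red V4 + red U4 * v = k * T2" "u * red U4 = k * T3"
    using B.kummer_sum_diff[OF B(2,3,4,5) uv B(6)] unfolding T by blast
  have a: "red a \<noteq> 0" using ab(1) by (rule red_unit)
  have L: "red b * (red V3 * red V4) = red a * T1" 
     "red b * (red U3 * red V4 + red U4 * red V3) = red a * T2"
     "red b * (red U3 * red U4) = red a * T3"
    unfolding T by (rule arg_cong[where f=red, OF ab(4), unfolded red_simps] 
      arg_cong[where f=red, OF ab(5), unfolded red_simps] arg_cong[where f=red, OF ab(6), unfolded red_simps])+
  have "T1 \<noteq> 0 \<or> T2 \<noteq> 0 \<or> T3 \<noteq> 0" unfolding T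
    by (rule B.kummer_no_base_point) (use kum_nonzero B in blast)+
  then have b: "red b \<noteq> 0" using L a by auto
  have 1: "red a * v * red V4 = k * red b * red V3 * red V4" using k L by Groebner_Basis.algebra
  have 2: "red a * u * red U4 = k * red b * red U3 * red U4" using k L by Groebner_Basis.algebra
  have 3: "red a * (u * red V4 + red U4 * v) = k * red b * (red U3 * red V4 + red U4 * red V3)"
    using k L by Groebner_Basis.algebra
  have "red a * v = k * red b * red V3 \<and> red a * u = k * red b * red U3"
  proof (cases "red V4 = 0")
    case True
    then show ?thesis using nz(2) 2 3 by simp
  next
    case False
    then have v: "red a * v = k * red b * red V3" using 1 by simp
    have "red a * u * red V4 = k * red b * red U3 * red V4" using 3 v by Groebner_Basis.algebra
    then show ?thesis using False v by simp
  qed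
  then have av: "red a * v = k * red b * red V3" and au: "red a * u = k * red b * red U3" by auto
  have "red a * (u * red V3) = red a * (red U3 * v)" using au av by Groebner_Basis.algebra
  then have "u * red V3 = red U3 * v" using a by simp
  then show ?thesis using kum_prop[OF uv] nz(1) by blast
qed

text \<open>\<open>R (Suc (Suc n))\<close> and \<open>R n\<close> are the sum and the difference of
  \<open>R (Suc n)\<close> and \<open>S\<close>, so \<open>reduction_step\<close> acts as a
  recursion of order two; hence the two initial values.\<close>

lemma reduction_sequence:
  assumes A: "ec_field A" "\<And>n. on_curve A (R n)" "on_curve A S" 
      "\<And>n. R (Suc (Suc n)) = ec_add A (R (Suc n)) S" "\<And>n. R n = ec_add A (R (Suc n)) (ec_neg S)"
    and B: "ec_field B" "\<And>n. on_curve B (r n)" "on_curve B s" 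
      "\<And>n. r (Suc (Suc n)) = ec_add B (r (Suc n)) s" "\<And>n. r n = ec_add B (r (Suc n)) (ec_neg s)"
    and S: "crep S US VS" "kum s (red US) (red VS)"
    and R0: "crep (R 0) U0 V0" "kum (r 0) (red U0) (red V0)"
    and R1: "crep (R 1) U1 V1" "kum (r 1) (red U1) (red V1)"
    and U: "crep (R n) U V"
  shows "kum (r n) (red U) (red V)"
  using U
proof (induction n arbitrary: U V rule: induct_nat_012)
  case 0
  then show ?case using crep_reduction_unique R0 by blast
next
  case 1
  then show ?case using crep_reduction_unique[OF R1(1) _ R1(2)] by simp
next
  case (ge2 n)
  obtain Ua Va Ub Vb where c: "crep (R n) Ua Va" "crep (R (Suc n)) Ub Vb" using crep_exists by meson
  show ?case unfolding B(4)
  proof (rule reduction_step[OF A(1) A(2) A(3) c(2) S(1) _ _ B(1) B(2) B(3)])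
    show "crep (ec_add A (R (Suc n)) S) U V" using ge2.prems A(4) by simp
    show "crep (ec_add A (R (Suc n)) (ec_neg S)) Ua Va" using c(1) A(5)[of n] by simp
    show "kum (ec_add B (r (Suc n)) (ec_neg s)) (red Ua) (red Va)" using ge2.IH(1) c(1) B(5)[of n] by simp
  qed (use ge2.IH c S in auto)
qed

end

subsection \<open>Heights\<close>

lemma coeff_mult_top:
  assumes "degree p \<le> a" "degree q \<le> b"
  shows "coeff (p * q) (a + b) = coeff p a * coeff q b"
proof (cases "degree p = a \<and> degree q = b")
  case True
  then show ?thesis using coeff_mult_degree_sum[of p q] by auto
next
  case False
  then have "degree p + degree q < a + b" using assms by linarith
  then have "degree (p * q) < a + b" using degree_mult_le[of p q] by linarith
  moreover have "coeff p a = 0 \<or> coeff q b = 0"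
    using False assms by (metis coeff_eq_0 order_le_neq_trans)
  ultimately show ?thesis by (auto simp: coeff_eq_0)
qed

text \<open>For coprime \<open>U\<close>, \<open>V\<close> this is the degree of the rational
  function \<open>U / V\<close>.\<close>

definition height :: "'a::zero poly \<Rightarrow> 'a poly \<Rightarrow> nat" where
  "height U V = max (degree U) (degree V)"

lemma height_top_nonzero:
  assumes "U \<noteq> 0 \<or> V \<noteq> 0"
  shows "coeff U (height U V) \<noteq> 0 \<or> coeff V (height U V) \<noteq> 0"
proof (cases "degree V \<le> degree U")
  case True
  then have h: "height U V = degree U" by (simp add: height_def)
  have "V \<noteq> 0" "degree V = degree U" if "U = 0" using assms that True by auto
  then show ?thesis unfolding h by (metis leading_coeff_0_iff)
next
  case False
  then have "V \<noteq> 0" by auto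
  then show ?thesis using False by (simp add: height_def max_def)
qed

text \<open>The divisibility version of \<open>kummer_no_base_point\<close>: the same elimination at
  a prime \<open>w\<close>, which cannot divide 2.\<close>

lemma kummer_primitive:
  fixes U1 V1 U2 V2 :: "'a::factorial_ring_gcd"
  assumes c: "coprime U1 V1" "coprime U2 V2" and two: "is_unit (2::'a)" and b: "b \<noteq> 0"
    and dvd: "b dvd (U1 * V2 - U2 * V1)^2" "b dvd 2 * (U1 * V2 + U2 * V1) * (U1 * U2 - V1 * V2)"
      "b dvd (U1 * U2 + V1 * V2)^2"
  shows "is_unit b"
proof (rule ccontr)
  assume "\<not> is_unit b"
  then obtain w where w: "prime w" "w dvd b" using prime_divisor_exists b by blast
  have u: "\<not> w dvd 2" using w(1) two by (metis not_prime_unit dvd_trans)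
  have n: "\<not> (w dvd U1 \<and> w dvd V1)" "\<not> (w dvd U2 \<and> w dvd V2)"
    using c w(1) by (metis coprime_common_divisor not_prime_unit)+
  have 1: "w dvd U1 * V2 - U2 * V1" and 3: "w dvd U1 * U2 + V1 * V2"
    using dvd w by (meson dvd_trans prime_dvd_power)+
  have "w dvd 2 * (U1 * V2 + U2 * V1) * (U1 * U2 - V1 * V2)" using dvd(2) w(2) dvd_trans by blast
  then have "w dvd U1 * V2 + U2 * V1 \<or> w dvd U1 * U2 - V1 * V2"
    using u unfolding prime_dvd_mult_iff[OF w(1)] by blast
  then show False
  proof
    assume "w dvd U1 * V2 + U2 * V1"
    then have "w dvd (U1 * V2 + U2 * V1) + (U1 * V2 - U2 * V1)"
      "w dvd (U1 * V2 + U2 * V1) - (U1 * V2 - U2 * V1)" using 1 by (blast intro: dvd_add dvd_diff)+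
    then have "w dvd 2 * (U1 * V2)" "w dvd 2 * (U2 * V1)" by (simp_all add: algebra_simps)
    then have "w dvd U1 \<or> w dvd V2" "w dvd U2 \<or> w dvd V1" using u w(1) by (simp_all add: prime_dvd_mult_iff)
    then have "w dvd U1 \<and> w dvd U2 \<or> w dvd V1 \<and> w dvd V2" using n by blast
    then have "w dvd U1 * U2 \<and> w dvd U1 * U2 + V1 * V2 \<and> \<not> w dvd V1 \<and> \<not> w dvd V2 \<or>
       w dvd V1 * V2 \<and> w dvd U1 * U2 + V1 * V2 \<and> \<not> w dvd U1 \<and> \<not> w dvd U2" using n 3 by auto
    then show False using w(1) by (auto simp: prime_dvd_mult_iff dvd_add_right_iff dvd_add_left_iff)
  next
    assume "w dvd U1 * U2 - V1 * V2"
    then have "w dvd (U1 * U2 + V1 * V2) + (U1 * U2 - V1 * V2)"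
      "w dvd (U1 * U2 + V1 * V2) - (U1 * U2 - V1 * V2)" using 3 by (blast intro: dvd_add dvd_diff)+
    then have "w dvd 2 * (U1 * U2)" "w dvd 2 * (V1 * V2)" by (simp_all add: algebra_simps)
    then have "w dvd U1 \<or> w dvd U2" "w dvd V1 \<or> w dvd V2" using u w(1) by (simp_all add: prime_dvd_mult_iff)
    then have "w dvd U1 \<and> w dvd V2 \<or> w dvd V1 \<and> w dvd U2" using n by blast
    then have "w dvd U1 * V2 \<and> w dvd U1 * V2 - U2 * V1 \<and> \<not> w dvd U2 \<and> \<not> w dvd V1 \<or>
       w dvd U2 * V1 \<and> w dvd U1 * V2 - U2 * V1 \<and> \<not> w dvd U1 \<and> \<not> w dvd V2" using n 1 by auto
    then show False using w(1) by (auto simp: prime_dvd_mult_iff dvd_diff_right_iff dvd_diff_left_iff)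
  qed
qed

text \<open>The parallelogram law, exact and not only up to a bounded error. Both factors
  \<open>a\<close> and \<open>b\<close> are constants, and the coefficients at the formal top
  degrees obey the same identities, so neither the three forms nor the symmetric functions of sum
  and difference lose degree: \<open>kummer_no_base_point\<close> and
  \<open>linear_forms_nonzero\<close> hold at the place at infinity too.\<close>

lemma height_sum_diff:
  fixes U1 :: "'a::field_gcd poly"
  assumes two: "(2::'a) \<noteq> 0" and c: "coprime U1 V1" "coprime U2 V2" "coprime U3 V3" "coprime U4 V4"
    and ab: "is_unit a" "coprime a b" "b \<noteq> 0" "b * (V3 * V4) = a * (U1 * V2 - U2 * V1)^2"
    "b * (U3 * V4 + U4 * V3) = a * (2 * (U1 * V2 + U2 * V1) * (U1 * U2 - V1 * V2))"
    "b * (U3 * U4) = a * (U1 * U2 + V1 * V2)^2"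
  shows "height U3 V3 + height U4 V4 = 2 * height U1 V1 + 2 * height U2 V2"
proof -
  have two': "is_unit (2::'a poly)" 
    using two by (simp add: is_unit_iff_degree numeral_poly)
  have "b dvd (U1 * V2 - U2 * V1)^2" "b dvd 2 * (U1 * V2 + U2 * V1) * (U1 * U2 - V1 * V2)"
      "b dvd (U1 * U2 + V1 * V2)^2"
    using ab by (metis coprime_commute coprime_dvd_mult_right_iff dvd_triv_left)+
  then have "is_unit b" using kummer_primitive[OF c(1,2) two' ab(3)] by blast
  then obtain b0 where b0: "b = [:b0:]" "b0 \<noteq> 0" using ab(3) unfolding is_unit_poly_iff by auto
  obtain a0 where a0: "a = [:a0:]" "a0 \<noteq> 0"
  proof -
    have "a \<noteq> 0" using ab(1) by auto
    then show ?thesis using that ab(1) unfolding is_unit_poly_iff by auto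
  qed
  have nz: "U \<noteq> 0 \<or> V \<noteq> 0" if "coprime U V" for U V :: "'a poly" using that by auto
  define h1 h2 h3 h4 where h: "h1 = height U1 V1" "h2 = height U2 V2" "h3 = height U3 V3" "h4 = height U4 V4"
  define u1 v1 u2 v2 u3 v3 u4 v4 where co: "u1 = coeff U1 h1" "v1 = coeff V1 h1" "u2 = coeff U2 h2" "v2 = coeff V2 h2"
    "u3 = coeff U3 h3" "v3 = coeff V3 h3" "u4 = coeff U4 h4" "v4 = coeff V4 h4"
  have n: "u1 \<noteq> 0 \<or> v1 \<noteq> 0" "u2 \<noteq> 0 \<or> v2 \<noteq> 0" "u3 \<noteq> 0 \<or> v3 \<noteq> 0" "u4 \<noteq> 0 \<or> v4 \<noteq> 0"
    unfolding co h by (rule height_top_nonzero, rule nz, rule c)+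
  have d: "degree U1 \<le> h1" "degree V1 \<le> h1" "degree U2 \<le> h2" "degree V2 \<le> h2"
    "degree U3 \<le> h3" "degree V3 \<le> h3" "degree U4 \<le> h4" "degree V4 \<le> h4" 
    by (auto simp: h height_def)
  define M where "M = h3 + h4"
  define K where "K = h1 + h2"
  have pd: "degree (p * q) \<le> i + j" if "degree p \<le> i" "degree q \<le> j" for p q :: "'a poly" and i j
    using that degree_mult_le[of p q] by linarith
  note dd = pd degree_add_le degree_diff_le
  have sq: "degree (p^2) \<le> i + i" "coeff (p^2) (i + i) = (coeff p i)^2" if "degree p \<le> i" for p :: "'a poly" and i
    using pd[OF that that] coeff_mult_top[OF that that] by (simp_all add: power2_eq_square)
  define L1 L2 L3 T1 T2 T3 where LT: "L1 = V3 * V4" "L2 = U3 * V4 + U4 * V3" "L3 = U3 * U4"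
    "T1 = (U1 * V2 - U2 * V1)^2" "T2 = 2 * (U1 * V2 + U2 * V1) * (U1 * U2 - V1 * V2)" "T3 = (U1 * U2 + V1 * V2)^2"
  have Ld: "degree L1 \<le> M" "degree L2 \<le> M" "degree L3 \<le> M"
    unfolding LT M_def using d pd[of U4 h4 V3 h3] by (auto intro!: dd simp: add.commute)
  have Lc: "coeff L1 M = v3 * v4" "coeff L2 M = u3 * v4 + u4 * v3" "coeff L3 M = u3 * u4"
    unfolding LT M_def co using d coeff_mult_top[of U4 h4 V3 h3]
    by (auto simp: coeff_mult_top add.commute)
  have e: "degree (U1 * V2 - U2 * V1) \<le> K" "degree (U1 * V2 + U2 * V1) \<le> K"
    "degree (U1 * U2 - V1 * V2) \<le> K" "degree (U1 * U2 + V1 * V2) \<le> K"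
    unfolding K_def using d pd[of U2 h2 V1 h1] by (auto intro!: dd simp: add.commute)
  have ec: "coeff (U1 * V2 - U2 * V1) K = u1 * v2 - u2 * v1" "coeff (U1 * V2 + U2 * V1) K = u1 * v2 + u2 * v1"
    "coeff (U1 * U2 - V1 * V2) K = u1 * u2 - v1 * v2" "coeff (U1 * U2 + V1 * V2) K = u1 * u2 + v1 * v2"
    unfolding K_def co using d coeff_mult_top[of U2 h2 V1 h1] by (auto simp: coeff_mult_top add.commute)
  have T2: "T2 = smult 2 ((U1 * V2 + U2 * V1) * (U1 * U2 - V1 * V2))" unfolding LT
    by (simp add: mult.assoc numeral_poly)
  have Td: "degree T1 \<le> K + K" "degree T2 \<le> K + K" "degree T3 \<le> K + K"
    using sq e pd[OF e(2,3)] degree_smult_le[of 2 "(U1 * V2 + U2 * V1) * (U1 * U2 - V1 * V2)"] unfolding T2 unfolding LT by auto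
  have Tc: "coeff T1 (K + K) = (u1 * v2 - u2 * v1)^2" 
    "coeff T2 (K + K) = 2 * (u1 * v2 + u2 * v1) * (u1 * u2 - v1 * v2)" "coeff T3 (K + K) = (u1 * u2 + v1 * v2)^2"
    unfolding T2 unfolding LT coeff_smult coeff_mult_top[OF e(2,3)] sq(2)[OF e(1)] sq(2)[OF e(4)] ec by simp_all
  have eq: "smult b0 L1 = smult a0 T1" "smult b0 L2 = smult a0 T2" "smult b0 L3 = smult a0 T3"
    using ab(4-6) unfolding a0 b0 LT by simp_all
  have Lnz: "coeff L1 M \<noteq> 0 \<or> coeff L2 M \<noteq> 0 \<or> coeff L3 M \<noteq> 0"
    unfolding Lc using linear_forms_nonzero n by blast
  interpret ec_field "1::'a" using two by unfold_locales auto
  have Tnz: "coeff T1 (K + K) \<noteq> 0 \<or> coeff T2 (K + K) \<noteq> 0 \<or> coeff T3 (K + K) \<noteq> 0"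
    unfolding Tc using kummer_no_base_point n by blast
  have "coeff L1 i = 0 \<longleftrightarrow> coeff T1 i = 0" "coeff L2 i = 0 \<longleftrightarrow> coeff T2 i = 0" "coeff L3 i = 0 \<longleftrightarrow> coeff T3 i = 0" for i
    using eq a0(2) b0(2) by (metis coeff_smult mult_eq_0_iff)+
  then have "M = K + K"
    using Lnz Tnz Ld Td by (metis coeff_eq_0 linorder_neqE_nat order_le_less_trans)
  then show ?thesis by (simp add: M_def K_def h)
qed

subsection \<open>The invariant differential\<close>

locale derivation =
  fixes D :: "'k::field \<Rightarrow> 'k"
  assumes D_add: "D (x + y) = D x + D y" and D_mult: "D (x * y) = D x * y + x * D y"
begin

lemma D_0: "D 0 = 0" using D_add[of 0 0] by (metis add_0 add_left_cancel add_0_right)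
lemma D_1: "D 1 = 0" using D_mult[of 1 1] by (metis add_0_right add_left_cancel mult_1 mult_1_right)
lemma D_minus: "D (- x) = - D x" using D_add[of x "- x"] by (simp add: D_0 eq_neg_iff_add_eq_0 add.commute)
lemma D_diff: "D (x - y) = D x - D y" using D_add[of x "- y"] by (simp add: D_minus)
lemma D_power2: "D (x^2) = 2 * x * D x" by (simp add: power2_eq_square D_mult)
lemma D_power3: "D (x^3) = 3 * x^2 * D x" by (simp add: power3_eq_cube D_mult power2_eq_square algebra_simps)

text \<open>On \<open>f Y^2 = X^3 - X\<close> the quotient \<open>D X / Y\<close> is additive: it is the invariant
  differential of \<open>Y^2 = X^3 - X\<close> up to the factor \<open>sqrt f\<close>.\<close>
lemma differential_additive:
  assumes f: "ec_field f" and c: "on_curve f (Aff X1 Y1)" "on_curve f (Aff X2 Y2)"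
    and Y: "Y1 \<noteq> 0" "Y2 \<noteq> 0" and lam: "D X1 = lam * Y1" "D X2 = mu * Y2"
    and sum: "ec_add f (Aff X1 Y1) (Aff X2 Y2) = Aff X3 Y3"
  shows "D X3 = (lam + mu) * Y3"
proof -
  interpret ec_field f by fact
  have c': "f * Y1^2 = X1^3 - X1" "f * Y2^2 = X2^3 - X2" using c by auto
  have D1: "2 * f * D Y1 = (3 * X1^2 - 1) * lam - D f * Y1"
  proof -
    have "D f * Y1^2 + f * (2 * Y1 * D Y1) = 3 * X1^2 * D X1 - D X1"
      using arg_cong[OF c'(1), of D] by (simp only: D_mult D_diff D_power2 D_power3)
    then have "Y1 * (2 * f * D Y1) = Y1 * ((3 * X1^2 - 1) * lam - D f * Y1)" unfolding lam
      by Groebner_Basis.algebra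
    then show ?thesis using Y(1) by simp
  qed
  have D2: "2 * f * D Y2 = (3 * X2^2 - 1) * mu - D f * Y2"
  proof -
    have "D f * Y2^2 + f * (2 * Y2 * D Y2) = 3 * X2^2 * D X2 - D X2"
      using arg_cong[OF c'(2), of D] by (simp only: D_mult D_diff D_power2 D_power3)
    then have "Y2 * (2 * f * D Y2) = Y2 * ((3 * X2^2 - 1) * mu - D f * Y2)" unfolding lam
      by Groebner_Basis.algebra
    then show ?thesis using Y(2) by simp
  qed
  have "\<not> (X1 = X2 \<and> Y1 + Y2 = 0)" using sum by auto
  then obtain l where l: "is_slope f l X1 Y1 X2 Y2" using slope_exists c by blast
  have l1: "l * (X2 - X1) = Y2 - Y1" and l2: "f * l * (Y1 + Y2) = X1^2 + X1 * X2 + X2^2 - 1"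
    using l by (auto simp: is_slope_def)
  have X3: "X3 = f * l^2 - X1 - X2" and Y3: "Y3 = l * (X1 - X3) - Y1"
    using sum unfolding ec_add_slope[OF l c(1)] by auto
  have DX3: "D X3 = D f * l^2 + f * (2 * l * D l) - lam * Y1 - mu * Y2"
    unfolding X3 D_diff D_mult D_power2 lam ..
  have Dl: "D l * (X2 - X1) + l * (mu * Y2 - lam * Y1) = D Y2 - D Y1"
    using arg_cong[OF l1, of D] unfolding D_mult D_diff lam .
  show ?thesis
  proof (cases "X1 = X2")
    case False
    have "2 * f * (D l * (X2 - X1)) = (3 * X2^2 - 1) * mu - D f * Y2 - (3 * X1^2 - 1) * lam + D f * Y1
       - 2 * f * l * (mu * Y2 - lam * Y1)"
      using Dl D1 D2 by Groebner_Basis.algebra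
    then have "(X2 - X1) * D X3 = l * ((3 * X2^2 - 1) * mu - (3 * X1^2 - 1) * lam)
       - 2 * f * l^2 * (mu * Y2 - lam * Y1) - (X2 - X1) * (lam * Y1 + mu * Y2)"
      using l1 DX3 by Groebner_Basis.algebra
    \<comment> \<open>This identity and the next are the derivatives, at \<open>X2\<close> and at
      \<open>X1\<close>, of \<open>(X - X1) (X - X2) (X - X3)\<close>, which is
      \<open>X^3 - X\<close> minus \<open>f\<close> times the square of the line.\<close>
    moreover have "3 * X2^2 - 1 - 2 * f * l * Y2 = (X2 - X1) * (X2 - X3)"
      using l1 l2 X3 by Groebner_Basis.algebra
    moreover have "3 * X1^2 - 1 - 2 * f * l * Y1 = (X1 - X2) * (X1 - X3)"
      using l1 l2 X3 by Groebner_Basis.algebra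
    ultimately have "(X2 - X1) * D X3 = (X2 - X1) * (l * ((X2 - X3) * mu + (X1 - X3) * lam) - (lam * Y1 + mu * Y2))"
      by Groebner_Basis.algebra
    also have "l * ((X2 - X3) * mu + (X1 - X3) * lam) - (lam * Y1 + mu * Y2) = (lam + mu) * Y3"
      unfolding Y3 using l1 by Groebner_Basis.algebra
    finally show ?thesis using False by simp
  next
    case True
    have Y21: "Y2 = Y1" using l1 True by simp
    have X21: "X2 = X1" using True by simp
    have mu: "mu = lam" using lam Y unfolding Y21 X21 by simp
    have s: "2 * f * l * Y1 = 3 * X1^2 - 1" using l2 unfolding Y21 X21 by Groebner_Basis.algebra
    have t: "D (2 * f * l * Y1) = D (3 * X1^2 - 1)" unfolding s ..
    have "D 2 = 0" "D 3 = 0" using D_add[of 1 1] D_add[of 1 2] by (simp_all add: D_1)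
    then have "2 * (D f * l * Y1 + f * D l * Y1 + f * l * D Y1) = 3 * (2 * X1 * (lam * Y1))"
      using t unfolding D_mult D_diff D_power2 D_1 lam by (simp add: algebra_simps)
    then have "Y1 * (D f * l^2 + 2 * f * l * D l) = Y1 * (2 * lam * l * (X1 - X3))"
      using D1 s X3[unfolded X21] by Groebner_Basis.algebra
    then have "D f * l^2 + 2 * f * l * D l = 2 * lam * l * (X1 - X3)" using Y(1) by simp
    then show ?thesis unfolding DX3 mu Y21 Y3 by Groebner_Basis.algebra
  qed
qed

end

section \<open>Differentiation of rational functions\<close>

definition fract_deriv :: "'a::idom poly fract \<Rightarrow> 'a poly fract" where
  "fract_deriv z = (THE w. \<forall>a b. b \<noteq> 0 \<longrightarrow> z = Fract a b \<longrightarrow>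
     w = Fract (pderiv a * b - a * pderiv b) (b * b))"

lemma fract_deriv_Fract:
  assumes "b \<noteq> 0"
  shows "fract_deriv (Fract a b) = Fract (pderiv a * b - a * pderiv b) (b * b)"
  unfolding fract_deriv_def
proof (rule the_equality, intro allI impI)
  fix c d :: "'a poly"
  assume d: "d \<noteq> 0" and "Fract a b = Fract c d"
  then have e: "a * d = c * b" using assms by (simp add: eq_fract)
  have "a * pderiv d + d * pderiv a = c * pderiv b + b * pderiv c"
    using arg_cong[OF e, of pderiv] by (simp add: pderiv_mult)
  then have "(pderiv a * b - a * pderiv b) * (d * d) = (pderiv c * d - c * pderiv d) * (b * b)"
    using e by Groebner_Basis.algebra
  then show "Fract (pderiv a * b - a * pderiv b) (b * b) = Fract (pderiv c * d - c * pderiv d) (d * d)"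
    using assms d by (simp add: eq_fract)
qed (use assms in blast)

lemma fract_deriv_to_fract: "fract_deriv (to_fract p) = to_fract (pderiv p)"
  by (simp add: to_fract_def fract_deriv_Fract)

interpretation fract_deriv: derivation "fract_deriv :: 'a::idom poly fract \<Rightarrow> _"
proof
  fix x y :: "'a poly fract"
  obtain a b where x: "x = Fract a b" "b \<noteq> 0" by (cases x) auto
  obtain c d where y: "y = Fract c d" "d \<noteq> 0" by (cases y) auto
  show "fract_deriv (x + y) = fract_deriv x + fract_deriv y"
    using x y by (simp add: fract_deriv_Fract eq_fract pderiv_add pderiv_mult algebra_simps)
  show "fract_deriv (x * y) = fract_deriv x * y + x * fract_deriv y"
    using x y by (simp add: fract_deriv_Fract eq_fract pderiv_mult algebra_simps)
qed

subsection \<open>The generic point\<close>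

text \<open>The abscissa of the 2-isogeny \<open>1 + i\<close> is
  \<open>(x^2 - 1) / (2 * i * x)\<close>; in homogeneous form the kernel point with
  \<open>x = 0\<close> is included.\<close>

lemma one_plus_i_kummer:
  assumes f: "ec_field A" and c: "on_curve A (Aff x y)" and i: "i^2 = - 1"
  shows "kum (ec_add A (Aff x y) (Aff (- x) (i * y))) (x^2 - 1) (2 * i * x)"
proof -
  interpret ec_field A by fact
  have e: "A * y^2 = x^3 - x" using c by simp
  show ?thesis
  proof (cases "x = 0")
    case True
    then have "y = 0" using e A_nz by simp
    then show ?thesis using True by simp
  next
    case False
    have i0: "i \<noteq> 0" using i by auto
    have xx: "x \<noteq> - x"
    proof
      assume "x = - x"
      then have "2 * x = 0" by (simp add: eq_neg_iff_add_eq_0)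
      then show False using False two_nz by simp
    qed
    define l where "l = (i * y - y) / (- x - x)"
    have dx: "- x - x \<noteq> 0" using xx by (metis add.inverse_inverse eq_iff_diff_eq_0 minus_equation_iff)
    have l: "l * (2 * x) = y - i * y"
    proof -
      have "l * (- x - x) = i * y - y" unfolding l_def using dx by simp
      then show ?thesis by Groebner_Basis.algebra
    qed
    have "(A * l^2 * (2 * i * x)) * (2 * x) = i * A * (l * (2 * x))^2" by Groebner_Basis.algebra
    also have "\<dots> = (A * y^2) * (i + i * i^2 - 2 * i^2)" unfolding l by Groebner_Basis.algebra
    also have "\<dots> = (x^2 - 1) * (2 * x)" unfolding e i by Groebner_Basis.algebra
    finally have "A * l^2 * (2 * i * x) * (2 * x) = (x^2 - 1) * (2 * x)" .
    moreover have "2 * x \<noteq> 0" using False two_nz by simp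
    ultimately have "A * l^2 * (2 * i * x) = x^2 - 1" by (metis mult_right_cancel)
    then show ?thesis using xx i0 False two_nz by (simp add: Let_def l_def)
  qed
qed

lemma fraction_reduction_poly:
  assumes "(2::'a::field_gcd) \<noteq> 0"
  shows "fraction_reduction (to_fract :: 'a poly \<Rightarrow> _) (\<lambda>p. poly p x)"
proof
  fix z :: "'a poly fract"
  obtain a b where "z = Fract a b" "b \<noteq> 0" by (cases z) auto
  then show "\<exists>a b. b \<noteq> 0 \<and> z * to_fract b = to_fract a"
    by (intro exI[of _ a] exI[of _ b]) (simp add: to_fract_def eq_fract)
  have "to_fract (1 + 1 :: 'a poly) = 1 + 1" by (simp only: to_fract_add to_fract_1)
  then have "(2 :: 'a poly fract) = to_fract 2" by (simp only: one_add_one)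
  moreover have "(2 :: 'a poly) \<noteq> 0" using assms by (simp add: numeral_poly)
  ultimately show "(2 :: 'a poly fract) \<noteq> 0" by (metis to_fract_eq_0_iff)
qed (use assms in auto)

locale generic_point =
  fixes d :: "'a::field_gcd"
  assumes two: "(2::'a) \<noteq> 0" and d2: "d^2 = - 1"
begin

text \<open>\<open>gp n\<close> is \<open>G + n i G\<close> for the generic point \<open>G = (x, 1)\<close> of the twist by \<open>tw\<close>, and \<open>gS = i G\<close>.\<close>
definition tw :: "'a poly fract" where "tw = to_fract [:0, 1:] ^ 3 - to_fract [:0, 1:]"

definition gS :: "'a poly fract ecpt" where "gS = Aff (- to_fract [:0, 1:]) (to_fract [:d:] * 1)"

primrec gp :: "nat \<Rightarrow> 'a poly fract ecpt" where
  "gp 0 = Aff (to_fract [:0, 1:]) 1"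
| "gp (Suc n) = ec_add tw (gp n) gS"

definition cr :: "'a poly fract ecpt \<Rightarrow> 'a poly \<Rightarrow> 'a poly \<Rightarrow> bool" where
  "cr = fraction_reduction.crep to_fract"

lemma two': "(2 :: 'a poly fract) \<noteq> 0"
  using fraction_reduction_poly[OF two] by (rule fraction_reduction.two_nz(1))

lemma cr_def': "cr R U V \<longleftrightarrow> coprime U V \<and> kum R (to_fract U) (to_fract V)"
  unfolding cr_def by (rule fraction_reduction.crep_def[OF fraction_reduction_poly[OF two]])

lemma tw_field: "ec_field tw"
proof
  have "tw = to_fract ([:0, 1:] * [:0, 1:] * [:0, 1:] - [:0, 1:])"
    by (simp only: tw_def to_fract_mult to_fract_diff power3_eq_cube)
  also have "[:0, 1:] * [:0, 1:] * [:0, 1:] - [:0, 1:] = [:0, -1, 0, 1 :: 'a:]" by simp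
  finally have "tw = to_fract [:0, -1, 0, 1:]" .
  moreover have "[:0, -1, 0, 1 :: 'a:] \<noteq> 0" by simp
  ultimately show "tw \<noteq> 0" by (metis to_fract_eq_0_iff)
qed (rule two')

sublocale tw: ec_field tw by (rule tw_field)

lemma d2': "to_fract [:d:] ^ 2 = - 1"
proof -
  have "[:d:] * [:d:] = [:d^2:]" by (simp add: power2_eq_square)
  also have "\<dots> = - 1" unfolding d2 by (simp add: one_pCons)
  finally have "to_fract ([:d:] * [:d:]) = to_fract (- 1)" by (rule arg_cong)
  then show ?thesis by (simp only: power2_eq_square to_fract_mult to_fract_uminus to_fract_1)
qed

lemma on_curve_gS: "on_curve tw gS"
proof -
  have "tw * (to_fract [:d:])^2 = (- to_fract [:0, 1:]) ^ 3 - (- to_fract [:0, 1:])"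
    unfolding d2' tw_def by Groebner_Basis.algebra
  then show ?thesis by (simp add: gS_def)
qed

lemma on_curve_gp: "on_curve tw (gp n)"
proof (induction n)
  case 0
  show ?case by (simp add: tw_def)
qed (simp add: tw.on_curve_add on_curve_gS)

lemma gp_pred: "gp n = ec_add tw (gp (Suc n)) (ec_neg gS)"
  using tw.ec_add_cancel[OF on_curve_gp on_curve_gS] by simp

lemma cr_gS: "cr gS [:0, -1:] 1"
  by (simp add: cr_def' gS_def flip: to_fract_uminus)

lemma cr_0: "cr (gp 0) [:0, 1:] 1"
  by (simp add: cr_def')

lemma coprime_1: "coprime ([:0, 1:]^2 - 1) (2 * [:d:] * [:0, 1:])"
proof -
  have dd: "2 * d \<noteq> 0" using two d2 by auto
  have "2 * [:d:] * [:0, 1:] = [:0, 1:] * [:2 * d:]" by (simp add: numeral_poly)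
  moreover have "is_unit [:2 * d:]" using dd by (simp add: is_unit_iff_degree)
  moreover have "coprime ([:0, 1:]^2 - 1) [:0, 1 :: 'a:]"
    by (rule coprimeI) (metis dvd_diff_right_iff dvd_power dvd_diff_left_iff zero_less_numeral dvd_trans dvd_mult power2_eq_square)
  ultimately show ?thesis by (metis coprime_mult_right_iff is_unit_right_imp_coprime)
qed

lemma cr_1: "cr (gp 1) ([:0, 1:]^2 - 1) (2 * [:d:] * [:0, 1:])"
proof -
  have 2: "to_fract (2 :: 'a poly) = 2" using to_fract_add[of "1::'a poly" 1] by (simp only: one_add_one to_fract_1)
  have "kum (gp 1) ((to_fract [:0, 1:])^2 - 1) (2 * to_fract [:d:] * to_fract [:0, 1:])"
    using one_plus_i_kummer[OF tw_field on_curve_gp[of 0, unfolded gp.simps] d2']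
    by (simp only: One_nat_def gp.simps gS_def)
  then show ?thesis
    using coprime_1 unfolding cr_def' power2_eq_square to_fract_mult to_fract_diff to_fract_1 2 by blast
qed

lemma cr_unique:
  assumes "cr R U V" "cr R U' V'"
  obtains u where "u \<noteq> 0" "U' = smult u U" "V' = smult u V"
proof -
  have "to_fract U * to_fract V' = to_fract U' * to_fract V" using assms kum_cross unfolding cr_def' by blast
  then have e: "U * V' = U' * V" by (simp flip: to_fract_mult)
  have c: "coprime U V" "coprime U' V'" using assms by (auto simp: cr_def')
  show ?thesis
  proof (cases "U = 0")
    case True
    then have "is_unit V" "U' = 0" using c(1) e by auto
    then have "is_unit V'" using c(2) by simp
    obtain v v' where v: "V = [:v:]" "V' = [:v':]" "v \<noteq> 0" "v' \<noteq> 0"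
      using \<open>is_unit V\<close> \<open>is_unit V'\<close> unfolding is_unit_poly_iff by (metis dvd_0_left_iff zero_neq_one)
    show ?thesis by (rule that[of "v' / v"]) (use True v \<open>U' = 0\<close> in simp_all)
  next
    case False
    have "U dvd U'" using c(1) e by (metis coprime_dvd_mult_left_iff dvd_triv_left)
    have "U' dvd U" using c(2) e by (metis coprime_dvd_mult_left_iff dvd_triv_left)
    obtain w where w: "U' = U * w" using \<open>U dvd U'\<close> by blast
    obtain z where z: "U = U' * z" using \<open>U' dvd U\<close> by blast
    have "U * (w * z) = U * 1" using w z by (metis mult.assoc mult_1_right)
    then have "w * z = 1" using False by simp
    then have "is_unit w" by (metis dvd_triv_left)
    moreover have "w \<noteq> 0" using \<open>w * z = 1\<close> by auto
    ultimately obtain u where u: "w = [:u:]" "u \<noteq> 0" unfolding is_unit_poly_iff by auto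
    have "U * V' = U * (w * V)" using e w by (simp add: mult_ac)
    then have "V' = w * V" using False by simp
    then show ?thesis using that[of u] u w by simp
  qed
qed

lemma cr_height_unique: "cr R U V \<Longrightarrow> cr R U' V' \<Longrightarrow> height U' V' = height U V"
  by (erule (1) cr_unique) (simp add: height_def)

text \<open>As \<open>gS\<close> has height 1, the parallelogram law reads
  \<open>h (n + 2) + h n = 2 * h (n + 1) + 2\<close> with \<open>h 0 = 1\<close> and
  \<open>h 1 = 2\<close>. The solution is the norm of \<open>1 + n i\<close>.\<close>

lemma height_gp: "cr (gp n) U V \<Longrightarrow> height U V = n^2 + 1"
proof (induction n arbitrary: U V rule: induct_nat_012)
  case 0
  then show ?case using cr_height_unique[OF cr_0] by (simp add: height_def)
next
  case 1
  have "degree ([:0, 1:]^2 - 1 :: 'a poly) = 2"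
    by (simp add: power2_eq_square one_pCons)
  moreover have "degree (2 * [:d:] * [:0, 1:]) \<le> 1"
    by (simp add: numeral_poly)
  ultimately show ?case using cr_height_unique[OF cr_1, of U V] 1 by (simp add: height_def)
next
  case (ge2 n)
  interpret fraction_reduction "to_fract :: 'a poly \<Rightarrow> _" "\<lambda>p. poly p 0"
    by (rule fraction_reduction_poly[OF two])
  note cr = cr_def[symmetric]
  obtain Ua Va Ub Vb where c: "cr (gp n) Ua Va" "cr (gp (Suc n)) Ub Vb" using crep_exists unfolding cr by meson
  have c3: "cr (ec_add tw (gp (Suc n)) gS) U V" using ge2.prems unfolding gp.simps(2)[of "Suc n"] .
  have c4: "cr (ec_add tw (gp (Suc n)) (ec_neg gS)) Ua Va" using c(1) unfolding gp_pred[of n] .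
  obtain a b where ab: "is_unit a" "coprime a b" "b \<noteq> 0" "b * (V * Va) = a * (Ub * 1 - [:0, -1:] * Vb)^2"
    "b * (U * Va + Ua * V) = a * (2 * (Ub * 1 + [:0, -1:] * Vb) * (Ub * [:0, -1:] - Vb * 1))"
    "b * (U * Ua) = a * (Ub * [:0, -1:] + Vb * 1)^2"
    using crep_sum_diff[unfolded cr, OF tw_field on_curve_gp on_curve_gS c(2) cr_gS c3 c4] .
  have "height U V + height Ua Va = 2 * height Ub Vb + 2 * height [:0, -1 :: 'a:] 1"
    by (rule height_sum_diff[OF two _ _ _ _ ab]) (use c ge2.prems cr_gS in \<open>simp_all add: cr_def'\<close>)
  then have "height U V + (n^2 + 1) = 2 * ((Suc n)^2 + 1) + 2"
    using ge2.IH(1)[OF c(1)] ge2.IH(2)[OF c(2)] by (simp add: height_def)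
  then show ?case by (simp add: power2_eq_square algebra_simps)
qed

text \<open>The point at infinity and the 2-torsion points have constant abscissa, hence height 0,
  whereas \<open>gp n\<close> has positive height. This provides the nonzero ordinates that
  \<open>differential_additive\<close> asks for.\<close>

lemma gp_affine:
  obtains x y where "gp n = Aff x y" "y \<noteq> 0"
proof (cases "gp n")
  case Inf
  then have "cr (gp n) 1 0" by (simp add: cr_def')
  then show ?thesis using height_gp[of n 1 0] by (simp add: height_def)
next
  case (Aff x y)
  have "y \<noteq> 0"
  proof
    assume "y = 0"
    then have "x^3 - x = 0" using on_curve_gp[of n] Aff by simp
    then have "x * (x - 1) * (x + 1) = 0" by (simp add: algebra_simps power3_eq_cube)
    then have "x = 0 \<or> x = 1 \<or> x = - 1" by (auto simp: eq_neg_iff_add_eq_0)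
    then obtain e where "x = to_fract e" "degree e = 0" by (metis to_fract_0 to_fract_1 to_fract_uminus degree_0 degree_1 degree_minus)
    then have "cr (gp n) e 1" using Aff by (simp add: cr_def')
    then show False using height_gp[of n e 1] \<open>degree e = 0\<close> by (simp add: height_def)
  qed
  then show ?thesis using that Aff by blast
qed

text \<open>Each added \<open>gS\<close> contributes \<open>d\<close>: its abscissa has derivative
  \<open>- 1 = d * d\<close>, which is \<open>d\<close> times its ordinate.\<close>

lemma differential_gp:
  assumes "gp n = Aff x y"
  shows "fract_deriv x = to_fract [:1 + of_nat n * d:] * y"
  using assms
proof (induction n arbitrary: x y)
  case 0
  then have "x = to_fract [:0, 1:]" "y = 1" by auto
  moreover have "pderiv [:0, 1 :: 'a:] = 1" by (simp add: pderiv_pCons)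
  ultimately show ?case by (simp add: fract_deriv_to_fract flip: one_pCons)
next
  case (Suc n)
  obtain x1 y1 where 1: "gp n = Aff x1 y1" "y1 \<noteq> 0" using gp_affine .
  have "d \<noteq> 0" using d2 by auto
  have "fract_deriv (- to_fract [:0, 1:]) = - to_fract (pderiv [:0, 1 :: 'a:])"
    by (simp only: fract_deriv.D_minus fract_deriv_to_fract)
  also have "pderiv [:0, 1 :: 'a:] = 1" by (simp add: pderiv_pCons)
  also have "- to_fract 1 = to_fract [:d:] * (to_fract [:d:] * 1)" using d2' by (simp add: power2_eq_square)
  finally have "fract_deriv (- to_fract [:0, 1:]) = to_fract [:d:] * (to_fract [:d:] * 1)" .
  then have "fract_deriv x = (to_fract [:1 + of_nat n * d:] + to_fract [:d:]) * y"
    using fract_deriv.differential_additive[OF tw_field on_curve_gp[of n, unfolded 1] on_curve_gS[unfolded gS_def] 1(2) _ Suc.IH[OF 1(1)]]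
      Suc.prems \<open>d \<noteq> 0\<close> by (simp add: 1 gS_def)
  also have "to_fract [:1 + of_nat n * d:] + to_fract [:d:] = to_fract [:1 + of_nat (Suc n) * d:]"
    by (simp add: algebra_simps flip: to_fract_add)
  finally show ?case .
qed

text \<open>A vanishing derivative of \<open>U / V\<close> means
  \<open>pderiv U * V = U * pderiv V\<close>. By coprimality \<open>V\<close> divides
  \<open>pderiv V\<close>, which has smaller degree unless it is zero.\<close>

lemma pderiv_zero:
  assumes "1 + of_nat m * d = 0" "cr (gp m) U V"
  shows "pderiv U = 0" "pderiv V = 0"
proof -
  obtain x y where xy: "gp m = Aff x y" using gp_affine .
  have "fract_deriv x = 0" using differential_gp[OF xy] assms(1) by simp
  moreover have k: "to_fract V \<noteq> 0" "to_fract U = x * to_fract V" "coprime U V"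
    using assms(2) xy by (auto simp: cr_def')
  ultimately have "fract_deriv (to_fract U) = x * fract_deriv (to_fract V)"
    by (simp only: k(2) fract_deriv.D_mult mult_zero_left add_0_left)
  then have "to_fract (pderiv U) = x * to_fract (pderiv V)" unfolding fract_deriv_to_fract .
  then have "to_fract (pderiv U) * to_fract V = to_fract U * to_fract (pderiv V)"
    unfolding k(2) by (simp only: mult_ac)
  then have e: "pderiv U * V = U * pderiv V" by (simp flip: to_fract_mult)
  then have "V dvd pderiv V" using k(3) by (metis coprime_commute coprime_dvd_mult_right_iff dvd_triv_right)
  have "V \<noteq> 0" using k(1) by auto
  show V: "pderiv V = 0"
  proof (rule ccontr)
    assume n: "pderiv V \<noteq> 0"
    then have "degree V \<noteq> 0" by (metis degree_eq_zeroE pderiv_singleton)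
    then have "degree (pderiv V) < degree V"
      by (metis coeff_eq_0 coeff_pderiv degree_le le_degree leading_coeff_0_iff linorder_not_le mult_zero_right n less_Suc_eq_le Suc_le_eq)
    then show False using \<open>V dvd pderiv V\<close> n by (meson dvd_imp_degree_le linorder_not_le)
  qed
  show "pderiv U = 0" using e V \<open>V \<noteq> 0\<close> by simp
qed

text \<open>Specialisation of the generic point. Abscissas do not see the twist, so the computation
  over \<open>tw\<close> can be evaluated at a point of any curve
  \<open>B y^2 = x^3 - x\<close>.\<close>

lemma gp_reduction:
  assumes B: "ec_field B" and c: "on_curve B (Aff x y)"
    and r: "r 0 = Aff x y" "\<And>n. r (Suc n) = ec_add B (r n) (Aff (- x) (d * y))"
    and U: "cr (gp n) U V"
  shows "kum (r n) (poly U x) (poly V x)"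
proof -
  interpret B: ec_field B by fact
  interpret fraction_reduction "to_fract :: 'a poly \<Rightarrow> _" "\<lambda>p. poly p x"
    by (rule fraction_reduction_poly[OF two])
  note cr = cr_def[symmetric]
  have e: "B * y^2 = x^3 - x" using c by simp
  have s: "on_curve B (Aff (- x) (d * y))"
  proof -
    have "B * (d * y)^2 = d^2 * (B * y^2)" by Groebner_Basis.algebra
    also have "\<dots> = (- x)^3 - (- x)" unfolding e d2 by Groebner_Basis.algebra
    finally show ?thesis by simp
  qed
  have rc: "on_curve B (r n)" for n by (induction n) (use r c s B.on_curve_add in auto)
  have rp: "r n = ec_add B (r (Suc n)) (ec_neg (Aff (- x) (d * y)))" for n
    using B.ec_add_cancel[OF rc s] r(2) by simp
  have k0: "kum (r 0) (poly [:0, 1:] x) (poly 1 x)" and ks: "kum (Aff (- x) (d * y)) (poly [:0, - 1:] x) (poly 1 x)"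
    using r(1) by simp_all
  have k1: "kum (r 1) (poly ([:0, 1:]^2 - 1) x) (poly (2 * [:d:] * [:0, 1:]) x)"
    using one_plus_i_kummer[OF B c d2] r by (simp add: mult_ac)
  show ?thesis
    by (rule reduction_sequence[unfolded cr, where R=gp and r=r, OF tw_field on_curve_gp on_curve_gS gp.simps(2) gp_pred
        B rc s r(2) rp cr_gS ks cr_0 k0 cr_1 k1 U])
qed

end

section \<open>The Frobenius map as \<open>1 + m i\<close>\<close>

lemma pderiv_zero_imp_linear:
  fixes U :: "'a::field poly"
  assumes "pderiv U = 0" "degree U \<le> q" and char: "\<And>j. 0 < j \<Longrightarrow> j < q \<Longrightarrow> of_nat j \<noteq> (0::'a)" and q: "0 < q"
    and frob: "\<And>t::'a. t^q = t"
  shows "poly U t = coeff U q * t + coeff U 0"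
proof -
  \<comment> \<open>A zero derivative leaves only exponents that vanish in the field; up to degree
    \<open>q\<close> these are 0 and \<open>q\<close>, and \<open>frob\<close> replaces
    \<open>t^q\<close> by \<open>t\<close>.\<close>
  have z: "coeff U j = 0" if "0 < j" "j < q" for j
  proof -
    obtain k where k: "j = Suc k" using \<open>0 < j\<close> gr0_conv_Suc by auto
    have "of_nat j * coeff U j = 0" using arg_cong[OF assms(1), of "\<lambda>p. coeff p k"] by (simp add: coeff_pderiv k)
    then show ?thesis using char[OF that] by simp
  qed
  have "poly U t = (\<Sum>i\<le>q. coeff U i * t^i)"
    unfolding poly_altdef using assms(2) by (intro sum.mono_neutral_left) (auto simp: coeff_eq_0)
  also have "\<dots> = (\<Sum>i\<in>{0, q}. coeff U i * t^i)"
    using z by (intro sum.mono_neutral_right) auto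
  finally show ?thesis using q frob by simp
qed

text \<open>\<open>1 + m i\<close> with \<open>i\<close> acting through \<open>d = m\<close> has norm \<open>q\<close> and zero differential,
  hence acts as the Frobenius up to sign.\<close>
theorem frobenius_kummer:
  fixes d :: "'a::field_gcd"
  assumes two: "(2::'a) \<noteq> 0" and q: "q = m^2 + 1" and m: "even m" "of_nat m = d" and q0: "of_nat q = (0::'a)"
    and char: "\<And>j. 0 < j \<Longrightarrow> j < q \<Longrightarrow> of_nat j \<noteq> (0::'a)" and frob: "\<And>t::'a. t^q = t"
    and B: "ec_field B" and c: "on_curve B (Aff x y)"
    and r: "r 0 = Aff x y" "\<And>n. r (Suc n) = ec_add B (r n) (Aff (- x) (d * y))"
  shows "kum (r m) x 1"
proof -
  have "of_nat q = d^2 + 1" using q m(2) by (simp add: algebra_simps)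
  then have d2: "d^2 = - 1" using q0 by (simp add: eq_neg_iff_add_eq_0)
  interpret generic_point d by unfold_locales (fact two d2)+
  interpret B: ec_field B by fact
  have "d * d = - 1" using d2 by (simp add: power2_eq_square)
  then have z: "1 + of_nat m * d = 0" using m(2) by simp
  interpret fraction_reduction "to_fract :: 'a poly \<Rightarrow> _" "\<lambda>p. poly p 0"
    by (rule fraction_reduction_poly[OF two])
  obtain U V where UV: "cr (gp m) U V" using crep_exists[of "gp m"] unfolding cr_def by blast
  have "height U V = q" using height_gp[OF UV] q by simp
  then have deg: "degree U \<le> q" "degree V \<le> q" by (auto simp: height_def)
  have q1: "0 < q" using q by simp
  define u0 u1 v0 v1 where uv: "u0 = coeff U 0" "u1 = coeff U q" "v0 = coeff V 0" "v1 = coeff V q"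
  have lin: "poly U t = u1 * t + u0" "poly V t = v1 * t + v0" for t
    unfolding uv using pderiv_zero_imp_linear[OF _ _ char q1 frob] pderiv_zero[OF z UV] deg by auto
  \<comment> \<open>For a 2-torsion point the summand is its own negative, so after the even number
    \<open>m\<close> of additions the start is reached again. The Moebius map thus fixes 0, 1 and
    -1, which makes it the identity.\<close>
  have tors: "kum (Aff e 0) (u1 * e + u0) (v1 * e + v0)" if e: "e^3 - e = 0" for e
  proof -
    define rr where "rr = rec_nat (Aff e 0) (\<lambda>_ R. ec_add B R (Aff (- e) (d * 0)))"
    have rr: "rr 0 = Aff e 0" "\<And>n. rr (Suc n) = ec_add B (rr n) (Aff (- e) (d * 0))" by (simp_all add: rr_def)
    have ce: "on_curve B (Aff e 0)" using e by simp
    have cs: "on_curve B (Aff (- e) (d * 0))" using e by (simp add: algebra_simps power3_eq_cube)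
    have rc: "on_curve B (rr n)" for n by (induction n) (use rr ce cs B.on_curve_add in auto)
    have "rr (Suc (Suc n)) = rr n" for n
      using B.ec_add_cancel[OF rc[of n] cs] by (simp add: rr)
    then have "rr (2 * k) = Aff e 0" for k by (induction k) (simp_all add: rr)
    then have "rr m = Aff e 0" using m(1) by (metis evenE)
    then show ?thesis using gp_reduction[OF B ce rr UV] unfolding lin by simp
  qed
  have 0: "u0 = 0" "v0 \<noteq> 0" using tors[of 0] by auto
  have 1: "u1 = v1 + v0" using tors[of 1] 0 by simp
  have 2: "- u1 = - (v0 - v1)" using tors[of "- 1"] 0 by simp
  have "2 * v1 = 0" using 1 2 by Groebner_Basis.algebra
  then have v1: "v1 = 0" "u1 = v0" using two 1 by auto
  have "kum (r m) (v0 * x) v0" using gp_reduction[OF B c r UV] unfolding lin by (simp add: 0 v1)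
  then show ?thesis by (rule kum_scale[where k=v0]) simp_all
qed

subsection \<open>Finite modules over the Gaussian integers\<close>

primrec smul :: "nat \<Rightarrow> 'a::ab_group_add \<Rightarrow> 'a" where
  "smul 0 x = 0"
| "smul (Suc n) x = x + smul n x"

lemma smul_0_right [simp]: "smul n 0 = 0"
  by (induction n) auto

lemma smul_add_left: "smul (m + n) x = smul m x + smul n x"
  by (induction m) (auto simp: algebra_simps)

lemma smul_add: "smul n (x + y) = smul n x + smul n y"
  by (induction n) (auto simp: algebra_simps)

lemma smul_minus: "smul n (- x) = - smul n x"
  by (induction n) auto

lemma smul_mult: "smul (m * n) x = smul m (smul n x)"
  by (induction m) (auto simp: smul_add_left)

lemma smul_additive:
  assumes "additive h"
  shows "h (smul n x) = smul n (h x)"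
  by (induction n) (auto simp: additive.zero[OF assms] additive.add[OF assms])

lemma additive_smul: "additive (smul n)"
  by unfold_locales (rule smul_add)

lemma additive_funpow:
  fixes h :: "'a::ab_group_add \<Rightarrow> 'a"
  assumes "additive h"
  shows "additive (h ^^ n)"
proof (induction n)
  case (Suc n)
  have "(h ^^ Suc n) (x + y) = (h ^^ Suc n) x + (h ^^ Suc n) y" for x y
    by (simp only: funpow.simps comp_apply additive.add[OF Suc] additive.add[OF assms])
  then show ?case by unfold_locales
qed (unfold_locales, simp)

lemma card_vimage_additive:
  fixes h :: "'a::{ab_group_add, finite} \<Rightarrow> 'b::ab_group_add"
  assumes h: "additive h" and S: "S \<subseteq> range h"
  shows "card (h -` S) = card {x. h x = 0} * card S"
proof -
  have fin: "finite S" by (rule finite_subset[OF S]) simp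
  have "h -` S = (\<Union>y\<in>S. h -` {y})" by auto
  also have "card \<dots> = (\<Sum>y\<in>S. card (h -` {y}))" by (rule card_UN_disjoint) (use fin in auto)
  also have "\<dots> = (\<Sum>y\<in>S. card {x. h x = 0})"
  proof (rule sum.cong)
    fix y assume "y \<in> S"
    then obtain x0 where x0: "h x0 = y" using S by auto
    have "bij_betw (\<lambda>x. x0 + x) {x. h x = 0} (h -` {y})"
      by (rule bij_betwI[where g="\<lambda>x. x - x0"])
         (use x0 in \<open>auto simp: additive.add[OF h] additive.diff[OF h]\<close>)
    then show "card (h -` {y}) = card {x. h x = 0}" by (rule bij_betw_same_card[symmetric])
  qed simp
  finally show ?thesis by (simp add: mult.commute)
qed

lemma card_kernel_range:
  fixes h :: "'a::{ab_group_add, finite} \<Rightarrow> 'b::ab_group_add"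
  assumes "additive h"
  shows "CARD('a) = card {x. h x = 0} * card (range h)"
  using card_vimage_additive[OF assms subset_refl] by (simp add: vimage_def)

lemma even_card_involution:
  assumes "finite S" "\<And>x. x \<in> S \<Longrightarrow> f x \<in> S \<and> f (f x) = x \<and> f x \<noteq> x"
  shows "even (card S)"
  using assms
proof (induction rule: finite_psubset_induct)
  case (psubset S)
  show ?case
  proof (cases "S = {}")
    case False
    then obtain x where x: "x \<in> S" by auto
    have fx: "f x \<in> S" "f (f x) = x" "f x \<noteq> x" using psubset.prems[OF x] by auto
    define S' where "S' = S - {x, f x}"
    have "even (card S')"
    proof (rule psubset.IH)
      show "S' \<subset> S" using x by (auto simp: S'_def)
      fix y assume y: "y \<in> S'"
      then have "y \<in> S" "y \<noteq> x" "y \<noteq> f x" by (auto simp: S'_def)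
      then show "f y \<in> S' \<and> f (f y) = y \<and> f y \<noteq> y"
        using psubset.prems[of y] fx unfolding S'_def by (metis Diff_iff insert_iff singletonD)
    qed
    moreover have "card S = card S' + 2"
    proof -
      have "S = S' \<union> {x, f x}" "S' \<inter> {x, f x} = {}" using x fx by (auto simp: S'_def)
      then have "card S = card S' + card {x, f x}"
        using psubset.hyps by (metis card_Un_disjoint finite_Un)
      then show ?thesis using fx by simp
    qed
    ultimately show ?thesis by simp
  qed simp
qed

lemma odd_card_no_2_torsion:
  fixes S :: "'a::{ab_group_add, finite} set"
  assumes "0 \<in> S" "\<And>x. x \<in> S \<Longrightarrow> - x \<in> S" "\<And>x. x \<in> S \<Longrightarrow> x + x = 0 \<Longrightarrow> x = 0"
  shows "odd (card S)"
proof -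
  have "even (card (S - {0}))"
  proof (rule even_card_involution[where f=uminus])
    fix x assume x: "x \<in> S - {0}"
    have "- x \<noteq> x"
    proof
      assume "- x = x"
      then have "x + x = 0" by (metis add.left_inverse)
      then show False using x assms(3) by auto
    qed
    then show "- x \<in> S - {0} \<and> - (- x) = x \<and> - x \<noteq> x" using x assms(2)[of x] by simp
  qed simp
  moreover have "card S = Suc (card (S - {0}))" using assms(1) by (intro card.remove) auto
  ultimately show ?thesis by simp
qed

text \<open>A finite \<open>Z[i]\<close>-module on which \<open>th = 1 + i\<close> has a kernel of
  order 2. The counting arguments use the curve only through these axioms.\<close>

locale gauss_module =
  fixes i th :: "'a::{ab_group_add, finite} \<Rightarrow> 'a" and T :: 'a
  assumes i_add: "i (x + y) = i x + i y" and i_i: "i (i x) = - x"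
    and th_def: "th x = x + i x"
    and ker_th: "th x = 0 \<longleftrightarrow> x = 0 \<or> x = T" and T_nz: "T \<noteq> 0"
begin

lemma additive_i: "additive i" by unfold_locales (rule i_add)

lemma th_add: "th (x + y) = th x + th y" by (simp add: th_def i_add algebra_simps)

lemma additive_th: "additive th" by unfold_locales (rule th_add)

lemma th_i: "th (i x) = i (th x)" by (simp add: th_def i_add)

lemma th_th: "th (th x) = i (smul 2 x)"
  by (simp add: th_def i_add i_i numeral_2_eq_2 algebra_simps)

lemma th_smul: "th (smul n x) = smul n (th x)"
  by (rule smul_additive[OF additive_th])

lemma i_zero: "i x = 0 \<longleftrightarrow> x = 0"
  by (metis additive.zero additive_i i_i neg_equal_0_iff_equal)

lemma card_ker_th: "card {x. th x = 0} = 2"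
proof -
  have "{x. th x = 0} = {0, T}" using ker_th by auto
  then show ?thesis using T_nz by simp
qed

text \<open>\<open>(1 + i)^2 = 2 i\<close>, so even powers of \<open>th\<close> are powers of 2 up
  to a unit.\<close>

lemma th_funpow_even: "\<exists>j. (th ^^ (2 * k)) x = (i ^^ j) (smul (2 ^ k) x)"
proof (induction k)
  case (Suc k)
  then obtain j where j: "(th ^^ (2 * k)) x = (i ^^ j) (smul (2 ^ k) x)" by blast
  have "(th ^^ (2 * Suc k)) x = th (th ((th ^^ (2 * k)) x))" by simp
  also have "\<dots> = (i ^^ Suc j) (smul (2 ^ Suc k) x)"
    unfolding j th_th by (simp add: smul_mult smul_additive[OF additive_funpow[OF additive_i]])
  finally show ?case by blast
qed (intro exI[of _ 0], simp)

lemma i_funpow_zero: "(i ^^ j) x = 0 \<longleftrightarrow> x = 0"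
  by (induction j) (auto simp: i_zero)

abbreviation "ker k \<equiv> {x. (th ^^ k) x = 0}"

lemma ker_Suc: "ker (Suc k) = th -` ker k"
  by (auto simp: funpow_swap1 vimage_def)

lemma card_ker_le: "card (ker k) \<le> 2 ^ k"
proof (induction k)
  case (Suc k)
  have "ker (Suc k) = th -` (ker k \<inter> range th)" unfolding ker_Suc by auto
  also have "card \<dots> = 2 * card (ker k \<inter> range th)"
    using card_vimage_additive[OF additive_th, of "ker k \<inter> range th"] unfolding card_ker_th by blast
  also have "\<dots> \<le> 2 * card (ker k)" by (simp add: card_mono)
  finally show ?case using Suc by simp
qed simp

text \<open>If \<open>(th ^^ j) x = T\<close>, then \<open>x\<close> differs by an element of
  \<open>ker j\<close> from \<open>(th ^^ (k - j)) R\<close>, which lies in the range as long as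
  \<open>j < k\<close>. Once the kernels lie in the range, each step doubles them.\<close>

lemma ker_subset_range:
  assumes "(th ^^ k) R = T" "j \<le> k"
  shows "ker j \<subseteq> range th"
  using assms(2)
proof (induction j)
  case 0
  have "th 0 = 0" by (rule additive.zero[OF additive_th])
  then show ?case by (auto intro: range_eqI[of _ _ 0])
next
  case (Suc j)
  show ?case
  proof
    fix x assume "x \<in> ker (Suc j)"
    then have "th ((th ^^ j) x) = 0" by simp
    then consider "(th ^^ j) x = 0" | "(th ^^ j) x = T" using ker_th by auto
    then show "x \<in> range th"
    proof cases
      case 1
      then show ?thesis using Suc by auto
    next
      case 2
      define r where "r = (th ^^ (k - j)) R"
      have "(th ^^ j) r = (th ^^ (j + (k - j))) R" unfolding r_def funpow_add by simp
      then have "(th ^^ j) r = T" using Suc.prems assms(1) by simp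
      then have "(th ^^ j) (x - r) = 0" using 2 additive.diff[OF additive_funpow[OF additive_th]] by simp
      then have "x - r \<in> range th" using Suc by auto
      moreover have "r \<in> range th"
      proof -
        have "k - j = Suc (k - j - 1)" using Suc.prems by simp
        then have "r = th ((th ^^ (k - j - 1)) R)" unfolding r_def by (metis comp_apply funpow.simps(2))
        then show ?thesis by simp
      qed
      ultimately obtain u v where "x - r = th u" "r = th v" by auto
      then have "x = th (u + v)" by (simp add: th_add algebra_simps)
      then show ?thesis by simp
    qed
  qed
qed

lemma card_ker:
  assumes "(th ^^ k) R = T"
  shows "card (ker (Suc k)) = 2 ^ Suc k"
proof -
  have "card (ker j) = 2 ^ j" if "j \<le> Suc k" for j
    using that
  proof (induction j)
    case (Suc j)
    then have "ker j \<subseteq> range th" using ker_subset_range[OF assms] by simp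
    then have "card (th -` ker j) = 2 * card (ker j)"
      using card_vimage_additive[OF additive_th] unfolding card_ker_th by blast
    then show ?case using Suc unfolding ker_Suc by simp
  qed simp
  then show ?thesis by blast
qed

lemma card_ker_dvd: "card (ker k) dvd CARD('a)"
  using card_kernel_range[OF additive_funpow[OF additive_th]] by (metis dvd_triv_left)

lemma range_th_complement:
  assumes "P \<notin> range th" "x \<notin> range th"
  shows "x - P \<in> range th"
proof -
  let ?C = "(+) P ` range th"
  have "CARD('a) = 2 * card (range th)" using card_kernel_range[OF additive_th] by (simp add: card_ker_th)
  moreover have "card ?C = card (range th)" by (rule card_image) simp
  moreover have "range th \<inter> ?C = {}"
  proof -
    have False if "th u = P + th v" for u v
    proof -
      have "P = th (u - v)" using that additive.diff[OF additive_th] by simp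
      then show False using assms by simp
    qed
    then show ?thesis by fastforce
  qed
  ultimately have "card (range th \<union> ?C) = CARD('a)" by (simp add: card_Un_disjoint)
  then have "range th \<union> ?C = UNIV" by (simp add: card_eq_UNIV_imp_eq_UNIV)
  then have "x \<in> ?C" using assms by blast
  then show ?thesis by auto
qed

text \<open>If the left-hand side vanished, \<open>th^(4n-1) p\<close> would kill the whole module, because \<open>range th\<close> has
  index 2 and misses \<open>P\<close>; then the \<open>p\<close>-torsion would have more than \<open>p^2\<close> elements.\<close>
theorem th_funpow_eq_T:
  assumes card: "CARD('a) = p^2 * 16^n" and p: "odd p" "p > 0" and n: "n > 0"
    and ann: "\<And>x::'a. smul (p * 4^n) x = 0" and P: "P \<notin> range th"
  shows "(th ^^ (4 * n - 1)) (smul p P) = T"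
proof -
  have four: "4 * n = Suc (4 * n - 1)" using n by simp
  have top: "(th ^^ (4 * n)) (smul p x) = 0" for x
  proof -
    obtain j where "(th ^^ (2 * (2 * n))) (smul p x) = (i ^^ j) (smul (2 ^ (2 * n)) (smul p x))"
      using th_funpow_even by blast
    moreover have "smul (2 ^ (2 * n)) (smul p x) = 0"
    proof -
      have e: "(2::nat) ^ (2 * n) * p = p * 4 ^ n" by (simp add: power_mult)
      show ?thesis unfolding smul_mult[symmetric] e by (rule ann)
    qed
    ultimately show ?thesis by (simp add: i_funpow_zero)
  qed
  let ?w = "(th ^^ (4 * n - 1)) (smul p P)"
  have "th ?w = 0" using top[of P] by (subst (asm) four) simp
  moreover have "?w \<noteq> 0"
  proof
    assume w: "?w = 0"
    have r: "(th ^^ (4 * n - 1)) (smul p (th x)) = 0" for x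
    proof -
      have "(th ^^ Suc (4 * n - 1)) (smul p x) = 0" using top[of x] four by simp
      then show ?thesis unfolding funpow_Suc_right by (simp add: th_smul)
    qed
    have all: "(th ^^ (4 * n - 1)) (smul p x) = 0" for x
    proof (cases "x \<in> range th")
      case True
      then show ?thesis using r by auto
    next
      case False
      then obtain u where "x - P = th u" using range_th_complement[OF P] by blast
      then have "x = P + th u" by (simp add: algebra_simps)
      then show ?thesis using w r additive.add[OF additive_funpow[OF additive_th]] by (simp add: smul_add)
    qed
    define c where "c = card {x::'a. smul p x = 0}"
    have c1: "CARD('a) = c * card (range (smul p :: 'a \<Rightarrow> 'a))"
      unfolding c_def by (rule card_kernel_range[OF additive_smul])
    have "card (range (smul p :: 'a \<Rightarrow> 'a)) \<le> card (ker (4 * n - 1))"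
      using all by (intro card_mono) auto
    then have le: "card (range (smul p :: 'a \<Rightarrow> 'a)) \<le> 2 ^ (4 * n - 1)" using card_ker_le le_trans by blast
    \<comment> \<open>Since \<open>p\<close> is odd, its kernel has no 2-torsion; hence
      \<open>c\<close> is odd, and as a divisor of \<open>p^2 * 16^n\<close> it divides
      \<open>p^2\<close>. An image of at most \<open>2^(4n-1)\<close> elements then leaves room for
      only half of the module.\<close>
    have "odd c" unfolding c_def
    proof (rule odd_card_no_2_torsion)
      fix x :: 'a assume x: "x \<in> {x. smul p x = 0}" and xx: "x + x = 0"
      obtain k where "p = 2 * k + 1" using p(1) by (elim oddE)
      then have "smul p x = smul k (x + x) + x"
        by (simp add: smul_add_left smul_add mult_2)
      then show "x = 0" using x xx by simp
    qed (auto simp: smul_minus)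
    then have "coprime c (2 ^ (4 * n))" by simp
    moreover have "(16::nat) ^ n = 2 ^ (4 * n)" by (simp add: power_mult)
    moreover have "c dvd p^2 * 16 ^ n" using c1 card by (metis dvd_triv_left)
    ultimately have "c dvd p^2" by (simp add: coprime_dvd_mult_left_iff)
    then have "c \<le> p^2" using p(2) by (simp add: dvd_imp_le)
    then have "p^2 * 16 ^ n \<le> p^2 * 2 ^ (4 * n - 1)" using c1 card le mult_le_mono by metis
    moreover have "(16::nat) ^ n = 2 * 2 ^ (4 * n - 1)"
      unfolding \<open>(16::nat) ^ n = 2 ^ (4 * n)\<close> by (subst four) simp
    ultimately show False using p(2) by simp
  qed
  ultimately show ?thesis using ker_th by blast
qed

end

subsection \<open>Jacobsthal sums\<close>

definition qchar :: "'a::field \<Rightarrow> int" where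
  "qchar a = (if a = 0 then 0 else if \<exists>b. b^2 = a then 1 else - 1)"

lemma qchar_0 [simp]: "qchar 0 = 0" by (simp add: qchar_def)

lemma qchar_square: "b \<noteq> 0 \<Longrightarrow> qchar (b^2) = 1" by (auto simp: qchar_def)

lemma qchar_1 [simp]: "qchar 1 = 1" using qchar_square[of 1] by simp

lemma qchar_eq_1_iff: "qchar a = 1 \<longleftrightarrow> a \<noteq> 0 \<and> (\<exists>b. b^2 = a)" by (auto simp: qchar_def)

lemma qchar_square_mult: 
  assumes "k \<noteq> 0" shows "qchar (k^2 * a) = qchar a"
proof -
  have "(\<exists>b. b^2 = k^2 * a) \<longleftrightarrow> (\<exists>b. b^2 = a)"
  proof
    assume "\<exists>b. b^2 = k^2 * a"
    then obtain b where "b^2 = k^2 * a" ..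
    then have "(b / k)^2 = a" using assms by (simp add: power_divide)
    then show "\<exists>b. b^2 = a" ..
  next
    assume "\<exists>b. b^2 = a"
    then obtain b where "b^2 = a" ..
    then have "(k * b)^2 = k^2 * a" by (simp add: power_mult_distrib)
    then show "\<exists>b. b^2 = k^2 * a" ..
  qed
  then show ?thesis using assms by (simp add: qchar_def)
qed

context
  assumes two: "(2::'a::{field, finite}) \<noteq> 0"
begin

lemma square_eq: "(b::'a)^2 = c^2 \<longleftrightarrow> b = c \<or> b = - c"
  by (simp add: power2_eq_iff)

lemma neg_neq: "(b::'a) \<noteq> 0 \<Longrightarrow> - b \<noteq> b"
proof
  assume "b \<noteq> 0" "- b = b"
  then have "2 * b = 0" by (metis add.left_inverse mult_2)
  then show False using two \<open>b \<noteq> 0\<close> by simp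
qed

lemma card_square_roots: "int (card {y::'a. y^2 = a}) = 1 + qchar a"
proof (cases "\<exists>b. b^2 = a")
  case True
  then obtain b where b: "b^2 = a" ..
  have "{y. y^2 = a} = {b, - b}" unfolding b[symmetric] square_eq by auto
  then show ?thesis using b neg_neq[of b] by (cases "b = 0") (auto simp: qchar_square)
next
  case False
  then have "{y. y^2 = a} = {}" by auto
  moreover have "a \<noteq> 0" using False by (metis zero_power2)
  ultimately show ?thesis using False by (simp add: qchar_def)
qed

lemma sum_qchar: "(\<Sum>a\<in>(UNIV::'a set). qchar a) = 0"
proof -
  have "(\<Sum>a\<in>(UNIV::'a set). 1 + qchar a) = (\<Sum>a\<in>UNIV. int (card {y::'a. y^2 = a}))"
    by (simp add: card_square_roots)
  also have "\<dots> = int (card (\<Union>a\<in>UNIV. {y::'a. y^2 = a}))"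
    by (subst card_UN_disjoint) auto
  also have "(\<Union>a\<in>UNIV. {y::'a. y^2 = a}) = UNIV" by auto
  finally show ?thesis by (simp add: sum.distrib)
qed

lemma sum_scale: "k \<noteq> 0 \<Longrightarrow> (\<Sum>x\<in>(UNIV::'a set). g (k * x)) = (\<Sum>x\<in>UNIV. (g x :: int))"
  by (rule sum.reindex_bij_betw) (rule bij_betwI[where g="\<lambda>x. x / k"]; simp)

lemma qchar_mult: "qchar (a * b :: 'a) = qchar a * qchar b"
proof (cases "a = 0 \<or> b = 0")
  case False
  then have nz: "a \<noteq> 0" "b \<noteq> 0" by auto
  show ?thesis
  proof (cases "qchar a = 1 \<or> qchar b = 1")
    case True
    then show ?thesis
    proof
      assume "qchar a = 1"
      then obtain k where "k^2 = a" by (auto simp: qchar_eq_1_iff)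
      then show ?thesis using qchar_square_mult[of k b] nz \<open>qchar a = 1\<close> by auto
    next
      assume "qchar b = 1"
      then obtain k where "k^2 = b" by (auto simp: qchar_eq_1_iff)
      then show ?thesis using qchar_square_mult[of k a] nz \<open>qchar b = 1\<close> by (auto simp: mult.commute)
    qed
  next
    case ns: False
    have m1: "qchar a = - 1" "qchar b = - 1" using ns nz by (auto simp: qchar_def split: if_splits)
    text \<open>Each summand of \<open>\<Sum>x. qchar x + qchar (a * x) = 0\<close> is nonpositive.\<close>
    have le: "qchar x + qchar (a * x) \<le> 0" for x
    proof (cases "qchar x = 1")
      case True
      then obtain k where "k^2 = x" "k \<noteq> 0" by (auto simp: qchar_eq_1_iff)
      then have "qchar (a * x) = - 1" using qchar_square_mult[of k a] m1 by (simp add: mult.commute)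
      then show ?thesis using True by simp
    next
      case False
      show ?thesis
      proof (cases "x = 0")
        case False
        then have "qchar x = - 1" using \<open>qchar x \<noteq> 1\<close> by (auto simp: qchar_def split: if_splits)
        then show ?thesis by (simp add: qchar_def)
      qed simp
    qed
    have "(\<Sum>x\<in>UNIV. - (qchar x + qchar (a * x))) = 0"
      unfolding sum_negf sum.distrib using sum_qchar sum_scale[OF nz(1), of qchar] by simp
    moreover have "(\<Sum>x\<in>UNIV. - (qchar x + qchar (a * x))) = 0 \<longleftrightarrow> (\<forall>x\<in>UNIV. - (qchar x + qchar (a * x)) = 0)"
      by (rule sum_nonneg_eq_0_iff) (simp_all only: finite neg_0_le_iff_le le)
    ultimately have "- (qchar b + qchar (a * b)) = 0" by blast
    then show ?thesis using m1 by simp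
  qed
qed auto

text \<open>Dividing \<open>b * (b + (v - u))\<close> by the square \<open>b^2\<close> leaves
  \<open>1 + (v - u) / b\<close>, which for \<open>u \<noteq> v\<close> runs through every value
  except 1.\<close>

lemma sum_qchar_product: 
  "(\<Sum>a\<in>(UNIV::'a set). qchar ((u - a) * (v - a))) = (if u = v then int CARD('a) - 1 else - 1)"
proof -
  have "(\<Sum>a\<in>(UNIV::'a set). qchar ((u - a) * (v - a))) = (\<Sum>b\<in>UNIV. qchar (b * (b + (v - u))))"
    by (rule sum.reindex_bij_witness[of _ "\<lambda>b. u - b" "\<lambda>a. u - a"]) (auto simp: algebra_simps)
  also have "\<dots> = (\<Sum>b\<in>UNIV - {0}. qchar (b * (b + (v - u))))"
    by (rule sum.mono_neutral_right) auto
  also have "\<dots> = (\<Sum>b\<in>UNIV - {0}. qchar (1 + (v - u) / b))"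
  proof (rule sum.cong)
    fix b :: 'a assume "b \<in> UNIV - {0}"
    then have b: "b \<noteq> 0" by simp
    then have "b * (b + (v - u)) = b^2 * (1 + (v - u) / b)" by (simp add: field_simps power2_eq_square)
    then show "qchar (b * (b + (v - u))) = qchar (1 + (v - u) / b)" using qchar_square_mult[OF b] by simp
  qed simp
  also have "\<dots> = (if u = v then int CARD('a) - 1 else - 1)"
  proof (cases "u = v")
    case True
    then show ?thesis by (simp add: card_Diff_subset)
  next
    case False
    then have d: "v - u \<noteq> 0" by simp
    have "(\<Sum>b\<in>UNIV - {0}. qchar (1 + (v - u) / b)) = (\<Sum>e\<in>UNIV - {1::'a}. qchar e)"
      by (rule sum.reindex_bij_witness[of _ "\<lambda>e. (v - u) / (e - 1)" "\<lambda>b. 1 + (v - u) / b"])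
         (use d in auto)
    also have "\<dots> = - 1" using sum_qchar by (simp add: sum_diff1)
    finally show ?thesis using False by simp
  qed
  finally show ?thesis .
qed

definition jacobsthal :: "'a \<Rightarrow> int" where
  "jacobsthal a = (\<Sum>x\<in>UNIV. qchar (x^3 - a * x))"

lemma jacobsthal_0: "jacobsthal 0 = 0"
proof -
  have "qchar (x^3) = qchar x" for x :: 'a
    using qchar_square_mult[of x x] by (cases "x = 0") (simp_all add: power2_eq_square power3_eq_cube mult.assoc)
  then show ?thesis unfolding jacobsthal_def using sum_qchar by simp
qed

lemma jacobsthal_scale:
  assumes "k \<noteq> 0"
  shows "(jacobsthal (k^2 * a))^2 = (jacobsthal a)^2"
proof -
  have "jacobsthal (k^2 * a) = (\<Sum>t\<in>UNIV. qchar ((k * t)^3 - k^2 * a * (k * t)))"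
    unfolding jacobsthal_def by (rule sum_scale[OF assms, symmetric])
  also have "\<dots> = (\<Sum>t\<in>UNIV. qchar k * qchar (t^3 - a * t))"
  proof (rule sum.cong)
    fix t :: 'a
    have "(k * t)^3 - k^2 * a * (k * t) = k^2 * (k * (t^3 - a * t))"
      by (simp add: algebra_simps power2_eq_square power3_eq_cube)
    then show "qchar ((k * t)^3 - k^2 * a * (k * t)) = qchar k * qchar (t^3 - a * t)"
      using qchar_square_mult[OF assms] by (simp add: qchar_mult)
  qed simp
  also have "\<dots> = qchar k * jacobsthal a" by (simp add: jacobsthal_def sum_distrib_left)
  finally have "jacobsthal (k^2 * a) = qchar k * jacobsthal a" .
  moreover have "(qchar k)^2 = 1" using assms by (simp add: qchar_def)
  ultimately show ?thesis by (simp add: power_mult_distrib)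
qed

text \<open>Expand the square and sum over the parameter \<open>a\<close> first. By
  \<open>sum_qchar_product\<close> only the pairs \<open>y = x\<close> and \<open>y = - x\<close>
  contribute beyond a vanishing sum, and they contribute equally because \<open>- 1\<close> is a
  square.\<close>

lemma jacobsthal_second_moment:
  assumes m1: "qchar (- 1 :: 'a) = 1"
  shows "(\<Sum>a\<in>(UNIV::'a set). (jacobsthal a)^2) = 2 * int CARD('a) * (int CARD('a) - 1)"
proof -
  let ?q = "int CARD('a)"
  have e: "qchar (x^3 - a * x) * qchar (y^3 - a * y) = qchar (x * y) * qchar ((x^2 - a) * (y^2 - a))" for a x y :: 'a
    by (simp add: power2_eq_square power3_eq_cube algebra_simps flip: qchar_mult)
  have "(\<Sum>a\<in>(UNIV::'a set). (jacobsthal a)^2) =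
     (\<Sum>a\<in>(UNIV::'a set). \<Sum>x\<in>UNIV. \<Sum>y\<in>UNIV. qchar (x * y) * qchar ((x^2 - a) * (y^2 - a)))"
    unfolding jacobsthal_def power2_eq_square[of "sum _ _"] sum_product e ..
  also have "\<dots> = (\<Sum>x\<in>(UNIV::'a set). \<Sum>a\<in>UNIV. \<Sum>y\<in>UNIV. qchar (x * y) * qchar ((x^2 - a) * (y^2 - a)))"
    by (rule sum.swap)
  also have "\<dots> = (\<Sum>x\<in>(UNIV::'a set). \<Sum>y\<in>UNIV. \<Sum>a\<in>UNIV. qchar (x * y) * qchar ((x^2 - a) * (y^2 - a)))"
    by (intro sum.cong refl sum.swap)
  also have "\<dots> = (\<Sum>x\<in>UNIV. \<Sum>y\<in>UNIV. qchar (x * y) * (if (x::'a)^2 = y^2 then ?q - 1 else - 1))"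
    unfolding sum_distrib_left[symmetric] sum_qchar_product ..
  also have "\<dots> = (\<Sum>x\<in>UNIV. \<Sum>y\<in>UNIV. (if (x::'a)^2 = y^2 then ?q * qchar (x * y) else 0) - qchar x * qchar y)"
    by (intro sum.cong refl) (simp add: qchar_mult algebra_simps)
  also have "\<dots> = (\<Sum>x\<in>UNIV. (\<Sum>y\<in>UNIV. if (x::'a)^2 = y^2 then ?q * qchar (x * y) else 0) - qchar x * (\<Sum>y\<in>(UNIV::'a set). qchar y))"
    by (simp add: sum_subtractf sum_distrib_left)
  also have "\<dots> = (\<Sum>x\<in>UNIV. \<Sum>y\<in>UNIV. if (x::'a)^2 = y^2 then ?q * qchar (x * y) else 0)"
    by (simp add: sum_qchar)
  also have "\<dots> = (\<Sum>x\<in>(UNIV::'a set). if x = 0 then 0 else 2 * ?q)"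
  proof (intro sum.cong refl)
    fix x :: 'a
    have "(\<Sum>y\<in>UNIV. if x^2 = y^2 then ?q * qchar (x * y) else 0) = (\<Sum>y\<in>{x, - x}. ?q * qchar (x * y))"
      by (rule sum.mono_neutral_cong_right) (auto simp: square_eq power2_eq_iff)
    also have "\<dots> = (if x = 0 then 0 else 2 * ?q)"
    proof (cases "x = 0")
      case False
      have "qchar (x * x) = 1" using qchar_square[OF False] by (simp add: power2_eq_square)
      moreover have "qchar (x * - x) = qchar (- 1 :: 'a) * qchar (x * x)" using qchar_mult[of "- 1" "x * x"] by simp
      moreover have "(\<Sum>y\<in>{x, - x}. ?q * qchar (x * y)) = ?q * qchar (x * x) + ?q * qchar (x * - x)"
        using neg_neq[OF False, symmetric] by simp
      ultimately show ?thesis using False m1 by simp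
    qed simp
    finally show "(\<Sum>y\<in>UNIV. if x^2 = y^2 then ?q * qchar (x * y) else 0) = (if x = 0 then 0 else 2 * ?q)" .
  qed
  also have "\<dots> = (\<Sum>x\<in>UNIV - {0::'a}. 2 * ?q)"
    by (rule sum.mono_neutral_cong_right) auto
  finally show ?thesis by (simp add: card_Diff_subset)
qed

text \<open>By \<open>jacobsthal_scale\<close> the square of the sum depends only on the class of
  \<open>a\<close> modulo squares. It takes two values, each for half of the nonzero
  \<open>a\<close>, and the second moment determines their total.\<close>

theorem jacobsthal_identity:
  assumes m1: "qchar (- 1 :: 'a) = 1" and g: "qchar (g::'a) = - 1"
  shows "(jacobsthal 1)^2 + (jacobsthal g)^2 = 4 * int CARD('a)"
proof -
  let ?q = "int CARD('a)" and ?S = "\<lambda>a. (jacobsthal a)^2"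
  \<comment> \<open>Both classes in one formula, so that the term with \<open>qchar a\<close>
    disappears on summation.\<close>
  have v: "2 * ?S a = (?S 1 + ?S g) + qchar a * (?S 1 - ?S g)" if "a \<noteq> 0" for a
  proof (cases "qchar a = 1")
    case True
    then obtain k where "k^2 = a" "k \<noteq> 0" by (auto simp: qchar_eq_1_iff)
    then show ?thesis using jacobsthal_scale[of k 1] True by simp
  next
    case False
    then have a: "qchar a = - 1" using that by (auto simp: qchar_def split: if_splits)
    have "g \<noteq> 0" using g by auto
    have "qchar (a * g) = 1" using a g by (simp add: qchar_mult)
    then obtain k where k: "k^2 = a * g" "a * g \<noteq> 0" by (auto simp: qchar_eq_1_iff)
    then have "(k / g)^2 * g = a" using \<open>g \<noteq> 0\<close> by (simp add: power_divide power2_eq_square)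
    then show ?thesis using jacobsthal_scale[of "k / g" g] k \<open>g \<noteq> 0\<close> a by auto
  qed
  have "2 * (2 * ?q * (?q - 1)) = (\<Sum>a\<in>UNIV. 2 * ?S a)"
    using jacobsthal_second_moment[OF m1] by (simp flip: sum_distrib_left)
  also have "\<dots> = (\<Sum>a\<in>UNIV - {0::'a}. 2 * ?S a)"
    by (rule sum.mono_neutral_right) (auto simp: jacobsthal_0)
  also have "\<dots> = (\<Sum>a\<in>UNIV - {0::'a}. (?S 1 + ?S g) + qchar a * (?S 1 - ?S g))"
    using v by (intro sum.cong) auto
  also have "\<dots> = (?q - 1) * (?S 1 + ?S g) + (\<Sum>a\<in>UNIV - {0::'a}. qchar a) * (?S 1 - ?S g)"
    by (simp add: sum.distrib sum_distrib_right card_Diff_subset)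
  also have "(\<Sum>a\<in>UNIV - {0::'a}. qchar a) = 0" using sum_qchar by (simp add: sum_diff1)
  finally have "(?q - 1) * (4 * ?q) = (?q - 1) * (?S 1 + ?S g)" by (simp add: mult_ac)
  moreover have "?q - 1 \<noteq> 0"
  proof -
    have "card {0, 1 :: 'a} \<le> CARD('a)" by (rule card_mono) auto
    then show ?thesis by simp
  qed
  ultimately show ?thesis by simp
qed

lemma card_curve:
  assumes "b \<noteq> 0"
  shows "int (card {(x::'a, y). b * y^2 = x^3 - x}) = int CARD('a) + qchar b * jacobsthal 1"
proof -
  have "{(x::'a, y). b * y^2 = x^3 - x} = (SIGMA x:UNIV. {y. y^2 = (x^3 - x) / b})"
    using assms by (auto simp: field_simps)
  then have "int (card {(x::'a, y). b * y^2 = x^3 - x}) = (\<Sum>x\<in>UNIV. 1 + qchar ((x^3 - x) / b))"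
    by (simp add: card_square_roots)
  also have "\<dots> = (\<Sum>x\<in>UNIV. 1 + qchar b * qchar (x^3 - 1 * x :: 'a))"
  proof (intro sum.cong refl arg_cong2[of _ _ _ _ "(+)"])
    fix x :: 'a
    have "(x^3 - x) / b = (1 / b)^2 * (b * (x^3 - x))" using assms by (simp add: power2_eq_square)
    then show "qchar ((x^3 - x) / b) = qchar b * qchar (x^3 - 1 * x)"
      using qchar_square_mult[of "1 / b"] assms by (simp add: qchar_mult)
  qed
  finally show ?thesis by (simp add: sum.distrib jacobsthal_def sum_distrib_left)
qed

end

text \<open>Since \<open>m^2\<close> is \<open>- 1\<close> modulo \<open>q\<close>, the prime
  \<open>q\<close> divides \<open>(s - m * t) * (s + m * t)\<close>. If it divides the first factor,
  the product identity for sums of two squares bounds the quotient by 1; otherwise replace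
  \<open>t\<close> by \<open>- t\<close>.\<close>

lemma sum_two_squares_unique:
  fixes s t m q :: int
  assumes q: "prime q" "q = m^2 + 1" and st: "s^2 + t^2 = q"
  shows "\<bar>s\<bar> = 1 \<or> \<bar>s\<bar> = \<bar>m\<bar>"
proof -
  have q0: "q > 0" using q(1) by (simp add: prime_gt_0_int)
  have main: "\<bar>s\<bar> = 1 \<or> \<bar>s\<bar> = \<bar>m\<bar>" if st: "s^2 + t^2 = q" and d: "q dvd s - m * t" for t
  proof -
    have e: "(s * m + t)^2 + (s - m * t)^2 = q^2"
    proof -
      have "(s * m + t)^2 + (s - m * t)^2 = (s^2 + t^2) * (m^2 + 1)" by (simp add: power2_eq_square algebra_simps)
      then show ?thesis using st q(2) by (simp add: power2_eq_square)
    qed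
    obtain k where k: "s - m * t = q * k" using d by blast
    have "q^2 * k^2 \<le> q^2 * 1" 
      using e zero_le_power2[of "s * m + t"] unfolding k power_mult_distrib by linarith
    then have k2: "k^2 \<le> 1" using q0 by simp
    then have "\<bar>k\<bar> \<le> 1" by (simp add: abs_square_le_1)
    then consider "k = 0" | "\<bar>k\<bar> = 1" by linarith
    then show ?thesis
    proof cases
      case 1
      then have s: "s = m * t" using k by simp
      then have "t^2 * q = 1 * q" using st q(2) by (simp add: power_mult_distrib algebra_simps)
      then have "t^2 = 1" using q0 by simp
      then show ?thesis using s by (auto simp: power2_eq_1_iff)
    next
      case 2
      then have "k^2 = 1" by (simp add: abs_square_eq_1)
      then have "(s * m + t)^2 = 0" using e unfolding k by (simp add: power_mult_distrib)
      then have t: "t = - (s * m)" by simp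
      then have "s^2 * q = 1 * q" using st q(2) by (simp add: power_mult_distrib algebra_simps)
      then have "s^2 = 1" using q0 by simp
      then show ?thesis by (auto simp: power2_eq_1_iff)
    qed
  qed
  have "(s - m * t) * (s - m * (- t)) = q * (1 - t^2)"
  proof -
    have "(s - m * t) * (s - m * (- t)) = (s^2 + t^2) - t^2 * (m^2 + 1)" by (simp add: power2_eq_square algebra_simps)
    then show ?thesis using st q(2) by (simp add: algebra_simps)
  qed
  then have "q dvd s - m * t \<or> q dvd s - m * (- t)" using q(1) by (metis dvd_triv_left prime_dvd_mult_iff)
  then show ?thesis using main[of t] main[of "- t"] st by auto
qed

subsection \<open>The group of points of \<open>30 y^2 = x^3 - x\<close>\<close>

lemma sixteen_power: "(16::'a::comm_semiring_1)^n = (4^n)^2"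
proof -
  have "(16::'a)^n = (4 * 4)^n" by simp
  then show ?thesis by (simp only: power_mult_distrib power2_eq_square)
qed

text \<open>A type class, so that the points over such a field form a type of class
  \<open>ab_group_add\<close>. Inverting 30 inverts 2 as well and keeps the curve
  nonsingular.\<close>

class field_30 = field_gcd + finite +
  assumes thirty_nz: "30 \<noteq> 0"

lemma two_nz_30: "(2::'a::field_30) \<noteq> 0"
proof
  assume "(2::'a) = 0"
  then have "(2::'a) * 15 = 0" by (simp only: mult_zero_left)
  then show False using thirty_nz[where 'a='a] by simp
qed

interpretation E30: ec_field "30 :: 'a::field_30"
  by unfold_locales (rule thirty_nz two_nz_30)+

fun ec_i :: "'a::field \<Rightarrow> 'a ecpt \<Rightarrow> 'a ecpt" where
  "ec_i c Inf = Inf"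
| "ec_i c (Aff x y) = Aff (- x) (c * y)"

lemma on_curve_i:
  assumes "c^2 = - 1" "on_curve A P"
  shows "on_curve A (ec_i c P)"
proof (cases P)
  case (Aff x y)
  have "A * (c * y)^2 = c^2 * (A * y^2)" by Groebner_Basis.algebra
  also have "\<dots> = (- x)^3 - (- x)" using assms Aff by simp
  finally show ?thesis using Aff by simp
qed simp

text \<open>The automorphism is linear in the coordinates, so it maps lines to lines; it multiplies
  slopes by \<open>- c\<close>.\<close>

lemma (in ec_field) ec_i_add:
  assumes c: "c^2 = - 1" and P: "on_curve A P" and Q: "on_curve A Q"
  shows "ec_i c (ec_add A P Q) = ec_add A (ec_i c P) (ec_i c Q)"
proof (cases "P = Inf \<or> Q = Inf")
  case True
  then show ?thesis by auto
next
  case False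
  then obtain x1 y1 x2 y2 where PQ: "P = Aff x1 y1" "Q = Aff x2 y2" by (cases P; cases Q) auto
  show ?thesis
  proof (cases "x1 = x2 \<and> y1 + y2 = 0")
    case True
    then have "y2 = - y1" by (simp add: eq_neg_iff_add_eq_0 add.commute)
    then show ?thesis using True by (simp add: PQ)
  next
    case False
    then obtain l where l: "is_slope A l x1 y1 x2 y2" using slope_exists P Q PQ by blast
    have cc: "c * c = - 1" using c by (simp add: power2_eq_square)
    have "(- (c * l)) * (- x2 - - x1) = c * (l * (x2 - x1))" by Groebner_Basis.algebra
    moreover have l1: "l * (x2 - x1) = y2 - y1" using l by (simp add: is_slope_def)
    ultimately have 1: "(- (c * l)) * (- x2 - - x1) = c * y2 - c * y1" by (metis right_diff_distrib)
    have "A * (- (c * l)) * (c * y1 + c * y2) = - (c * c) * (A * l * (y1 + y2))" by Groebner_Basis.algebra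
    then have 2: "A * (- (c * l)) * (c * y1 + c * y2) = (- x1)^2 + - x1 * - x2 + (- x2)^2 - 1"
      using l unfolding cc is_slope_def by simp
    have l': "is_slope A (- (c * l)) (- x1) (c * y1) (- x2) (c * y2)"
      unfolding is_slope_def using 1 2 by blast
    have c1: "on_curve A (Aff x1 y1)" "on_curve A (Aff (- x1) (c * y1))"
      using P PQ on_curve_i[OF c, of A P] by auto
    have e: "A * (- (c * l))^2 - - x1 - - x2 = - (A * l^2 - x1 - x2)"
      using c by Groebner_Basis.algebra
    have e2: "- (c * l) * (- x1 - - (A * l^2 - x1 - x2)) - c * y1 = c * (l * (x1 - (A * l^2 - x1 - x2)) - y1)"
      by Groebner_Basis.algebra
    show ?thesis
      unfolding PQ ec_add_slope[OF l c1(1)] ec_i.simps ec_add_slope[OF l' c1(2)] e e2 ..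
  qed
qed

typedef (overloaded) ('a::field_30) pt = "{P :: 'a ecpt. on_curve 30 P}"
  morphisms ec_of Pt
  by (rule exI[of _ Inf]) simp

setup_lifting type_definition_pt

instantiation pt :: (field_30) ab_group_add
begin

lift_definition zero_pt :: "'a pt" is Inf by simp
lift_definition plus_pt :: "'a pt \<Rightarrow> 'a pt \<Rightarrow> 'a pt" is "ec_add 30" by (rule E30.on_curve_add)
lift_definition uminus_pt :: "'a pt \<Rightarrow> 'a pt" is ec_neg by simp
definition minus_pt :: "'a pt \<Rightarrow> 'a pt \<Rightarrow> 'a pt" where "minus_pt P Q = P + - Q"

instance
proof
  fix a b c :: "'a pt"
  show "a + b + c = a + (b + c)" by transfer (rule E30.ec_add_assoc)
  show "a + b = b + a" by transfer (rule E30.ec_add_commute)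
  show "0 + a = a" by transfer simp
  show "- a + a = 0" by transfer simp
  show "a - b = a + - b" by (simp add: minus_pt_def)
qed

end

section \<open>Finiteness and number of points\<close>

lemma finite_points: "finite {P :: 'a::{field, finite} ecpt. on_curve A P}"
proof (rule finite_subset)
  show "{P. on_curve A P} \<subseteq> insert Inf ((\<lambda>(x, y). Aff x y) ` (UNIV :: ('a \<times> 'a) set))"
  proof
    fix P :: "'a ecpt"
    show "P \<in> insert Inf ((\<lambda>(x, y). Aff x y) ` UNIV)" by (cases P) auto
  qed
qed simp

instance pt :: (field_30) finite
proof
  have "(UNIV :: 'a pt set) = Pt ` {P. on_curve 30 P}"
    using type_definition.Abs_image[OF type_definition_pt] by metis
  then show "finite (UNIV :: 'a pt set)" using finite_points finite_imageI by metis
qed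

lemma card_pt: "CARD('a::field_30 pt) = Suc (card {(x::'a, y). 30 * y^2 = x^3 - x})"
proof -
  let ?S = "{(x::'a, y). 30 * y^2 = x^3 - x}"
  have "CARD('a pt) = card {P :: 'a ecpt. on_curve 30 P}"
    by (rule type_definition.card[OF type_definition_pt])
  also have "{P :: 'a ecpt. on_curve 30 P} = insert Inf ((\<lambda>(x, y). Aff x y) ` ?S)"
  proof -
    have "P \<in> {P. on_curve 30 P} \<longleftrightarrow> P \<in> insert Inf ((\<lambda>(x, y). Aff x y) ` ?S)" for P :: "'a ecpt"
      by (cases P) auto
    then show ?thesis by blast
  qed
  also have "card \<dots> = Suc (card ((\<lambda>(x, y). Aff x y) ` ?S))"
    by (subst card_insert_disjoint) auto
  also have "card ((\<lambda>(x, y). Aff x y) ` ?S) = card ?S"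
    by (rule card_image) (auto simp: inj_on_def)
  finally show ?thesis .
qed

section \<open>The action of \<open>i\<close> and divisibility by \<open>1 + i\<close>\<close>

definition rot :: "'a::field_30 \<Rightarrow> 'a pt \<Rightarrow> 'a pt" where
  "rot c P = Pt (ec_i c (ec_of P))"

definition one_plus :: "'a::field_30 \<Rightarrow> 'a pt \<Rightarrow> 'a pt" where
  "one_plus c P = P + rot c P"

definition T0 :: "'a::field_30 pt" where "T0 = Pt (Aff 0 0)"

lemma on_curve_ec_of [simp]: "on_curve 30 (ec_of P)"
  using ec_of by auto

lemma ec_of_Pt: "on_curve 30 P \<Longrightarrow> ec_of (Pt P) = P"
  by (rule Pt_inverse) simp

lemma ec_of_rot: "c^2 = - 1 \<Longrightarrow> ec_of (rot c P) = ec_i c (ec_of P)"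
  unfolding rot_def by (rule ec_of_Pt) (rule on_curve_i; simp)

lemma ec_of_T0: "ec_of T0 = Aff 0 0"
  unfolding T0_def by (rule ec_of_Pt) simp

lemma pt_eq: "ec_of P = ec_of Q \<Longrightarrow> P = Q"
  by (simp add: ec_of_inject)

lemma kum_one_plus:
  assumes "c^2 = - 1" "ec_of P = Aff x y"
  shows "kum (ec_of (one_plus c P)) (x^2 - 1) (2 * c * x)"
proof -
  have "on_curve 30 (Aff x y)" using on_curve_ec_of[of P] assms(2) by simp
  then show ?thesis using one_plus_i_kummer[OF E30.ec_field_axioms _ assms(1)]
    by (simp add: one_plus_def plus_pt.rep_eq ec_of_rot[OF assms(1)] assms(2))
qed

lemma ec_of_zero_y:
  assumes "ec_of P = Aff x y" "y = 0 \<or> x^3 - x = 0"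
  shows "y = 0" "x = 0 \<or> x = 1 \<or> x = - 1"
proof -
  have e: "30 * y^2 = x^3 - x" using on_curve_ec_of[of P] assms(1) by simp
  then have z: "x^3 - x = 0" using assms(2) by auto
  then have "(30::'a) = 0 \<or> y^2 = 0" using e by (metis mult_eq_0_iff)
  then show "y = 0" using thirty_nz[where 'a='a] by simp
  have "x * (x - 1) * (x + 1) = 0" using z by (simp add: algebra_simps power3_eq_cube)
  then show "x = 0 \<or> x = 1 \<or> x = - 1" by (auto simp: eq_neg_iff_add_eq_0)
qed

lemma gauss_module_pt:
  assumes c: "(c::'a::field_30)^2 = - 1"
  shows "gauss_module (rot c) (one_plus c) T0"
proof
  fix P Q :: "'a pt"
  show "rot c (P + Q) = rot c P + rot c Q"
    by (rule pt_eq) (simp add: ec_of_rot[OF c] plus_pt.rep_eq E30.ec_i_add[OF c])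
  have cc: "c * c = - 1" using c by (simp add: power2_eq_square)
  have "ec_i c (ec_i c R) = ec_neg R" for R
    by (cases R) (simp_all add: cc flip: mult.assoc)
  then show "rot c (rot c P) = - P"
    by (intro pt_eq) (simp add: ec_of_rot[OF c] uminus_pt.rep_eq)
  show "one_plus c P = P + rot c P" by (simp add: one_plus_def)
  show "T0 \<noteq> (0 :: 'a pt)"
  proof
    assume "T0 = (0 :: 'a pt)"
    then have "ec_of (T0 :: 'a pt) = ec_of 0" by simp
    then show False by (simp add: ec_of_T0 zero_pt.rep_eq)
  qed
  show "one_plus c P = 0 \<longleftrightarrow> P = 0 \<or> P = T0"
  proof
    assume z: "one_plus c P = 0"
    show "P = 0 \<or> P = T0"
    proof (cases "ec_of P")
      case Inf
      then show ?thesis by (metis pt_eq zero_pt.rep_eq)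
    next
      case (Aff x y)
      have "2 * c * x = 0" using kum_one_plus[OF c Aff] z by (simp add: zero_pt.rep_eq)
      then have x: "x = 0" using c two_nz_30[where 'a='a] by auto
      then have "y = 0" using ec_of_zero_y(1)[OF Aff] by simp
      then show ?thesis using Aff x by (metis pt_eq ec_of_T0)
    qed
  next
    assume "P = 0 \<or> P = T0"
    then show "one_plus c P = 0"
      by (auto intro!: pt_eq simp: one_plus_def plus_pt.rep_eq ec_of_rot[OF c] ec_of_T0 zero_pt.rep_eq)
  qed
qed

text \<open>At most two ordinates for each abscissa. A bound linear in the field size suffices, as
  it is compared with \<open>16^n\<close> for a field of at most \<open>8^n\<close>
  elements.\<close>

lemma card_pt_le: "CARD('a::field_30 pt) \<le> 2 * CARD('a) + 1"
proof -
  have "card {y::'a. y^2 = a} \<le> 2" for a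
    using card_square_roots[OF two_nz_30, of a] by (simp add: qchar_def split: if_splits)
  then have "card {y::'a. 30 * y^2 = x^3 - x} \<le> 2" for x
  proof -
    have "{y::'a. 30 * y^2 = x^3 - x} = {y. y^2 = (x^3 - x) / 30}"
      using nonzero_eq_divide_eq[OF thirty_nz, of _ "x^3 - x"] by (metis mult.commute)
    then show ?thesis using \<open>\<And>a. card {y::'a. y^2 = a} \<le> 2\<close> by metis
  qed
  then have "(\<Sum>x\<in>(UNIV::'a set). card {y::'a. 30 * y^2 = x^3 - x}) \<le> (\<Sum>x\<in>(UNIV::'a set). 2)"
    by (intro sum_mono)
  moreover have "{(x::'a, y). 30 * y^2 = x^3 - x} = (SIGMA x:UNIV. {y. 30 * y^2 = x^3 - x})" by auto
  ultimately show ?thesis unfolding card_pt by simp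
qed

theorem card_bound_of_order:
  assumes "(c::'a::field_30)^2 = - 1" "(one_plus c ^^ k) R = T0"
  shows "2 ^ Suc k \<le> 2 * CARD('a) + 1"
proof -
  interpret gauss_module "rot c" "one_plus c" T0 by (rule gauss_module_pt[OF assms(1)])
  have "2 ^ Suc k = card (ker (Suc k))" using card_ker[OF assms(2)] by simp
  also have "\<dots> \<le> CARD('a pt)" by (rule card_mono) auto
  also have "\<dots> \<le> 2 * CARD('a) + 1" by (rule card_pt_le)
  finally show ?thesis .
qed

definition P0 :: "'a::field_30 pt" where "P0 = Pt (Aff 5 2)"

lemma ec_of_P0: "ec_of P0 = Aff 5 2"
  unfolding P0_def by (rule ec_of_Pt) simp

text \<open>A preimage would have abscissa \<open>x\<close> with
  \<open>x^2 - 1 = 10 * c * x\<close>, that is \<open>(x - 5 * c)^2 = - 24\<close>. Multiplied by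
  \<open>c^2 = - 1\<close> this makes 24, and so 6, a square.\<close>

lemma P0_notin_range:
  assumes c: "(c::'a::field_30)^2 = - 1" and six: "\<not> (\<exists>s::'a. s^2 = 6)"
  shows "P0 \<notin> range (one_plus c)"
proof
  assume "P0 \<in> range (one_plus c)"
  then obtain S where S: "P0 = one_plus c S" by auto
  show False
  proof (cases "ec_of S")
    case Inf
    then have "S = 0" by (metis pt_eq zero_pt.rep_eq)
    then have "P0 = (0 :: 'a pt)"
      using S by (metis gauss_module.ker_th[OF gauss_module_pt[OF c]])
    then show False using ec_of_P0[where 'a='a] by (simp add: zero_pt.rep_eq)
  next
    case (Aff x y)
    have "x^2 - 1 = 5 * (2 * c * x)" using kum_one_plus[OF c Aff] S[symmetric] by (simp add: ec_of_P0)
    then have sq: "(c * (x - 5 * c))^2 = 2 * 2 * 6" using c by Groebner_Basis.algebra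
    define w where "w = c * (x - 5 * c) / 2"
    have "w * 2 = c * (x - 5 * c)"
      unfolding w_def by (rule nonzero_eq_divide_eq[THEN iffD1, OF two_nz_30 refl])
    then have "w^2 * (2 * 2) = 6 * (2 * 2)" using sq by Groebner_Basis.algebra
    moreover have "(2::'a) * 2 \<noteq> 0" using two_nz_30[where 'a='a] by (simp only: mult_eq_0_iff) simp
    ultimately have "w^2 = 6" by (metis mult_right_cancel)
    then show False using six by blast
  qed
qed

text \<open>\<open>2 = (1 + i) (1 - i)\<close>.\<close>

lemma one_plus_twice:
  assumes c: "(c::'a::field_30)^2 = - 1"
  shows "Z + Z \<in> range (one_plus c)"
proof -
  interpret gauss_module "rot c" "one_plus c" T0 by (rule gauss_module_pt[OF c])
  have "one_plus c (Z - rot c Z) = Z + Z"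
    by (simp add: one_plus_def additive.diff[OF additive_i] i_i algebra_simps)
  then show ?thesis by (metis rangeI)
qed

text \<open>The map \<open>x \<mapsto> (x^2 - 1) / (2 * c * x)\<close> sends \<open>c\<close> to 1
  and 1 to 0. The abscissa \<open>c\<close> belongs to a point over the field because
  \<open>c^3 - c = (1 - c)^2\<close> and 30 is a square.\<close>

lemma one_plus_cubed_torsion_point:
  assumes c: "(c::'a::field_30)^2 = - 1" and s: "(s::'a)^2 = 30"
  obtains W1 where "ec_of W1 = Aff c ((1 - c) / s)" "ec_of (one_plus c W1) = Aff 1 0"
    "one_plus c (one_plus c W1) = T0"
proof -
  have cc: "c * c = - 1" using c by (simp add: power2_eq_square)
  have s0: "s \<noteq> 0" using s thirty_nz[where 'a='a] by auto
  have "30 * ((1 - c) / s)^2 = (1 - c)^2" using s0 unfolding s[symmetric] by (simp add: power_divide)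
  also have "\<dots> = c^3 - c" using c by Groebner_Basis.algebra
  finally have "on_curve 30 (Aff c ((1 - c) / s))" by simp
  then have W: "ec_of (Pt (Aff c ((1 - c) / s))) = Aff c ((1 - c) / s)" by (rule ec_of_Pt)
  define W1 where "W1 = Pt (Aff c ((1 - c) / s))"
  have "kum (ec_of (one_plus c W1)) (c^2 - 1) (2 * c * c)" using kum_one_plus[OF c W] by (simp add: W1_def)
  moreover have "c^2 - 1 = - 2" "2 * c * c = - 2" using c cc by (simp_all add: mult.assoc)
  ultimately obtain x y where xy: "ec_of (one_plus c W1) = Aff x y" "- 2 = x * (- 2)"
    using two_nz_30[where 'a='a] by (cases "ec_of (one_plus c W1)") auto
  then have x: "x = 1" using two_nz_30[where 'a='a] by simp
  then have y: "y = 0" using ec_of_zero_y(1)[OF xy(1)] by simp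
  have "kum (ec_of (one_plus c (one_plus c W1))) (1^2 - 1) (2 * c * 1)"
    using kum_one_plus[OF c xy(1)] x by simp
  then obtain u v where uv: "ec_of (one_plus c (one_plus c W1)) = Aff u v" "0 = u * (2 * c)" "2 * c \<noteq> 0"
    by (cases "ec_of (one_plus c (one_plus c W1))") auto
  then have "u = 0" by auto
  then have "v = 0" using ec_of_zero_y(1)[OF uv(1)] by simp
  then have "one_plus c (one_plus c W1) = T0" using uv(1) \<open>u = 0\<close> by (metis pt_eq ec_of_T0)
  then show ?thesis using that W xy x y unfolding W1_def by blast
qed

text \<open>Besides 0, the 2-torsion consists of the images of \<open>W1\<close> under \<theta> and
  \<theta>\<open>^2\<close>, namely \<open>(1,0)\<close> and \<open>(0,0)\<close>, and of
  \<open>(-1,0)\<close>, which is \<open>i\<close> applied to the first of them.\<close>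

lemma two_torsion_in_range:
  assumes c: "(c::'a::field_30)^2 = - 1" and s: "(s::'a)^2 = 30" and W: "W + W = 0"
  shows "W \<in> range (one_plus c)"
proof -
  interpret gauss_module "rot c" "one_plus c" T0 by (rule gauss_module_pt[OF c])
  obtain W1 where W1: "ec_of W1 = Aff c ((1 - c) / s)" "ec_of (one_plus c W1) = Aff 1 0"
    "one_plus c (one_plus c W1) = T0" by (rule one_plus_cubed_torsion_point[OF c s])
  show ?thesis
  proof (cases "ec_of W")
    case Inf
    then have "W = 0" by (metis pt_eq zero_pt.rep_eq)
    then have "W = one_plus c 0" by (simp add: ker_th)
    then show ?thesis by blast
  next
    case (Aff x y)
    have "ec_add 30 (Aff x y) (Aff x y) = Inf" using arg_cong[OF W, of ec_of] by (simp add: plus_pt.rep_eq Aff zero_pt.rep_eq)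
    then have "y + y = 0" by (auto simp: Let_def split: if_splits)
    then have "y = 0" using two_nz_30[where 'a='a] by (metis mult_2 mult_eq_0_iff)
    then consider "x = 0" | "x = 1" | "x = - 1" using ec_of_zero_y(2)[OF Aff] by auto
    then show ?thesis
    proof cases
      case 1
      then have "W = T0" using Aff \<open>y = 0\<close> by (metis pt_eq ec_of_T0)
      then show ?thesis using W1(3) by (metis rangeI)
    next
      case 2
      then have "W = one_plus c W1" using Aff \<open>y = 0\<close> W1(2) by (metis pt_eq)
      then show ?thesis by blast
    next
      case 3
      have "ec_of (rot c (one_plus c W1)) = Aff (- 1) 0" by (simp add: ec_of_rot[OF c] W1(2))
      then have "W = rot c (one_plus c W1)" using Aff 3 \<open>y = 0\<close> by (metis pt_eq)
      then have "W = one_plus c (rot c W1)" by (simp add: th_i)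
      then show ?thesis by blast
    qed
  qed
qed

lemma eight_dvd_card:
  assumes c: "(c::'a::field_30)^2 = - 1" and s: "(s::'a)^2 = 30"
  shows "8 dvd CARD('a pt)"
proof -
  interpret gauss_module "rot c" "one_plus c" T0 by (rule gauss_module_pt[OF c])
  obtain W1 where "one_plus c (one_plus c W1) = T0" using one_plus_cubed_torsion_point[OF c s] by metis
  then have "(one_plus c ^^ 2) W1 = T0" by (simp add: numeral_2_eq_2)
  then have "card (ker (Suc 2)) = 2 ^ Suc 2" by (rule card_ker)
  then show ?thesis using card_ker_dvd[of "Suc 2"] by simp
qed

section \<open>The group for prime \<open>q = m^2 + 1\<close>\<close>

lemma frobenius_pm:
  assumes q: "CARD('a::field_30) = m^2 + 1" and m: "even m" and q0: "of_nat CARD('a) = (0::'a)"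
    and char: "\<And>j. 0 < j \<Longrightarrow> j < CARD('a) \<Longrightarrow> of_nat j \<noteq> (0::'a)" and frob: "\<And>t::'a. t^CARD('a) = t"
  shows "P + smul m (rot (of_nat m) P) = P \<or> P + smul m (rot (of_nat m) P) = - (P::'a pt)"
proof (cases "ec_of P")
  case Inf
  then have "P = 0" by (metis pt_eq zero_pt.rep_eq)
  have "(of_nat m :: 'a)^2 + 1 = 0" using q0 unfolding q by (simp add: add.commute)
  then have d: "(of_nat m :: 'a)^2 = - 1" by (simp add: eq_neg_iff_add_eq_0)
  have "rot (of_nat m) P = 0"
    by (rule pt_eq) (simp add: ec_of_rot[OF d] Inf zero_pt.rep_eq)
  then show ?thesis using \<open>P = 0\<close> by simp
next
  case (Aff x y)
  let ?d = "of_nat m :: 'a"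
  have "?d^2 + 1 = 0" using q0 unfolding q by (simp add: add.commute)
  then have d: "?d^2 = - 1" by (simp add: eq_neg_iff_add_eq_0)
  define r where "r n = ec_of (P + smul n (rot ?d P))" for n
  have r0: "r 0 = Aff x y" by (simp add: r_def Aff)
  have rs: "r (Suc n) = ec_add 30 (r n) (Aff (- x) (?d * y))" for n
  proof -
    have "r (Suc n) = ec_of ((P + smul n (rot ?d P)) + rot ?d P)" by (simp add: r_def algebra_simps)
    then show ?thesis unfolding plus_pt.rep_eq[of _ "rot ?d P"] by (simp add: r_def ec_of_rot[OF d] Aff)
  qed
  have oc: "on_curve 30 (Aff x y)" using on_curve_ec_of[of P] Aff by simp
  \<comment> \<open>Frobenius fixes every abscissa in the field; the Kummer coordinate leaves only
    the sign of the ordinate open.\<close>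
  have "kum (r m) x 1"
    by (rule frobenius_kummer[OF two_nz_30 q m refl q0 char frob E30.ec_field_axioms oc r0 rs])
  then obtain z where z: "r m = Aff x z" by (cases "r m") auto
  have "on_curve 30 (r m)" unfolding r_def by simp
  then have "30 * z^2 = x^3 - x" using z by simp
  then have "30 * z^2 = 30 * y^2" using oc by simp
  then have "z^2 = y^2" using thirty_nz by (metis mult_left_cancel)
  then have "z = y \<or> z = - y" by (simp add: power2_eq_iff)
  then have "ec_of (P + smul m (rot ?d P)) = ec_of P \<or> ec_of (P + smul m (rot ?d P)) = ec_of (- P)"
    using z by (auto simp: r_def Aff uminus_pt.rep_eq)
  then show ?thesis using pt_eq by blast
qed

text \<open>Jacobsthal's identity, with 6 as the nonresidue, writes \<open>q\<close> as
  \<open>a^2 + b^2\<close> with \<open>2 * a = S\<close>. Uniqueness leaves 1 and \<open>m\<close>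
  for the size of \<open>a\<close>, and divisibility of the count \<open>q + 1 + 2 * a\<close> by 8
  decides.\<close>

lemma card_pt_eq:
  fixes m :: nat
  assumes q: "CARD('a::field_30) = m^2 + 1" "prime CARD('a)" and m: "4 dvd m" and c: "(c::'a)^2 = - 1"
    and s: "(s::'a)^2 = 30" and six: "\<not> (\<exists>s::'a. s^2 = 6)"
  shows "CARD('a pt) = m^2"
proof -
  let ?q = "int CARD('a)"
  define S where "S = jacobsthal (1::'a)"
  define R where "R = jacobsthal (6::'a)"
  have "(6::'a) \<noteq> 0"
  proof
    assume "(6::'a) = 0"
    then have "(6::'a) * 5 = 0" by (simp only: mult_zero_left)
    then show False using thirty_nz[where 'a='a] by simp
  qed
  then have "qchar (6::'a) = - 1" using six by (simp add: qchar_def)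
  moreover have "qchar (- 1 :: 'a) = 1" using c qchar_eq_1_iff by (metis neg_equal_0_iff_equal zero_neq_one)
  ultimately have SR: "S^2 + R^2 = 4 * ?q"
    unfolding S_def R_def using jacobsthal_identity[OF two_nz_30] by blast
  have "s \<noteq> 0" using s thirty_nz[where 'a='a] by auto
  then have "qchar (30::'a) = 1" using qchar_square[of s] s by simp
  then have card: "int CARD('a pt) = ?q + 1 + S"
    using card_curve[OF two_nz_30 thirty_nz[where 'a='a]] by (simp add: card_pt S_def)
  have ev: "even S \<and> even R"
  proof -
    have "even S \<longleftrightarrow> even R"
      using SR by (metis even_add even_mult_iff even_numeral even_power zero_less_numeral dvd_mult2 num.distinct(1) even_numeral)
    moreover have False if "odd S" "odd R"
    proof -
      obtain a b where "S = 2 * a + 1" "R = 2 * b + 1" using \<open>odd S\<close> \<open>odd R\<close> by (elim oddE)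
      then have "4 * (a * a + a + b * b + b) + 2 = 4 * ?q" using SR by (simp add: power2_eq_square algebra_simps)
      then show False by presburger
    qed
    ultimately show ?thesis by blast
  qed
  obtain a b where ab: "S = 2 * a" "R = 2 * b" using ev by (auto elim!: evenE)
  have "a^2 + b^2 = ?q" using SR unfolding ab by (simp add: power_mult_distrib)
  moreover have "prime ?q" using q(2) by simp
  moreover have "?q = (int m)^2 + 1" using q(1) by simp
  ultimately have a: "\<bar>a\<bar> = 1 \<or> \<bar>a\<bar> = \<bar>int m\<bar>" by (rule sum_two_squares_unique[rotated 2])
  obtain k where k: "m = 4 * k" using m by blast
  have "8 dvd ?q + 1 + S" using eight_dvd_card[OF c s] card by (metis int_dvd_int_iff of_nat_numeral)
  then have "8 dvd 2 + 16 * (int k)^2 + 2 * a" using q(1) k ab by (simp add: power_mult_distrib)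
  \<comment> \<open>So \<open>a\<close> is 3 modulo 4: this excludes \<open>a = 1\<close> and, as 4
    divides \<open>m\<close>, both signs of \<open>m\<close>.\<close>
  then have d8: "4 dvd 8 * (int k)^2 + 1 + a" by presburger
  have "a = - 1"
    using a
  proof
    assume "\<bar>a\<bar> = 1"
    then show ?thesis using d8 by presburger
  next
    assume "\<bar>a\<bar> = \<bar>int m\<bar>"
    then have "4 dvd a" using k by (metis abs_dvd_iff dvd_abs_iff dvd_triv_left of_nat_mult of_nat_numeral)
    then show ?thesis using d8 by presburger
  qed
  then have "int CARD('a pt) = int (m^2)" using card q(1) ab by simp
  then show ?thesis by simp
qed

text \<open>Two square roots of \<open>- 1\<close> occur. The Frobenius argument needs the root
  \<open>m\<close> itself, while \<open>c\<close> may be either root; annihilation by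
  \<open>m\<close> does not mention the root and so passes from one module structure to the
  other.\<close>

theorem one_plus_funpow_P0:
  fixes p n :: nat and c :: "'a::field_30"
  assumes q: "CARD('a) = (p * 4^n)^2 + 1" "prime CARD('a)" and p: "odd p" and n: "n > 0"
    and q0: "of_nat CARD('a) = (0::'a)"
    and char: "\<And>j. 0 < j \<Longrightarrow> j < CARD('a) \<Longrightarrow> of_nat j \<noteq> (0::'a)" and frob: "\<And>t::'a. t^CARD('a) = t"
    and c: "c^2 = - 1" and s: "(s::'a)^2 = 30" and six: "\<not> (\<exists>s::'a. s^2 = 6)"
  shows "(one_plus c ^^ (4 * n - 1)) (smul p P0) = T0"
proof -
  define m where "m = p * 4^n"
  have q': "CARD('a) = m^2 + 1" using q(1) by (simp add: m_def)
  obtain n' where n': "n = Suc n'" using n gr0_conv_Suc by auto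
  have m4: "m = 4 * (p * 4^n')" by (simp add: m_def n')
  then have "even m" "4 dvd m" by auto
  define k where "k = p * 4^n'"
  let ?d = "of_nat m :: 'a"
  have "?d^2 + 1 = 0" using q0 unfolding q' by (simp add: add.commute)
  then have d: "?d^2 = - 1" by (simp add: eq_neg_iff_add_eq_0)
  interpret d: gauss_module "rot ?d" "one_plus ?d" "T0 :: 'a pt" by (rule gauss_module_pt[OF d])
  interpret c: gauss_module "rot c" "one_plus c" "T0 :: 'a pt" by (rule gauss_module_pt[OF c])
  have out: "smul m P = 0" if "P \<notin> range (one_plus ?d)" for P
  proof -
    have "P + smul m (rot ?d P) = P \<or> P + smul m (rot ?d P) = - P"
      using frobenius_pm[OF q' \<open>even m\<close> q0 char frob] by blast
    then show ?thesis
    proof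
      assume "P + smul m (rot ?d P) = P"
      then have "rot ?d (smul m P) = 0" by (simp add: smul_additive[OF d.additive_i])
      then show ?thesis by (simp add: d.i_zero)
    next
      \<comment> \<open>Here \<open>2 P + m i P = 0\<close>. With \<open>m = 4 k\<close> and
        \<open>Z = k i P\<close>, the point \<open>P + 2 Z\<close> is 2-torsion; it and
        \<open>2 Z\<close> lie in the range, hence so does \<open>P\<close>.\<close>
      assume e: "P + smul m (rot ?d P) = - P"
      define Z where "Z = smul k (rot ?d P)"
      have mk: "m = k + k + (k + k)" using m4 by (simp add: k_def)
      have "smul (k + k + (k + k)) (rot ?d P) = Z + Z + (Z + Z)" by (simp add: smul_add_left Z_def)
      then have "smul m (rot ?d P) = Z + Z + (Z + Z)" unfolding mk[symmetric] .
      then have "(P + (Z + Z)) + (P + (Z + Z)) = 0" using e by (simp add: algebra_simps)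
      then have "P + (Z + Z) \<in> range (one_plus ?d)" by (rule two_torsion_in_range[OF d s])
      moreover have "Z + Z \<in> range (one_plus ?d)" by (rule one_plus_twice[OF d])
      ultimately obtain u v where "P + (Z + Z) = one_plus ?d u" "Z + Z = one_plus ?d v" by auto
      then have "P = one_plus ?d (u - v)" by (simp add: additive.diff[OF d.additive_th] eq_diff_eq)
      then show ?thesis using that by blast
    qed
  qed
  have "P0 \<notin> range (one_plus ?d)" by (rule P0_notin_range[OF d six])
  \<comment> \<open>A point \<open>P\<close> of the range is the difference of \<open>P0 + P\<close>
    and \<open>P0\<close>, both outside it.\<close>
  have ann: "smul m P = 0" for P :: "'a pt"
  proof (cases "P \<in> range (one_plus ?d)")
    case True
    then obtain u where u: "P = one_plus ?d u" by auto
    have "P0 + P \<notin> range (one_plus ?d)"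
    proof
      assume "P0 + P \<in> range (one_plus ?d)"
      then obtain v where "P0 + P = one_plus ?d v" by auto
      then have "P0 = one_plus ?d (v - u)" using u by (simp add: additive.diff[OF d.additive_th] algebra_simps)
      then show False using \<open>P0 \<notin> range (one_plus ?d)\<close> by blast
    qed
    then have "smul m (P0 + P) = 0" "smul m P0 = (0 :: 'a pt)" using out \<open>P0 \<notin> range (one_plus ?d)\<close> by blast+
    then show ?thesis by (simp add: smul_add)
  qed (rule out)
  have "CARD('a pt) = p^2 * 16^n"
  proof -
    have "(16::nat)^n = (4^n)^2" by (rule sixteen_power)
    then show ?thesis using card_pt_eq[OF q' q(2) \<open>4 dvd m\<close> c s six] by (simp add: m_def power_mult_distrib)
  qed
  then show ?thesis
    by (rule c.th_funpow_eq_T) (use p n ann P0_notin_range[OF c six] in \<open>auto simp: m_def intro: Nat.gr0I\<close>)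
qed

subsection \<open>Computation modulo \<open>N\<close>\<close>

lemma of_int_cong_zero:
  assumes "of_int N = (0::'a::ring_1)" "[a = b] (mod N)"
  shows "(of_int a :: 'a) = of_int b"
proof -
  obtain k where "a - b = N * k" using assms(2) by (auto simp: cong_iff_dvd_diff)
  then have "(of_int a :: 'a) - of_int b = of_int N * of_int k" by (metis of_int_diff of_int_mult)
  then show ?thesis using assms(1) by simp
qed

lemma of_int_mod:
  assumes "of_int N = (0::'a::ring_1)"
  shows "(of_int (a mod N) :: 'a) = of_int a"
  by (rule of_int_cong_zero[OF assms]) simp

lemma inv_mod_Some:
  assumes "inv_mod N d = Some e" "N > 0" "of_int N = (0::'a::ring_1)"
  shows "of_int d * of_int e = (1::'a)"
proof -
  have c: "coprime d N" and e: "e = (SOME e. e \<in> {0..<N} \<and> [d * e = 1] (mod N))"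
    using assms(1) by (auto simp: inv_mod_def split: if_splits)
  obtain x where "[d * x = 1] (mod N)" using cong_solve_coprime_int[OF c] by blast
  then have "[d * (x mod N) = 1] (mod N)" by (simp add: cong_def mod_mult_right_eq)
  then have "\<exists>e. e \<in> {0..<N} \<and> [d * e = 1] (mod N)" using assms(2) by (intro exI[of _ "x mod N"]) simp
  then have "[d * e = 1] (mod N)" unfolding e by (rule someI2_ex) simp
  then have "(of_int (d * e) :: 'a) = of_int 1" by (rule of_int_cong_zero[OF assms(3)])
  then show ?thesis by simp
qed

fun ec_map :: "int ecpt \<Rightarrow> 'a::field ecpt" where
  "ec_map Inf = Inf"
| "ec_map (Aff u v) = Aff (of_int u) (of_int v)"

lemma eq_divide_of_inverse:
  fixes d e z :: "'a::field"
  assumes "d * e = 1"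
  shows "z * e = z / d" "d \<noteq> 0"
proof -
  show "d \<noteq> 0" using assms by auto
  then show "z * e = z / d" using assms by (simp add: nonzero_eq_divide_eq mult_ac)
qed

text \<open>Holds in every field where \<open>N\<close> vanishes, so at each prime factor of a
  composite \<open>N\<close>: an inverse modulo \<open>N\<close> is an inverse there too.\<close>

lemma ecN_add_map:
  assumes "ecN_add N 30 P Q = Some R" "N > 0" and z: "of_int N = (0::'a::field_30)"
  shows "ec_map R = ec_add (30::'a) (ec_map P) (ec_map Q)"
proof (cases "P = Inf \<or> Q = Inf")
  case True
  then show ?thesis using assms(1) by (cases P; cases Q) auto
next
  case False
  then obtain x1 y1 x2 y2 where PQ: "P = Aff x1 y1" "Q = Aff x2 y2" by (cases P; cases Q) auto
  note m = of_int_mod[OF z] and cz = of_int_cong_zero[OF z]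
  show ?thesis
  proof (cases "inv_mod N (x2 - x1)")
    case (Some e)
    have i: "(of_int (x2 - x1) :: 'a) * of_int e = 1" by (rule inv_mod_Some[OF Some assms(2) z])
    have "(of_int x1 :: 'a) \<noteq> of_int x2" using eq_divide_of_inverse(2)[OF i] by auto
    then show ?thesis using assms(1) Some eq_divide_of_inverse(1)[OF i]
      by (auto simp: PQ Let_def m)
  next
    case None
    show ?thesis
    proof (cases "[x1 = x2] (mod N) \<and> [y1 + y2 = 0] (mod N)")
      case True
      then have "(of_int x1 :: 'a) = of_int x2" "(of_int y1 :: 'a) + of_int y2 = 0"
        using cz[of x1 x2] cz[of "y1 + y2" 0] by auto
      then show ?thesis using assms(1) None True by (auto simp: PQ)
    next
      case False
      then have xy: "[x1 = x2] (mod N) \<and> [y1 = y2] (mod N)"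
        using assms(1) None by (auto simp: PQ split: if_splits)
      then obtain e where e: "inv_mod N (2 * 30 * y1) = Some e"
        using assms(1) None False by (auto simp: PQ split: option.splits)
      have xy': "(of_int x1 :: 'a) = of_int x2" "(of_int y1 :: 'a) = of_int y2" using xy cz by blast+
      have i: "(of_int (2 * 30 * y1) :: 'a) * of_int e = 1" by (rule inv_mod_Some[OF e assms(2) z])
      have "(of_int y1 :: 'a) \<noteq> 0" using eq_divide_of_inverse(2)[OF i] by auto
      then have "(of_int y1 :: 'a) + of_int y1 \<noteq> 0" using two_nz_30[where 'a='a] by (metis mult_2 mult_eq_0_iff)
      then have A: "ec_add (30::'a) (ec_map P) (ec_map Q) =
         (let l = (3 * (of_int x1)^2 - 1) / (2 * 30 * of_int y1); x3 = 30 * l^2 - 2 * of_int x1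
          in Aff x3 (l * (of_int x1 - x3) - of_int y1))"
        unfolding PQ ec_map.simps xy'[symmetric] by simp
      have R: "R = (let l = (3 * x1^2 - 1) * e; x3 = (30 * l^2 - 2 * x1) mod N
                   in Aff x3 ((l * (x1 - x3) - y1) mod N))"
        using assms(1) None False xy e by (simp add: PQ Let_def)
      show ?thesis unfolding A R Let_def ec_map.simps m of_int_diff of_int_mult of_int_power of_int_numeral of_int_1
        eq_divide_of_inverse(1)[OF i[unfolded of_int_mult of_int_numeral]] ..
    qed
  qed
qed

lemma coprime_of_nonzero:
  assumes "prime N" and z: "\<And>x::int. of_int x = (0::'a::ring_1) \<longleftrightarrow> N dvd x" and "of_int d \<noteq> (0::'a)"
  shows "coprime d N"
  using assms by (metis coprime_commute prime_imp_coprime)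

text \<open>For prime \<open>N\<close> a failed inversion means equality in the field, and two
  points of the curve with equal abscissa are equal or opposite; every branch of
  \<open>ecN_add\<close> then succeeds.\<close>

lemma ecN_add_defined:
  assumes N: "prime N" and z: "\<And>x::int. of_int x = (0::'a::field_30) \<longleftrightarrow> N dvd x"
    and c: "on_curve (30::'a) (ec_map P)" "on_curve (30::'a) (ec_map Q)"
  shows "\<exists>R. ecN_add N 30 P Q = Some R"
proof (cases "P = Inf \<or> Q = Inf")
  case True
  then show ?thesis by (cases P; cases Q) auto
next
  case False
  then obtain x1 y1 x2 y2 where PQ: "P = Aff x1 y1" "Q = Aff x2 y2" by (cases P; cases Q) auto
  have cg: "[a = b] (mod N) \<longleftrightarrow> (of_int a :: 'a) = of_int b" for a b
    using z[of "a - b"] by (simp add: cong_iff_dvd_diff)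
  show ?thesis
  proof (cases "inv_mod N (x2 - x1)")
    case (Some e)
    then show ?thesis by (simp add: PQ Let_def)
  next
    case None
    then have "\<not> coprime (x2 - x1) N" by (auto simp: inv_mod_def split: if_splits)
    then have x: "(of_int x1 :: 'a) = of_int x2" 
      using coprime_of_nonzero[OF N z, of "x2 - x1"] by (metis eq_iff_diff_eq_0 of_int_diff)
    show ?thesis
    proof (cases "(of_int y1 :: 'a) + of_int y2 = 0")
      case True
      then have "[y1 + y2 = 0] (mod N)" by (simp add: cg)
      then show ?thesis using None x by (simp add: PQ cg)
    next
      case n: False
      have "30 * (of_int y1 :: 'a)^2 = 30 * (of_int y2)^2" using c x by (simp add: PQ)
      then have "(of_int y1 :: 'a)^2 = (of_int y2)^2" using thirty_nz[where 'a='a] by (metis mult_left_cancel)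
      then have y: "(of_int y1 :: 'a) = of_int y2" using n by (auto simp: power2_eq_iff)
      then have "(of_int y1 :: 'a) \<noteq> 0" using n by auto
      then have "(2 * 30 * of_int y1 :: 'a) \<noteq> 0"
        using thirty_nz[where 'a='a] two_nz_30[where 'a='a] by (metis mult_eq_0_iff)
      moreover have "of_int (2 * 30 * y1) = (2 * 30 * of_int y1 :: 'a)" by (simp only: of_int_mult of_int_numeral)
      ultimately have "coprime (2 * 30 * y1) N" using coprime_of_nonzero[OF N z] by metis
      then obtain e where "inv_mod N (2 * 30 * y1) = Some e" by (simp add: inv_mod_def)
      moreover have "\<not> [y1 + y2 = 0] (mod N)" using n by (simp add: cg)
      ultimately show ?thesis using None x y by (simp add: PQ cg Let_def)
    qed
  qed
qed

lemma ecN_i_map: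
  assumes "of_int N = (0::'a::field)"
  shows "ec_map (ecN_i N c P) = ec_i (of_int c :: 'a) (ec_map P)"
  by (cases P) (simp_all add: of_int_mod[OF assms])

lemma iter_one_plus_i_0: "iter_one_plus_i N c 0 r = r"
  by (simp add: iter_one_plus_i_def)

lemma iter_one_plus_i_Suc: "iter_one_plus_i N c (Suc k) r = Option.bind (iter_one_plus_i N c k r) (one_plus_i N c)"
  by (simp add: iter_one_plus_i_def)

lemma ec_of_one_plus: "c^2 = - 1 \<Longrightarrow> ec_of (one_plus c P) = ec_add 30 (ec_of P) (ec_i c (ec_of P))"
  by (simp add: one_plus_def plus_pt.rep_eq ec_of_rot)

lemma iter_one_plus_i_map:
  assumes N: "N > 0" and z: "of_int N = (0::'a::field_30)" and c: "(of_int c :: 'a)^2 = - 1"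
    and P: "ec_map P = ec_of (X::'a pt)" and R: "iter_one_plus_i N c k (Some P) = Some R"
  shows "ec_map R = ec_of ((one_plus (of_int c) ^^ k) X)"
  using R
proof (induction k arbitrary: R)
  case 0
  then show ?case using P by (simp add: iter_one_plus_i_0)
next
  case (Suc k)
  then obtain S where S: "iter_one_plus_i N c k (Some P) = Some S" "one_plus_i N c S = Some R"
    by (auto simp: iter_one_plus_i_Suc bind_eq_Some_conv)
  have "ec_map R = ec_add (30::'a) (ec_map S) (ec_map (ecN_i N c S))"
    using S(2) ecN_add_map[OF _ N z] unfolding one_plus_i_def by blast
  then show ?case
    unfolding ecN_i_map[OF z] Suc.IH[OF S(1)] funpow.simps(2) comp_apply ec_of_one_plus[OF c] .
qed

lemma iter_one_plus_i_defined:
  assumes N: "prime N" and z: "\<And>x::int. of_int x = (0::'a::field_30) \<longleftrightarrow> N dvd x"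
    and c: "(of_int c :: 'a)^2 = - 1" and P: "ec_map P = ec_of (X::'a pt)"
  shows "\<exists>R. iter_one_plus_i N c k (Some P) = Some R"
proof (induction k)
  case (Suc k)
  have z': "of_int N = (0::'a)" using z[of N] by simp
  have N0: "N > 0" using N by (simp add: prime_gt_0_int)
  obtain S where S: "iter_one_plus_i N c k (Some P) = Some S" using Suc by blast
  have "ec_map S = ec_of ((one_plus (of_int c) ^^ k) X)" by (rule iter_one_plus_i_map[OF N0 z' c P S])
  then have "on_curve (30::'a) (ec_map S)" by simp
  moreover have "on_curve (30::'a) (ec_map (ecN_i N c S))"
    unfolding ecN_i_map[OF z'] by (rule on_curve_i[OF c calculation])
  ultimately show ?case using ecN_add_defined[OF N z] S by (auto simp: iter_one_plus_i_Suc one_plus_i_def)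
qed (simp add: iter_one_plus_i_0)

text \<open>\<open>congr_cond\<close> asks for the integer point \<open>(0,0)\<close>, not only for
  a congruent one; canonical residues bridge the difference.\<close>

lemma one_plus_i_range:
  assumes "one_plus_i N c P = Some (Aff u v)" "N > 0"
  shows "0 \<le> u \<and> u < N \<and> 0 \<le> v \<and> v < N"
  using assms by (cases P) (auto simp: one_plus_i_def Let_def split: option.splits if_splits)

section \<open>Reduction of rational points\<close>

lemma rat_curve_int:
  fixes x y :: rat
  assumes "30 * y^2 = x^3 - x" "quotient_of x = (a, b)" "quotient_of y = (c, d)"
  shows "30 * c^2 * b^3 = d^2 * (a^3 - a * b^2)"
proof -
  have x: "x = of_int a / of_int b" "b > 0" and y: "y = of_int c / of_int d" "d > 0"
    using assms quotient_of_div quotient_of_denom_pos by blast+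
  have xb: "x * of_int b = of_int a" and yd: "y * of_int d = of_int c" using x y by auto
  have "30 * (y * of_int d)^2 * of_int b ^ 3 = (of_int d)^2 * ((x * of_int b)^3 - (x * of_int b) * (of_int b)^2)"
    using assms(1) by Groebner_Basis.algebra
  then have "(of_int (30 * c^2 * b^3) :: rat) = of_int (d^2 * (a^3 - a * b^2))"
    unfolding xb yd by simp
  then show ?thesis by (simp only: of_int_eq_iff)
qed

lemma red_rat_Some:
  assumes "red_rat N r = Some u" "quotient_of r = (a, b)" "N > 0" and z: "of_int N = (0::'a::field)"
  shows "of_int u * of_int b = (of_int a :: 'a)" "of_int b \<noteq> (0::'a)"
proof -
  obtain e where e: "inv_mod N b = Some e" "u = (a * e) mod N"
    using assms(1,2) by (auto simp: red_rat_def split: option.splits)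
  have "of_int b * of_int e = (1::'a)" by (rule inv_mod_Some[OF e(1) assms(3) z])
  then show "of_int u * of_int b = (of_int a :: 'a)" "of_int b \<noteq> (0::'a)"
    by (auto simp: e(2) of_int_mod[OF z] mult.assoc mult.commute[of "of_int b"])
qed

lemma red_pt_on_curve:
  assumes "red_pt N Q = Some P" "on_curve 30 Q" "N > 0" and z: "of_int N = (0::'a::field)"
  shows "on_curve (30::'a) (ec_map P)"
proof (cases Q)
  case (Aff x y)
  obtain u v where uv: "red_rat N x = Some u" "red_rat N y = Some v" "P = Aff u v"
    using assms(1) Aff by (auto split: option.splits)
  obtain a b where ab: "quotient_of x = (a, b)" by force
  obtain c d where cd: "quotient_of y = (c, d)" by force
  have "30 * c^2 * b^3 = d^2 * (a^3 - a * b^2)"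
    by (rule rat_curve_int[OF _ ab cd]) (use assms(2) Aff in simp)
  then have "(of_int (30 * c^2 * b^3) :: 'a) = of_int (d^2 * (a^3 - a * b^2))" by (rule arg_cong)
  then have e: "30 * (of_int c)^2 * (of_int b)^3 = ((of_int d)^2 * ((of_int a)^3 - of_int a * (of_int b)^2) :: 'a)"
    by (simp only: of_int_mult of_int_power of_int_diff of_int_numeral)
  note ub = red_rat_Some[OF uv(1) ab assms(3) z] and vd = red_rat_Some[OF uv(2) cd assms(3) z]
  have "(of_int b)^3 * (of_int d)^2 * (30 * (of_int v)^2) = (of_int b)^3 * (of_int d)^2 * ((of_int u)^3 - of_int u :: 'a)"
    using e unfolding ub(1)[symmetric] vd(1)[symmetric] by Groebner_Basis.algebra
  then show ?thesis using ub(2) vd(2) uv(3) by simp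
qed (use assms(1) in auto)

interpretation rat30: ec_field "30 :: rat" by unfold_locales auto

lemma on_curve_ec_mul: "on_curve 30 (ec_mul (30::rat) k (Aff 5 2))"
  by (induction k) (auto intro!: rat30.on_curve_add)

text \<open>Computing \<open>p (5,2)\<close> over the rationals and reducing agrees with computing
  in the field, as far as the abscissa shows; it also decides when the denominator vanishes in the
  field.\<close>

lemma E30_Q_kummer:
  assumes ab: "coprime a b" "kum (E30_Q p) (of_int a) (of_int b)"
  shows "kum (ec_of (smul p (P0 :: 'a::field_30 pt))) (of_int a) (of_int b)"
proof -
  interpret fraction_reduction "of_int :: int \<Rightarrow> rat" "of_int :: int \<Rightarrow> 'a"
  proof
    fix z :: rat
    obtain a b where "quotient_of z = (a, b)" by force
    then have "z = of_int a / of_int b" "b > 0" using quotient_of_div quotient_of_denom_pos by blast+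
    then show "\<exists>a b. b \<noteq> 0 \<and> z * of_int b = of_int a" by (intro exI[of _ a] exI[of _ b]) simp
  qed (use two_nz_30 in simp_all)
  let ?P = "Aff 5 2 :: rat ecpt" and ?R = "\<lambda>n. ec_mul 30 n (Aff 5 2 :: rat ecpt)"
  have cP: "on_curve 30 ?P" by simp
  have RS: "?R (Suc n) = ec_add 30 (?R n) ?P" for n
    unfolding ec_mul.simps by (rule rat30.ec_add_commute[OF cP on_curve_ec_mul])
  have RP: "?R n = ec_add 30 (?R (Suc n)) (ec_neg ?P)" for n
    unfolding RS using rat30.ec_add_cancel[OF on_curve_ec_mul cP] by simp
  define r where "r n = ec_of (smul n (P0 :: 'a pt))" for n
  have rc: "on_curve (30::'a) (r n)" for n by (simp add: r_def)
  have cp: "on_curve (30::'a) (Aff 5 2)" by simp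
  have rS: "r (Suc n) = ec_add (30::'a) (r n) (Aff 5 2)" for n
  proof -
    have "r (Suc n) = ec_of (smul n P0 + P0)" by (simp add: r_def add.commute)
    then show ?thesis by (simp add: plus_pt.rep_eq r_def ec_of_P0)
  qed
  have rP: "r n = ec_add (30::'a) (r (Suc n)) (ec_neg (Aff 5 2))" for n
    unfolding rS using E30.ec_add_cancel[OF rc cp] by simp
  have S: "crep ?P 5 1" "kum (Aff 5 2 :: 'a ecpt) (of_int 5) (of_int 1)" by (simp_all add: crep_def)
  have 0: "crep (?R 0) 1 0" "kum (r 0) (of_int 1) (of_int 0)" by (simp_all add: crep_def r_def zero_pt.rep_eq)
  have 1: "crep (?R 1) 5 1" "kum (r 1) (of_int 5) (of_int 1)"
    by (simp_all add: crep_def r_def ec_of_P0)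
  have "crep (?R p) a b" using ab by (simp add: crep_def E30_Q_def)
  then have "kum (r p) (of_int a) (of_int b)"
    by (rule reduction_sequence[where R="?R" and r=r, OF rat30.ec_field_axioms on_curve_ec_mul cP RS RP
        E30.ec_field_axioms rc cp rS rP S 0 1])
  then show ?thesis by (simp add: r_def)
qed

lemma congr_cond_root:
  fixes p n :: nat
  assumes z: "of_int (int (p^2 * 16^n + 1)) = (0::'a::field_30)"
    and c: "c = (- int (p * 4^n)) mod int (p^2 * 16^n + 1)"
  shows "(of_int c :: 'a)^2 = - 1"
proof -
  have e: "(16::int)^n = (4^n)^2" by (rule sixteen_power)
  have e2: "int (p^2 * 16^n + 1) = int (p * 4^n) ^ 2 + 1"
    using e by (simp add: power_mult_distrib)
  have "(of_int (int (p * 4^n) ^ 2 + 1) :: 'a) = 0" using z unfolding e2 .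
  then have "(of_int (int (p * 4^n)) :: 'a)^2 + 1 = 0" by (simp only: of_int_add of_int_power of_int_1)
  then have m: "(of_int (int (p * 4^n)) :: 'a)^2 = - 1" by (simp only: eq_neg_iff_add_eq_0)
  have "(of_int c :: 'a) = - of_int (int (p * 4^n))"
    unfolding c of_int_mod[OF z] by (rule of_int_minus)
  then show ?thesis by (simp only: power2_minus m)
qed

section \<open>Both implications over a residue field\<close>

theorem congr_cond_bound:
  fixes p n :: nat
  assumes z: "of_nat (p^2 * 16^n + 1) = (0::'a::field_30)" and n: "n > 0" and cc: "congr_cond p n"
  shows "16^n \<le> 2 * CARD('a) + 1"
proof -
  define N where "N = int (p^2 * 16^n + 1)"
  define c where "c = (- int (p * 4^n)) mod N"
  have N0: "N > 0" unfolding N_def of_nat_0_less_iff by simp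
  have z': "of_int N = (0::'a)" unfolding N_def of_int_of_nat_eq by (rule z)
  have c1: "(of_int c :: 'a)^2 = - 1" by (rule congr_cond_root[OF z'[unfolded N_def] c_def[unfolded N_def]])
  have it: "iter_one_plus_i N c (4 * n - 1) (red_pt N (E30_Q p)) = Some (Aff 0 0)"
    using cc unfolding congr_cond_def N_def c_def Let_def .
  have none: "iter_one_plus_i N c k None = None" for k
    by (induction k) (simp_all add: iter_one_plus_i_0 iter_one_plus_i_Suc)
  obtain P where P: "red_pt N (E30_Q p) = Some P" using it none by (cases "red_pt N (E30_Q p)") auto
  have "on_curve (30::'a) (ec_map P)"
    by (rule red_pt_on_curve[OF P _ N0 z']) (unfold E30_Q_def, rule on_curve_ec_mul)
  then have X: "ec_map P = ec_of (Pt (ec_map P) :: 'a pt)" by (simp add: ec_of_Pt)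
  have "ec_of ((one_plus (of_int c) ^^ (4 * n - 1)) (Pt (ec_map P) :: 'a pt)) = ec_map (Aff 0 0)"
    using iter_one_plus_i_map[OF N0 z' c1 X] it unfolding P by metis
  then have "(one_plus (of_int c) ^^ (4 * n - 1)) (Pt (ec_map P) :: 'a pt) = T0"
    by (intro pt_eq) (simp add: ec_of_T0)
  then have "2 ^ Suc (4 * n - 1) \<le> 2 * CARD('a) + 1" by (rule card_bound_of_order[OF c1])
  moreover have "(2::nat) ^ Suc (4 * n - 1) = 16 ^ n" using n by (simp add: power_mult flip: power_Suc)
  ultimately show ?thesis by simp
qed

theorem congr_cond_of_prime:
  fixes p n :: nat
  assumes q: "CARD('a::field_30) = p^2 * 16^n + 1" "prime CARD('a)" and p: "odd p" and n: "n > 0"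
    and z: "\<And>x::int. of_int x = (0::'a) \<longleftrightarrow> int CARD('a) dvd x" and frob: "\<And>t::'a. t^CARD('a) = t"
    and s: "(s::'a)^2 = 30" and six: "\<not> (\<exists>s::'a. s^2 = 6)"
  shows "congr_cond p n"
proof -
  define N where "N = int (p^2 * 16^n + 1)"
  define c where "c = (- int (p * 4^n)) mod N"
  have Nq: "int CARD('a) = N" by (simp add: q(1) N_def)
  have N: "prime N" using q(2) Nq by (metis prime_nat_int_transfer)
  have N0: "N > 0" unfolding N_def of_nat_0_less_iff by simp
  have zN: "\<And>x::int. of_int x = (0::'a) \<longleftrightarrow> N dvd x" using z unfolding Nq .
  have z': "of_int N = (0::'a)" using zN[of N] by simp
  have c1: "(of_int c :: 'a)^2 = - 1" by (rule congr_cond_root[OF z'[unfolded N_def] c_def[unfolded N_def]])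
  have e: "(16::nat)^n = (4^n)^2" by (rule sixteen_power)
  have q': "CARD('a) = (p * 4^n)^2 + 1" unfolding q(1) e by (simp add: power_mult_distrib)
  have q0: "of_nat CARD('a) = (0::'a)" using z[of "int CARD('a)"] by simp
  have char: "of_nat j \<noteq> (0::'a)" if "0 < j" "j < CARD('a)" for j
    using z[of "int j"] that by (auto dest: nat_dvd_not_less)
  have T: "(one_plus (of_int c) ^^ (4 * n - 1)) (smul p (P0 :: 'a pt)) = T0"
    by (rule one_plus_funpow_P0[OF q' q(2) p n q0 char frob c1 s six])
  interpret g: gauss_module "rot (of_int c)" "one_plus (of_int c)" "T0 :: 'a pt" by (rule gauss_module_pt[OF c1])
  note add = additive_funpow[OF g.additive_th, of "4 * n - 1"]
  define X where "X = smul p (P0 :: 'a pt)"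
  \<comment> \<open>The result \<open>T0\<close> is nonzero, so the starting point is too; hence the
    denominator of its rational abscissa is prime to \<open>N\<close>.\<close>
  have nI: "ec_of X \<noteq> Inf"
  proof
    assume "ec_of X = Inf"
    then have "X = 0" by (metis pt_eq zero_pt.rep_eq)
    then show False using T g.T_nz additive.zero[OF add] by (simp add: X_def)
  qed
  have cq: "on_curve 30 (E30_Q p)" unfolding E30_Q_def by (rule on_curve_ec_mul)
  obtain x y where xy: "E30_Q p = Aff x y"
    using nI E30_Q_kummer[of 1 0 p, where 'a='a] by (cases "E30_Q p"; cases "ec_of X") (auto simp: X_def)
  obtain a b where ab: "quotient_of x = (a, b)" by force
  obtain r d where rd: "quotient_of y = (r, d)" by force
  have cop: "coprime a b" "coprime r d" using ab rd quotient_of_coprime by blast+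
  have pos: "b > 0" "d > 0" using ab rd quotient_of_denom_pos by blast+
  have "x = of_int a / of_int b" using ab quotient_of_div by blast
  then have "kum (E30_Q p) (of_int a) (of_int b)" using pos xy by simp
  then have kX: "kum (ec_of X) (of_int a) (of_int b)" unfolding X_def by (rule E30_Q_kummer[OF cop(1)])
  then have b0: "(of_int b :: 'a) \<noteq> 0" using nI by (cases "ec_of X") auto
  \<comment> \<open>If \<open>N\<close> divided the denominator of \<open>y\<close>, the curve
    equation over the integers would force it to divide that of \<open>x\<close>.\<close>
  have d0: "(of_int d :: 'a) \<noteq> 0"
  proof
    assume "(of_int d :: 'a) = 0"
    then have "N dvd d" using zN[of d] by simp
    then have nr: "\<not> N dvd r" using cop(2) N by (metis coprime_common_divisor not_prime_unit)
    have "30 * r^2 * b^3 = d^2 * (a^3 - a * b^2)"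
      by (rule rat_curve_int[OF _ ab rd]) (use cq xy in simp)
    then have "N dvd 30 * r^2 * b^3" using \<open>N dvd d\<close> by (simp add: power2_eq_square)
    moreover have "\<not> N dvd 30" using zN[of 30] thirty_nz[where 'a='a] by simp
    moreover have "\<not> N dvd b" using zN[of b] b0 by simp
    ultimately show False using nr N by (auto simp: prime_dvd_mult_iff prime_dvd_power_iff)
  qed
  have "coprime b N" "coprime d N"
    by (rule coprime_of_nonzero[OF N zN], rule b0, rule coprime_of_nonzero[OF N zN], rule d0)
  then obtain u v where uv: "red_rat N x = Some u" "red_rat N y = Some v"
    by (simp add: red_rat_def ab rd inv_mod_def)
  then have P: "red_pt N (E30_Q p) = Some (Aff u v)" by (simp add: xy)
  note ub = red_rat_Some[OF uv(1) ab N0 z']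
  have cuv: "on_curve (30::'a) (ec_map (Aff u v))" by (rule red_pt_on_curve[OF P cq N0 z'])
  \<comment> \<open>The coordinatewise reduction \<open>Y\<close> shares its abscissa with
    \<open>X\<close>, so \<open>Y\<close> is \<open>X\<close> or \<open>- X\<close>; both are sent
    to \<open>T0\<close>, which is its own negative.\<close>
  define Y where "Y = (Pt (ec_map (Aff u v)) :: 'a pt)"
  have Y: "ec_map (Aff u v) = ec_of Y" unfolding Y_def ec_of_Pt[OF cuv] ..
  obtain x' y' where X': "ec_of X = Aff x' y'" using nI by (cases "ec_of X") auto
  have "x' = of_int u" using kX ub b0 unfolding X' by simp
  moreover have "30 * y'^2 = x'^3 - x'" using on_curve_ec_of[of X] unfolding X' on_curve.simps .
  ultimately have "30 * y'^2 = 30 * (of_int v)^2" using cuv by simp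
  then have "y'^2 = (of_int v)^2" using thirty_nz[where 'a='a] by (metis mult_left_cancel)
  then have "y' = of_int v \<or> y' = - of_int v" by (simp add: power2_eq_iff)
  then have "ec_of Y = ec_of X \<or> ec_of Y = ec_of (- X)"
    unfolding Y[symmetric] by (auto simp: X' uminus_pt.rep_eq \<open>x' = of_int u\<close>)
  then have "Y = X \<or> Y = - X" using pt_eq by blast
  moreover have "- T0 = (T0 :: 'a pt)" by (rule pt_eq) (simp add: uminus_pt.rep_eq ec_of_T0)
  ultimately have TY: "(one_plus (of_int c) ^^ (4 * n - 1)) Y = T0"
    using T additive.minus[OF add] by (auto simp: X_def)
  obtain R where R: "iter_one_plus_i N c (4 * n - 1) (Some (Aff u v)) = Some R"
    using iter_one_plus_i_defined[OF N zN c1 Y] by blast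
  have mR: "ec_map R = Aff (0::'a) 0"
    using iter_one_plus_i_map[OF N0 z' c1 Y R] unfolding TY ec_of_T0 .
  then obtain f g where fg: "R = Aff f g" by (cases R) auto
  \<comment> \<open>At least one step is performed, and the last one delivers canonical
    residues.\<close>
  obtain k where k: "4 * n - 1 = Suc k" using n by (cases "4 * n - 1") auto
  obtain S where "one_plus_i N c S = Some (Aff f g)"
    using R unfolding k fg iter_one_plus_i_Suc by (auto simp: bind_eq_Some_conv)
  then have rng: "0 \<le> f" "f < N" "0 \<le> g" "g < N" using one_plus_i_range N0 by blast+
  have "N dvd f" "N dvd g" using mR fg zN by auto
  then have "f = 0" "g = 0" using rng by (metis dvd_eq_mod_eq_0 mod_pos_pos_trivial)+
  then show ?thesis using R P fg unfolding congr_cond_def N_def c_def Let_def by simp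
qed

subsection \<open>Residues of \<open>p^2 16^n + 1\<close>\<close>

text \<open>The last digit of \<open>p\<close> gives \<open>p^2 = 1\<close> modulo 5 and excludes
  \<open>p = 3\<close>, so \<open>p^2 = 1\<close> modulo 3; \<open>16^n\<close> is 1 for both
  moduli. The value 2 is a nonresidue modulo 3 and modulo 5.\<close>

lemma residues_of_N:
  fixes p n :: nat
  assumes p: "prime p" "p mod 10 = 1 \<or> p mod 10 = 9" and n: "n > 0"
  shows "(p^2 * 16^n + 1) mod 3 = 2" "(p^2 * 16^n + 1) mod 5 = 2" "(p^2 * 16^n + 1) mod 16 = 1"
proof -
  have "p \<noteq> 3" using p(2) by auto
  moreover have "prime (3::nat)" by simp
  ultimately have "\<not> 3 dvd p" using p(1) primes_dvd_imp_eq[of 3 p] by blast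
  then have "p mod 3 = 1 \<or> p mod 3 = 2" by presburger
  then have p3: "p^2 mod 3 = 1" by (auto simp: power_mod[symmetric, of p 2 3])
  have "p mod 5 = 1 \<or> p mod 5 = 4" using p(2) by presburger
  then have p5: "p^2 mod 5 = 1" by (auto simp: power_mod[symmetric, of p 2 5])
  have s3: "(16::nat)^n mod 3 = 1" using power_mod[of "16::nat" 3 n] by simp
  have s5: "(16::nat)^n mod 5 = 1" using power_mod[of "16::nat" 5 n] by simp
  have "p^2 * 16^n mod 3 = 1" using mod_mult_eq[of "p^2" 3 "16^n"] p3 s3 by simp
  moreover have "(x + 1) mod 3 = 2" if "x mod 3 = 1" for x :: nat using that by presburger
  ultimately show "(p^2 * 16^n + 1) mod 3 = 2" by blast
  have "p^2 * 16^n mod 5 = 1" using mod_mult_eq[of "p^2" 5 "16^n"] p5 s5 by simp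
  moreover have "(x + 1) mod 5 = 2" if "x mod 5 = 1" for x :: nat using that by presburger
  ultimately show "(p^2 * 16^n + 1) mod 5 = 2" by blast
  obtain k where "n = Suc k" using n gr0_conv_Suc by auto
  then have "16 dvd p^2 * 16^n" by simp
  moreover have "(x + 1) mod 16 = 1" if "16 dvd x" for x :: nat using that by presburger
  ultimately show "(p^2 * 16^n + 1) mod 16 = 1" by blast
qed

text \<open>Every prime factor then gives a field in which 30 is invertible.\<close>

lemma prime_factor_gt_5:
  fixes N q :: nat
  assumes "N mod 3 = 2" "N mod 5 = 2" "N mod 16 = 1" "prime q" "q dvd N"
  shows "5 < q"
proof -
  have "\<not> 3 dvd N" "\<not> 5 dvd N" using assms(1,2) by (simp_all add: dvd_eq_mod_eq_0)
  moreover have "\<not> 2 dvd N" using assms(3) by presburger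
  ultimately have n: "\<not> 2 dvd N" "\<not> 3 dvd N" "\<not> 5 dvd N" by blast+
  have "q \<noteq> 2" "q \<noteq> 3" "q \<noteq> 5" using n assms(5) by metis+
  moreover have "q \<noteq> 0" "q \<noteq> 1" "q \<noteq> 4" using assms(4) by auto
  ultimately show ?thesis by linarith
qed

lemma odd_p: "p mod 10 = 1 \<or> p mod 10 = 9 \<Longrightarrow> odd (p::nat)" by presburger

context
  fixes q m :: nat
  assumes q: "prime q" "q = m^2 + 1" and q3: "q mod 3 = 2" and q5: "q mod 5 = 2" and q16: "q mod 16 = 1"
begin

lemma q_gt_5: "5 < q"
  by (rule prime_factor_gt_5[OF q3 q5 q16 q(1)]) simp

lemma Legendre_value:
  assumes "[a ^ ((q - 1) div 2) = e] (mod int q)" "e = 1 \<or> e = - 1"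
  shows "Legendre a (int q) = e"
proof -
  have "[Legendre a (int q) = a ^ ((q - 1) div 2)] (mod int q)"
    using euler_criterion[OF q(1)] q_gt_5 by simp
  then have "[Legendre a (int q) = e] (mod int q)" using assms(1) cong_trans by blast
  then have d: "int q dvd Legendre a (int q) - e" by (simp add: cong_iff_dvd_diff)
  have "\<bar>Legendre a (int q) - e\<bar> \<le> 2" using assms(2) by (auto simp: Legendre_def)
  then have "\<bar>Legendre a (int q) - e\<bar> < int q" using q_gt_5 by linarith
  then show ?thesis using d by (metis abs_dvd_iff dvd_abs_iff eq_iff_diff_eq_0 zdvd_not_zless abs_ge_zero order_le_less abs_eq_0)
qed

lemma power_of_Legendre: "[a ^ ((q - 1) div 2) = Legendre a (int q)] (mod int q)"
  using euler_criterion[OF q(1), of a] q_gt_5 cong_sym by auto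

lemma Legendre_two: "[2 ^ ((q - 1) div 2) = 1] (mod int q)"
proof -
  let ?h = "(q - 1) div 2" and ?m = "int m"
  have qm: "int q = ?m^2 + 1" using q(2) by simp
  obtain k where k: "q = 16 * k + 1" using q16 by (metis div_mult_mod_eq mult.commute)
  then have hk: "?h = 8 * k" and qk: "q - 1 = 16 * k" by auto
  have pw: "(x * y^2) ^ (8 * k) = (x^4) ^ (2 * k) * y ^ (16 * k)" for x y :: int
    by (simp add: power_mult_distrib flip: power_mult)
  \<comment> \<open>Modulo \<open>q\<close>, \<open>(1 + m)^2 = 2 m\<close> and
    \<open>- 2 m^2 = 2\<close>. The exponent is \<open>8 k\<close>, so the factor
    \<open>- m\<close>, of fourth power 1, contributes nothing and the square is removed by Fermat's
    theorem.\<close>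
  have "2 - (- ?m) * (1 + ?m)^2 = int q * (2 + ?m)"
    unfolding qm by (simp add: algebra_simps power2_eq_square)
  then have "[2 = (- ?m) * (1 + ?m)^2] (mod int q)" by (simp add: cong_iff_dvd_diff)
  then have "[2 ^ ?h = ((- ?m) * (1 + ?m)^2) ^ ?h] (mod int q)" by (rule cong_pow)
  also have "((- ?m) * (1 + ?m)^2) ^ ?h = ((- ?m)^4) ^ (2 * k) * (1 + ?m) ^ (q - 1)"
    unfolding hk unfolding qk by (rule pw)
  also have "[\<dots> = 1 ^ (2 * k) * 1] (mod int q)"
  proof (intro cong_mult cong_pow)
    have "(- ?m)^4 - 1 = int q * (?m^2 - 1)" unfolding qm by (simp add: algebra_simps power2_eq_square eval_nat_numeral)
    then show "[(- ?m)^4 = 1] (mod int q)" by (simp add: cong_iff_dvd_diff)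
    have "m \<noteq> 0" using q_gt_5 q(2) by (auto intro: Nat.gr0I)
    moreover have "m \<noteq> 1" using q_gt_5 q(2) by auto
    ultimately have "1 + m < q" unfolding q(2) power2_eq_square
      by (metis One_nat_def add.commute add_less_cancel_left le_neq_implies_less less_one linorder_not_le mult.right_neutral mult_less_cancel1 neq0_conv)
    then have "\<not> q dvd 1 + m" by (auto dest: dvd_imp_le)
    then have "[(1 + m) ^ (q - 1) = 1] (mod q)" by (rule fermat_theorem[OF q(1)])
    then have "[int ((1 + m) ^ (q - 1)) = int 1] (mod int q)" by (simp only: cong_int_iff)
    then show "[(1 + ?m) ^ (q - 1) = 1] (mod int q)" by simp
  qed
  finally show ?thesis by simp
qed

text \<open>Reciprocity has sign \<open>+ 1\<close> because \<open>(q - 1) div 2\<close> is even,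
  and \<open>q\<close> is 2, a nonresidue, modulo 3 and 5.\<close>

lemma Legendre_3_5: "Legendre 3 (int q) = - 1" "Legendre 5 (int q) = - 1"
proof -
  obtain k where k: "q = 16 * k + 1" using q16 by (metis div_mult_mod_eq mult.commute)
  have h: "even ((q - 1) div 2)" using k by simp
  have r: "Legendre (int r) (int q) = - 1" if r: "prime r" "2 < r" "r \<noteq> q" and L: "Legendre (int q) (int r) = - 1" for r
  proof -
    have "Legendre (int r) (int q) * Legendre (int q) (int r) = (- 1) ^ ((r - 1) div 2 * ((q - 1) div 2))"
      by (rule Quadratic_Reciprocity) (use r q q_gt_5 in auto)
    then show ?thesis using L h by simp
  qed
  have nq: "\<not> QuadRes (int r) (int q) \<and> \<not> [int q = 0] (mod int r)" if "r = 3 \<or> r = 5" for r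
  proof -
    have qr: "int q mod int r = 2" using that q3 q5 by (metis of_nat_mod of_nat_numeral)
    have "y^2 mod int r \<noteq> 2" for y :: int
    proof -
      have "y^2 mod int r = (y mod int r)^2 mod int r" by (simp add: power_mod)
      moreover have "0 \<le> y mod int r \<and> y mod int r < int r" using that by auto
      ultimately show ?thesis using that
      proof (elim disjE)
        assume "r = 3"
        then have "y mod int r \<in> {0, 1, 2}" using \<open>0 \<le> y mod int r \<and> y mod int r < int r\<close> by auto
        then show ?thesis using \<open>y^2 mod int r = (y mod int r)^2 mod int r\<close> \<open>r = 3\<close> by auto
      next
        assume "r = 5"
        then have "y mod int r \<in> {0, 1, 2, 3, 4}" using \<open>0 \<le> y mod int r \<and> y mod int r < int r\<close> by auto
        then show ?thesis using \<open>y^2 mod int r = (y mod int r)^2 mod int r\<close> \<open>r = 5\<close> by auto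
      qed
    qed
    then show ?thesis using qr by (auto simp: QuadRes_def cong_def)
  qed
  have "prime (3::nat)" "prime (5::nat)" by simp_all
  then show "Legendre 3 (int q) = - 1" "Legendre 5 (int q) = - 1"
    using r[of 3] r[of 5] nq[of 3] nq[of 5] q_gt_5 by (auto simp: Legendre_def)
qed

lemma Legendre_6_30: "Legendre 6 (int q) = - 1" "Legendre 30 (int q) = 1"
proof -
  let ?h = "(q - 1) div 2"
  have 3: "[3 ^ ?h = - 1] (mod int q)" and 5: "[5 ^ ?h = - 1] (mod int q)"
    using power_of_Legendre[of 3] power_of_Legendre[of 5] Legendre_3_5 by simp_all
  have "[2 ^ ?h * 3 ^ ?h = 1 * - 1] (mod int q)" by (rule cong_mult[OF Legendre_two 3])
  then have 6: "[6 ^ ?h = - 1] (mod int q)" by (simp flip: power_mult_distrib)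
  then show "Legendre 6 (int q) = - 1" by (rule Legendre_value) simp
  have "[6 ^ ?h * 5 ^ ?h = - 1 * - 1] (mod int q)" by (rule cong_mult[OF 6 5])
  then have "[30 ^ ?h = 1] (mod int q)" by (simp flip: power_mult_distrib)
  then show "Legendre 30 (int q) = 1" by (rule Legendre_value) simp
qed

end

subsection \<open>The prime field with a prescribed number of elements\<close>

class prime_card_gt_5 = prime_card +
  assumes card_gt_5: "5 < CARD('a)"

lemma of_int_mod_ring_eq_0_iff: "of_int x = (0 :: 'a::prime_card mod_ring) \<longleftrightarrow> int CARD('a) dvd x"
  by (simp add: of_int_eq_0_iff_char_dvd)

instance mod_ring :: (prime_card_gt_5) field_30
proof
  have "\<not> CARD('a) dvd 30"
  proof
    assume "CARD('a) dvd 30"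
    then have "CARD('a) dvd 2 * 3 * 5" by simp
    then have "CARD('a) dvd 2 \<or> CARD('a) dvd 3 \<or> CARD('a) dvd 5"
      using prime_card[where 'a='a] by (simp only: prime_dvd_mult_iff) blast
    then show False using card_gt_5[where 'a='a] by (auto dest!: dvd_imp_le)
  qed
  then have "\<not> int CARD('a) dvd int 30" by (simp only: int_dvd_int_iff) simp
  then have "(of_int (int 30) :: 'a mod_ring) \<noteq> 0" unfolding of_int_mod_ring_eq_0_iff .
  then show "(30 :: 'a mod_ring) \<noteq> 0" by simp
qed

text \<open>What the finite field is used for in both directions, as a statement about the number
  \<open>q\<close> alone, so that it can pass from the cardinality of a type to any prime.\<close>

definition claim_at :: "nat \<Rightarrow> bool" where
  "claim_at q \<longleftrightarrow> (\<forall>p n. prime p \<longrightarrow> p mod 10 = 1 \<or> p mod 10 = 9 \<longrightarrow> n > 0 \<longrightarrow>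
     (q = p^2 * 16^n + 1 \<longrightarrow> congr_cond p n) \<and>
     (q dvd p^2 * 16^n + 1 \<longrightarrow> congr_cond p n \<longrightarrow> 16^n \<le> 2 * q + 1))"

lemma claim_at_mod_ring: "claim_at CARD('a::prime_card_gt_5)"
  unfolding claim_at_def
proof (intro allI impI conjI)
  fix p n :: nat
  assume p: "prime p" "p mod 10 = 1 \<or> p mod 10 = 9" and n: "n > 0"
  let ?N = "p^2 * 16^n + 1"
  {
    assume q: "CARD('a) = ?N"
    have e: "(16::nat)^n = (4^n)^2" by (rule sixteen_power)
    have qm: "?N = (p * 4^n)^2 + 1" unfolding e by (simp add: power_mult_distrib)
    have prN: "prime ?N" using prime_card[where 'a='a] q by simp
    note L = Legendre_6_30[OF prN qm residues_of_N[OF p n]]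
    have cg: "[a = b] (mod int ?N) \<longleftrightarrow> of_int a = (of_int b :: 'a mod_ring)" for a b
      using of_int_mod_ring_eq_0_iff[of "a - b", where 'a='a] unfolding q by (simp add: cong_iff_dvd_diff)
    have "QuadRes (int ?N) 30" using L(2) by (simp add: Legendre_def split: if_splits)
    then obtain y where "(of_int (y^2) :: 'a mod_ring) = of_int 30" unfolding QuadRes_def cg by blast
    then have s: "(of_int y :: 'a mod_ring)^2 = 30" by simp
    have n6: "\<not> QuadRes (int ?N) 6" using L(1) by (simp add: Legendre_def split: if_splits)
    have six: "\<not> (\<exists>s::'a mod_ring. s^2 = 6)"
    proof
      assume "\<exists>s::'a mod_ring. s^2 = 6"
      then obtain s :: "'a mod_ring" where s: "s^2 = 6" by blast
      obtain k where "s = of_nat k" using surj_of_nat_mod_ring by blast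
      then have "of_int ((int k)^2) = (of_int 6 :: 'a mod_ring)" using s by simp
      then have "[(int k)^2 = 6] (mod int ?N)" unfolding cg .
      then show False using n6 unfolding QuadRes_def by blast
    qed
    have card: "CARD('a mod_ring) = CARD('a)" by simp
    show "congr_cond p n"
    proof (rule congr_cond_of_prime[where 'a="'a mod_ring"])
      show "t ^ CARD('a mod_ring) = t" for t :: "'a mod_ring" by (rule finite_field_power_card_eq_same)
      show "of_int x = (0 :: 'a mod_ring) \<longleftrightarrow> int CARD('a mod_ring) dvd x" for x
        unfolding card by (rule of_int_mod_ring_eq_0_iff)
    qed (use card q prN odd_p[OF p(2)] n s six in \<open>simp_all only: not_False_eq_True\<close>)
  next
    assume d: "CARD('a) dvd ?N" and cc: "congr_cond p n"
    have "int CARD('a) dvd int ?N" using d by (simp only: int_dvd_int_iff)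
    then have "(of_int (int ?N) :: 'a mod_ring) = 0" unfolding of_int_mod_ring_eq_0_iff .
    then have "(of_nat ?N :: 'a mod_ring) = 0" by (simp only: of_int_of_nat_eq)
    then show "16^n \<le> 2 * CARD('a) + 1" using congr_cond_bound[OF _ n cc, where 'a="'a mod_ring"] by simp
  }
qed

text \<open>Types cannot depend on the number \<open>q\<close>, so the statement is proved for a field whose
  cardinality is chosen to be a counterexample, should there be one.\<close>
definition bad_prime :: nat where
  "bad_prime = (if \<exists>q. prime q \<and> 5 < q \<and> \<not> claim_at q
     then SOME q. prime q \<and> 5 < q \<and> \<not> claim_at q else 7)"

text \<open>The default 7 is a prime above 5, so the index type exists with the required cardinality
  even when there is no counterexample.\<close>

lemma bad_prime: "prime bad_prime \<and> 5 < bad_prime"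
proof (cases "\<exists>q. prime q \<and> 5 < q \<and> \<not> claim_at q")
  case True
  then show ?thesis unfolding bad_prime_def using someI_ex[OF True] by simp
next
  case False
  then have "bad_prime = 7" by (simp only: bad_prime_def if_False)
  moreover have "prime (7::nat)" by simp
  ultimately show ?thesis by simp
qed

typedef bad_index = "{0..<bad_prime}"
  using bad_prime by (intro exI[of _ 0]) simp

lemma CARD_bad_index: "CARD(bad_index) = bad_prime"
  using type_definition.card[OF type_definition_bad_index] by simp

instance bad_index :: prime_card_gt_5
  by standard (use bad_prime in \<open>simp_all add: CARD_bad_index\<close>)

lemma claim_at_prime:
  assumes "prime q" "5 < q"
  shows "claim_at q"
proof (rule ccontr)
  assume "\<not> claim_at q"
  then have ex: "\<exists>q. prime q \<and> 5 < q \<and> \<not> claim_at q" using assms by blast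
  then have "\<not> claim_at bad_prime" unfolding bad_prime_def using someI_ex[OF ex] by simp
  then show False using claim_at_mod_ring[where 'a=bad_index] by (simp add: CARD_bad_index)
qed

section \<open>The primality criterion\<close>

lemma small_prime_factor:
  fixes N :: nat
  assumes "N > 1" "\<not> prime N"
  obtains q where "prime q" "q dvd N" "q^2 \<le> N"
proof -
  obtain a where a: "a dvd N" "a \<noteq> 1" "a \<noteq> N" using assms by (auto simp: prime_nat_iff)
  then obtain b where b: "N = a * b" by blast
  have "a \<noteq> 0" "b \<noteq> 0" using b assms(1) by (metis mult_zero_left mult_zero_right not_less_zero)+
  moreover have "b \<noteq> 1" using a b by auto
  ultimately have ab: "N = a * b" "1 < a" "1 < b" using a b by linarith+
  define d where "d = min a b"
  have "d dvd N" "1 < d" "d^2 \<le> N"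
    using ab by (auto simp: d_def min_def power2_eq_square)
  obtain q where q: "prime q" "q dvd d" using \<open>1 < d\<close> prime_factor_nat[of d] by auto
  then have "q \<le> d" using \<open>1 < d\<close> by (auto dest: dvd_imp_le)
  then have "q^2 \<le> N" using \<open>d^2 \<le> N\<close> by (meson order_trans power_mono zero_le)
  then show ?thesis using that q \<open>d dvd N\<close> dvd_trans by blast
qed

theorem theorem5:
  fixes p n :: nat
  assumes "prime p" and "p mod 10 = 1 \<or> p mod 10 = 9"
    and "n > 0" and "p < 2 ^ n"
  shows "prime (p^2 * 16^n + 1) \<longleftrightarrow> congr_cond p n"
proof
  let ?N = "p^2 * 16^n + 1"
  note r = residues_of_N[OF assms(1-3)]
  assume "prime ?N"
  moreover have "5 < ?N" by (rule prime_factor_gt_5[OF r \<open>prime ?N\<close>]) simp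
  ultimately show "congr_cond p n" using claim_at_prime[of ?N] assms(1-3) unfolding claim_at_def by blast
next
  let ?N = "p^2 * 16^n + 1"
  note r = residues_of_N[OF assms(1-3)]
  assume cc: "congr_cond p n"
  show "prime ?N"
  proof (rule ccontr)
    assume "\<not> prime ?N"
    moreover have "?N > 1" using assms(1) by (simp add: prime_gt_0_nat)
    ultimately obtain q where q: "prime q" "q dvd ?N" "q^2 \<le> ?N" using small_prime_factor by blast
    have "5 < q" by (rule prime_factor_gt_5[OF r q(1,2)])
    then have b: "16^n \<le> 2 * q + 1" using claim_at_prime[OF q(1)] assms(1-3) q(2) cc unfolding claim_at_def by blast
    \<comment> \<open>The size condition on \<open>p\<close> puts \<open>p^2 * 16^n\<close> strictly
      below \<open>64^n = (8^n)^2\<close>; strictness absorbs the final \<open>+ 1\<close> of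
      \<open>N\<close>.\<close>
    have "p^2 < (2^n)^2" using assms(4) by (intro power_strict_mono) auto
    then have "p^2 * 16^n < (2^n)^2 * 16^n" by simp
    also have "(2^n)^2 * 16^n = (8^n)^2 * (1::nat)"
    proof -
      have e: "(8::nat)^n = 2^n * 4^n" by (simp flip: power_mult_distrib)
      have e': "(16::nat)^n = (4^n)^2" by (rule sixteen_power)
      show ?thesis unfolding e e' by (simp add: power_mult_distrib)
    qed
    finally have "p^2 * 16^n < (8^n)^2" by simp
    then have "q^2 \<le> (8^n)^2" using q(3) by linarith
    then have "q \<le> 8^n" by (simp only: power2_nat_le_eq_le)
    \<comment> \<open>For \<open>n = 1\<close> no prime satisfies \<open>p < 2^n\<close>. From
      \<open>n = 2\<close> on, \<open>16^n\<close> is at least \<open>4 * 8^n\<close>, too much for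
      the bound \<open>2 * 8^n + 1\<close>.\<close>
    have n2: "2 \<le> n"
    proof (rule ccontr)
      assume "\<not> 2 \<le> n"
      then have "n = 1" using assms(3) by simp
      then show False using assms(4) prime_ge_2_nat[OF assms(1)] by simp
    qed
    have "4 * (8::nat)^n \<le> 2^n * 8^n" using n2 power_increasing[of 2 n "2::nat"] by simp
    also have "\<dots> = 16^n" by (simp flip: power_mult_distrib)
    finally have "4 * 8^n \<le> 2 * 8^n + (1::nat)" using b \<open>q \<le> 8^n\<close> by linarith
    moreover have "(1::nat) \<le> 8^n" by simp
    ultimately show False by linarith
  qed
qed

end
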